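(* Let $x\in D_1^+$, $\nu\in\mathbb{C}$, $\mu\in\mathbb{C}\setminus\mathbb{Z}$, $\nu+\mu\in\mathbb{C}\setminus-\mathbb{N}$. Then $$\mathsf{Q}_\nu^\mu(x)=\frac{2^{\mu-1}\Gamma(\mu)\cos(\pi\mu)}{(1-x^2)^{\frac12\mu}}{}_2F_1\!\left(\frac{\nu-\mu+1}{2},\frac{-\nu-\mu}{2};1-\mu;1-x^2\right)+\frac{\Gamma(-\mu)\Gamma(\nu+\mu+1)(1-x^2)^{\frac12\mu}}{2^{1+\mu}\Gamma(\nu-\mu+1)}{}_2F_1\!\left(\frac{\nu+\mu+1}{2},\frac{\mu-\nu}{2};1+\mu;1-x^2\right).$$
   Context: $\mathbb{N}=\{1,2,3,\dots\}$, $-\mathbb{N}=\{-1,-2,\dots\}$. $D_1=\mathbb{C}\setminus((-\infty,-1]\cup[1,\infty))$, $D_1^+=D_1\cap\{x:\operatorname{Re}x>0\}$, $D_2=\mathbb{C}\setminus(-\infty,1]$. Complex powers are principal values. ${}_2F_1(a,b;c;w)$ is the Gauss hypergeometric function, principal branch on $\mathbb{C}\setminus[1,\infty)$ (the analytic continuation of $\sum_{n\ge0}\frac{(a)_n(b)_n}{(c)_n}\frac{w^n}{n!}$). $1/\Gamma$ is read as the entire function (zero at the poles of $\Gamma$), and a quotient ${}_2F_1(a,b;c;w)/\Gamma(c)$ with $c\in\{0,-1,-2,\dots\}$ is read as the regularized function (continuous in $c$). Associated Legendre function of the second kind: for $z\in D_2$, $\nu+\mu\in\mathbb{C}\setminus-\mathbb{N}$,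 $$Q_\nu^\mu(z)=\frac{\sqrt{\pi}\,e^{i\pi\mu}\Gamma(\nu+\mu+1)(z^2-1)^{\frac12\mu}}{2^{\nu+1}\Gamma(\nu+\frac32)z^{\nu+\mu+1}}\,{}_2F_1\!\left(\tfrac{\nu+\mu+2}{2},\tfrac{\nu+\mu+1}{2};\nu+\tfrac32;\tfrac1{z^2}\right),$$ where $(z^2-1)^\alpha:=(z+1)^\alpha(z-1)^\alpha$. Ferrers function of the second kind: for $x\in(-1,1)$, $$\mathsf{Q}_\nu^\mu(x)=\tfrac12\big[e^{-\frac12 i\pi\mu}\,e^{-i\pi\mu}Q_\nu^\mu(x+i0)+e^{\frac12 i\pi\mu}\,e^{-i\pi\mu}Q_\nu^\mu(x-i0)\big],$$ where $x\pm i0$ denotes the limit from the upper/lower half-plane, and $\mathsf{Q}_\nu^\mu$ is extended analytically to $D_1$. *)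

theory Defs
  imports "HOL-Complex_Analysis.Complex_Analysis"
begin

definition D1 :: "complex set" where
  "D1 = - complex_of_real ` ({..-1} \<union> {1..})"

definition D1_plus :: "complex set" where
  "D1_plus = D1 \<inter> {x. Re x > 0}"

text \<open>
  Analytic continuation from \<open>A\<close> to \<open>U\<close> of a function \<open>f\<close> given on \<open>A\<close>. Where it is used below,
  \<open>U\<close> is open and connected and \<open>A\<close> has a limit point in \<open>U\<close>, so the values on \<open>U\<close> are
  determined as soon as a continuation exists; its existence is not built in.
\<close>
definition analytic_extension ::
    "complex set \<Rightarrow> complex set \<Rightarrow> (complex \<Rightarrow> complex) \<Rightarrow> complex \<Rightarrow> complex" where
  "analytic_extension A U f = (SOME g. g holomorphic_on U \<and> (\<forall>z\<in>A. g z = f z))"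

text \<open>Gauss hypergeometric function, principal branch; meaningful for \<open>c \<notin> \<int>\<^sub>\<le>\<^sub>0\<close>.\<close>
definition hyp2F1 :: "complex \<Rightarrow> complex \<Rightarrow> complex \<Rightarrow> complex \<Rightarrow> complex" where
  "hyp2F1 a b c =
     analytic_extension (ball 0 1) (- complex_of_real ` {1..})
       (\<lambda>w. \<Sum>n. pochhammer a n * pochhammer b n / pochhammer c n * w ^ n / fact n)"

text \<open>
  The quotient of \<open>hyp2F1 a b c w\<close> by \<open>Gamma c\<close>. At the poles of \<open>Gamma\<close> it is the regularized
  hypergeometric function, whose coefficients are the entire functions of \<open>c\<close> obtained from
  \<open>1 / (Gamma c * pochhammer c n) = rGamma (c + of_nat n)\<close>; this makes it continuous in \<open>c\<close>.
\<close>
definition hyp2F1_over_Gamma :: "complex \<Rightarrow> complex \<Rightarrow> complex \<Rightarrow> complex \<Rightarrow> complex" where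
  "hyp2F1_over_Gamma a b c w =
     (if c \<in> \<int>\<^sub>\<le>\<^sub>0 then
        analytic_extension (ball 0 1) (- complex_of_real ` {1..})
          (\<lambda>w. \<Sum>n. pochhammer a n * pochhammer b n * rGamma (c + of_nat n) * w ^ n / fact n) w
      else hyp2F1 a b c w / Gamma c)"

text \<open>
  Associated Legendre function of the second kind of degree \<open>\<nu>\<close> and order \<open>\<mu>\<close>, for \<open>z\<close> outside
  \<open>(-\<infinity>, 1]\<close>. The factor \<open>(z\<^sup>2 - 1)\<^sup>\<mu>\<^sup>/\<^sup>2\<close> means \<open>(z + 1)\<^sup>\<mu>\<^sup>/\<^sup>2 (z - 1)\<^sup>\<mu>\<^sup>/\<^sup>2\<close>, which is not the principal
  power of \<open>z\<^sup>2 - 1\<close>.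
\<close>
definition legendre_Q :: "complex \<Rightarrow> complex \<Rightarrow> complex \<Rightarrow> complex" where
  "legendre_Q \<nu> \<mu> z =
     of_real (sqrt pi) * exp (\<i> * of_real pi * \<mu>) * Gamma (\<nu> + \<mu> + 1)
       * ((z + 1) powr (\<mu> / 2) * (z - 1) powr (\<mu> / 2))
       / (2 powr (\<nu> + 1) * z powr (\<nu> + \<mu> + 1))
       * hyp2F1_over_Gamma ((\<nu> + \<mu> + 2) / 2) ((\<nu> + \<mu> + 1) / 2) (\<nu> + 3 / 2) (1 / z\<^sup>2)"

text \<open>
  Ferrers function of the second kind, first on the interval \<open>(-1, 1)\<close> from the boundary values of
  \<open>legendre_Q\<close> on both sides of the cut, then on \<open>D1\<close>.
\<close>
definition ferrers_Q_interval :: "complex \<Rightarrow> complex \<Rightarrow> complex \<Rightarrow> complex" where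
  "ferrers_Q_interval \<nu> \<mu> x =
     1 / 2 *
      (exp (- (\<i> * of_real pi * \<mu> / 2)) * exp (- (\<i> * of_real pi * \<mu>))
         * Lim (at x within {z. Im z > 0}) (legendre_Q \<nu> \<mu>)
       + exp (\<i> * of_real pi * \<mu> / 2) * exp (- (\<i> * of_real pi * \<mu>))
         * Lim (at x within {z. Im z < 0}) (legendre_Q \<nu> \<mu>))"

definition ferrers_Q :: "complex \<Rightarrow> complex \<Rightarrow> complex \<Rightarrow> complex" where
  "ferrers_Q \<nu> \<mu> =
     analytic_extension (complex_of_real ` {-1<..<1}) D1 (ferrers_Q_interval \<nu> \<mu>)"

end

theory Submission
  imports Defs
begin

text \<open>
  Up to elementary factors, \<open>legendre_Q\<close> solves the Gegenbauer equation
  \<open>(1 - z\<^sup>2) y'' - 2 (\<mu> + 1) z y' + (\<nu> - \<mu>) (\<nu> + \<mu> + 1) y = 0\<close>, whose solutions near \<open>z = 1\<close> are combinations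
  \<open>A u + B (z\<^sup>2 - 1)\<^sup>-\<^sup>\<mu> v\<close> of the two hypergeometric functions of the claim. For \<open>Re \<mu> > 0\<close> the second
  part dominates, and comparing the hypergeometric series with the binomial series gives \<open>B\<close>; differentiation
  shifts \<open>\<mu>\<close> to \<open>\<mu> + 1\<close> and so gives \<open>B\<close> for all \<open>\<mu>\<close>, while Euler's transformation exchanges \<open>\<mu>\<close> and \<open>- \<mu>\<close>
  and gives \<open>A\<close>. On the two sides of the cut, \<open>(z\<^sup>2 - 1)\<^sup>-\<^sup>\<mu>\<close> is \<open>exp (\<mp> \<i> \<pi> \<mu>) (1 - z\<^sup>2)\<^sup>-\<^sup>\<mu>\<close>, which
  averages to the factor \<open>cos (\<pi> \<mu>)\<close>. All of this rests on the continuation of the regularized series to the plane cut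
  along \<open>[1, \<infinity>)\<close>: the substitution \<open>w = 4 t / (1 + t)\<^sup>2\<close> maps the unit disc onto that domain, and the transformed
  equation has its only other singular points on the unit circle.
\<close>

section \<open>The cut plane and the majorant argument\<close>

text \<open>\<open>analytic_extension\<close> is a choice, so nothing is known about
  \<open>hyp2F1\<close> or \<open>ferrers_Q\<close> before some continuation has been exhibited;
  both existence proofs are part of the argument. For the Ferrers function the obstacle is that the
  two functions of the claim are at hand only for \<open>Re z > 0\<close>, while the continuation
  has to cover all of \<open>D1\<close>. The even and the odd hypergeometric solution in the
  variable \<open>z\<^sup>2\<close> are holomorphic on all of \<open>D1\<close>. In each open half
  plane the Legendre function, freed of its elementary factors, is a combination of these two; the
  coefficients are never computed, but the combination carries the function across the interval. In
  the right half of \<open>D1\<close> the identity theorem then replaces it by the expansion at 1,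
  whose coefficients are explicit. Regularized series are used throughout, because the parameter
  \<open>\<nu> + 3 / 2\<close> of the Legendre function may be a nonpositive integer.\<close>

lemma analytic_extension_eq:
  assumes "open U" "connected U" "A \<subseteq> U" "\<xi> \<in> U" "\<xi> islimpt A"
    and g: "g holomorphic_on U" "\<And>z. z \<in> A \<Longrightarrow> g z = f z" and "z \<in> U"
  shows "analytic_extension A U f z = g z"
proof -
  define h where "h = analytic_extension A U f"
  have "h holomorphic_on U \<and> (\<forall>z\<in>A. h z = f z)"
    unfolding h_def analytic_extension_def by (rule someI[of _ g]) (use g in auto)
  then have "(\<lambda>z. h z - g z) holomorphic_on U" "\<And>z. z \<in> A \<Longrightarrow> h z - g z = 0"
    using g by (auto intro!: holomorphic_intros)
  from analytic_continuation[OF this(1) assms(1-5) this(2) \<open>z \<in> U\<close>]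
  show ?thesis by (simp add: h_def)
qed

abbreviation slit_plane :: "complex set" where
  "slit_plane \<equiv> - complex_of_real ` {1..}"

lemma slit_plane_iff: "z \<in> slit_plane \<longleftrightarrow> Im z \<noteq> 0 \<or> Re z < 1"
  by (auto simp: image_iff complex_eq_iff not_le)

lemma open_slit_plane: "open slit_plane"
proof -
  have "slit_plane = {z. Im z < 0} \<union> {z. Im z > 0} \<union> {z. Re z < 1}"
    using slit_plane_iff by auto
  then show ?thesis
    by (metis open_Un open_halfspace_Im_gt open_halfspace_Im_lt open_halfspace_Re_lt)
qed

lemma connected_slit_plane: "connected slit_plane"
proof (rule starlike_imp_connected)
  show "starlike slit_plane"
    unfolding starlike_def
  proof (intro bexI[of _ 0] ballI subsetI)
    fix x z assume x: "x \<in> slit_plane" and "z \<in> closed_segment 0 x"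
    then obtain u where u: "0 \<le> u" "u \<le> 1" "z = u *\<^sub>R x" by (auto simp: in_segment)
    have "u * Re x < 1" if "Re x < 1"
      using that u by (metis mult_left_le_one_le mult_nonneg_nonpos linorder_linear order_le_less_trans zero_less_one)
    then show "z \<in> slit_plane"
      using u x unfolding slit_plane_iff by auto
  qed (auto simp: slit_plane_iff)
qed

lemma ball_subset_slit_plane: "ball 0 1 \<subseteq> slit_plane"
proof
  fix z :: complex assume "z \<in> ball 0 1"
  then show "z \<in> slit_plane"
    using complex_Re_le_cmod[of z] by (auto simp: slit_plane_iff simp del: Compl_iff)
qed

text \<open>
  The majorant argument of Fuchs: a formal solution at the regular singular point \<open>0\<close> converges as far
  as the coefficients of the equation do.
\<close>
lemma fps_conv_radius_Fuchs:
  fixes \<phi> p q :: "complex fps"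
  assumes eq: "fps_X * fps_deriv (fps_deriv \<phi>) + fps_deriv \<phi> = p * fps_deriv \<phi> + q * \<phi>"
    and p: "fps_conv_radius p \<ge> 1" and q: "fps_conv_radius q \<ge> 1"
  shows "fps_conv_radius \<phi> \<ge> 1"
proof -
  define f where "f = fps_nth \<phi>"
  \<comment> \<open>Coefficient of index n - 1 in \<open>eq\<close>. The constant term of p is the
    only one that meets \<open>f n\<close> and is moved to the left.\<close>
  have rec: "of_nat n * (of_nat n - fps_nth p 0) * f n
     = (\<Sum>k<n. (fps_nth p (n - k) * of_nat k + fps_nth q (n - 1 - k)) * f k)" if "n \<ge> 1" for n
  proof -
    obtain m where m: "n = Suc m" using \<open>n \<ge> 1\<close> by (cases n) auto
    have "fps_nth (fps_X * fps_deriv (fps_deriv \<phi>) + fps_deriv \<phi>) m = of_nat n * of_nat n * f n"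
      unfolding m f_def by (cases m) (auto simp: algebra_simps)
    moreover have "fps_nth (p * fps_deriv \<phi>) m = (\<Sum>k\<le>m. fps_nth p (m - k) * (of_nat (Suc k) * f (Suc k)))"
      by (simp only: mult.commute[of p] fps_mult_nth) (simp add: f_def atLeast0AtMost mult_ac)
    moreover have "(\<Sum>k\<le>m. fps_nth p (m - k) * (of_nat (Suc k) * f (Suc k)))
      = (\<Sum>k\<le>n. fps_nth p (n - k) * (of_nat k * f k))"
      unfolding m by (subst sum.atMost_Suc_shift) simp
    moreover have "\<dots> = fps_nth p 0 * of_nat n * f n + (\<Sum>k<n. fps_nth p (n - k) * of_nat k * f k)"
      by (simp add: lessThan_Suc_atMost[symmetric] mult_ac)
    moreover have "fps_nth (q * \<phi>) m = (\<Sum>k<n. fps_nth q (n - 1 - k) * f k)"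
      by (simp only: mult.commute[of q] fps_mult_nth) (simp add: f_def atLeast0AtMost m lessThan_Suc_atMost mult_ac)
    ultimately have "of_nat n * of_nat n * f n = fps_nth p 0 * of_nat n * f n
        + (\<Sum>k<n. fps_nth p (n - k) * of_nat k * f k) + (\<Sum>k<n. fps_nth q (n - 1 - k) * f k)"
      using arg_cong[OF eq, of "\<lambda>F. fps_nth F m"] by simp
    then show ?thesis by (simp add: algebra_simps sum.distrib)
  qed
  have bnd: "\<exists>M>0. \<forall>k. norm (fps_nth F k) * r ^ k \<le> M"
    if "fps_conv_radius F \<ge> 1" "0 < r" "r < 1" for F :: "complex fps" and r :: real
  proof -
    have "ereal (norm (of_real r :: complex)) < 1" using that by simp
    also have "1 \<le> conv_radius (fps_nth F)" using that by (simp add: fps_conv_radius_def)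
    finally have "ereal (norm (of_real r :: complex)) < conv_radius (fps_nth F)" .
    then have "summable (\<lambda>k. fps_nth F k * of_real r ^ k)"
      using summable_in_conv_radius by blast
    then have "Bseq (\<lambda>k. fps_nth F k * of_real r ^ k)"
      using convergent_imp_Bseq summable_LIMSEQ_zero convergentI by blast
    then show ?thesis
      unfolding Bseq_def using that by (auto simp: norm_mult norm_power)
  qed
  have main: "\<exists>C. \<forall>n. norm (f n) * \<rho> ^ n \<le> C" if "0 < \<rho>" "\<rho> < 1" for \<rho> :: real
  proof -
    define r where "r = (\<rho> + 1) / 2"
    have r: "0 < r" "r < 1" "\<rho> < r" using that by (auto simp: r_def)
    obtain M1 where M1: "M1 > 0" "\<And>k. norm (fps_nth p k) * r ^ k \<le> M1" using bnd[OF p] r by blast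
    obtain M2 where M2: "M2 > 0" "\<And>k. norm (fps_nth q k) * r ^ k \<le> M2" using bnd[OF q] r by blast
    define M where "M = max M1 M2"
    have M: "M > 0" "\<And>k. norm (fps_nth p k) \<le> M / r ^ k" "\<And>k. norm (fps_nth q k) \<le> M / r ^ k"
      using M1 M2 r by (auto simp: M_def field_simps le_max_iff_disj)
    define s where "s = \<rho> / r"
    have s: "0 < s" "s < 1" using r that by (auto simp: s_def)
    \<comment> \<open>K is the geometric sum that bounds the right-hand side of the recurrence.
      Beyond N the factor \<open>n - p\<^sub>0\<close> on the left has norm at least K, so the
      induction reproduces the same constant C; the indices up to N are covered by the
      maximum.\<close>
    define K where "K = M / (1 - s)"
    obtain N :: nat where N: "real N > norm (fps_nth p 0) + K" "N \<ge> 1"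
      by (metis add_increasing2 le_add2 of_nat_1 of_nat_add of_nat_less_iff order_less_le_trans plus_1_eq_Suc reals_Archimedean2 zero_le_one nat_le_linear of_nat_mono)
    define C where "C = Max ((\<lambda>n. norm (f n) * \<rho> ^ n) ` {..N})"
    have C0: "norm (f n) * \<rho> ^ n \<le> C" if "n \<le> N" for n
      unfolding C_def using that by (intro Max_ge) auto
    have Cpos: "C \<ge> 0" using C0[of 0] by (smt (verit) le0 norm_ge_zero power_0 mult_cancel_left1 mult.right_neutral)
    have "norm (f n) * \<rho> ^ n \<le> C" for n
    proof (induction n rule: less_induct)
      case (less n)
      show ?case
      proof (cases "n \<le> N")
        case False
        then have n: "n \<ge> 1" "n > N" by auto
        have "K \<le> real n - norm (fps_nth p 0)" using n N by (simp add: less_imp_le)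
        also have "\<dots> \<le> norm (of_nat n - fps_nth p 0)"
          by (metis norm_of_nat norm_triangle_ineq2)
        finally have K: "K \<le> norm (of_nat n - fps_nth p 0)" .
        have Kp: "K > 0" using M s by (simp add: K_def)
        \<comment> \<open>The factor k from the derivative and one further unit for q add up to
          \<open>k + 1 \<le> n\<close>; this n is cancelled by the factor n on the left of the
          recurrence.\<close>
        have term_le: "norm ((fps_nth p (n - k) * of_nat k + fps_nth q (n - 1 - k)) * f k) * \<rho> ^ n
            \<le> real n * M * C * s ^ (n - k)" if "k < n" for k
        proof -
          have "norm (fps_nth q (n - 1 - k)) \<le> M / r ^ (n - 1 - k)" by (rule M)
          also have "\<dots> \<le> M / r ^ (n - k)"
            using M(1) r that by (intro divide_left_mono power_decreasing) auto
          finally have "norm (fps_nth q (n - 1 - k)) \<le> M / r ^ (n - k)" .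
          moreover have "norm (fps_nth p (n - k) * of_nat k) \<le> M / r ^ (n - k) * real k"
            unfolding norm_mult norm_of_nat by (intro mult_right_mono M) auto
          ultimately have "norm (fps_nth p (n - k) * of_nat k + fps_nth q (n - 1 - k))
              \<le> M / r ^ (n - k) * real k + M / r ^ (n - k)"
            by (intro norm_triangle_mono)
          also have "\<dots> = M / r ^ (n - k) * (real k + 1)" by (simp add: distrib_left)
          also have "\<dots> \<le> M / r ^ (n - k) * real n"
            using that M r by (intro mult_left_mono) auto
          finally have "norm (fps_nth p (n - k) * of_nat k + fps_nth q (n - 1 - k)) \<le> M / r ^ (n - k) * real n" .
          then have "norm ((fps_nth p (n - k) * of_nat k + fps_nth q (n - 1 - k)) * f k) * \<rho> ^ n
             \<le> M / r ^ (n - k) * real n * norm (f k) * \<rho> ^ n"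
            unfolding norm_mult using \<open>0 < \<rho>\<close> by (intro mult_right_mono) auto
          also have "M / r ^ (n - k) * real n * norm (f k) * \<rho> ^ n
             = real n * M * s ^ (n - k) * (norm (f k) * \<rho> ^ k)"
          proof -
            have "\<rho> ^ n = \<rho> ^ k * \<rho> ^ (n - k)" using that by (simp flip: power_add)
            then show ?thesis by (simp add: s_def power_divide)
          qed
          also have "\<dots> \<le> real n * M * s ^ (n - k) * C"
            using less.IH[OF that] M s by (intro mult_left_mono) auto
          finally show ?thesis by (simp add: mult_ac)
        qed
        have "(\<Sum>k<n. s ^ (n - k)) = (\<Sum>j=1..n. s ^ j)"
          by (rule sum.reindex_bij_witness[of _ "\<lambda>j. n - j" "\<lambda>k. n - k"]) auto
        also have "\<dots> \<le> (\<Sum>j<Suc n. s ^ j)" using s by (intro sum_mono2) auto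
        also have "\<dots> \<le> 1 / (1 - s)"
          using s by (subst geometric_sum) (auto simp: field_simps)
        finally have geo: "(\<Sum>k<n. s ^ (n - k)) \<le> 1 / (1 - s)" .
        have "real n * K * (norm (f n) * \<rho> ^ n) \<le> real n * norm (of_nat n - fps_nth p 0) * (norm (f n) * \<rho> ^ n)"
          using K that by (intro mult_right_mono mult_left_mono) auto
        also have "\<dots> = norm (of_nat n * (of_nat n - fps_nth p 0) * f n) * \<rho> ^ n"
          by (simp add: norm_mult)
        also have "\<dots> = norm (\<Sum>k<n. (fps_nth p (n - k) * of_nat k + fps_nth q (n - 1 - k)) * f k) * \<rho> ^ n"
          using rec[OF n(1)] by simp
        also have "\<dots> \<le> (\<Sum>k<n. norm ((fps_nth p (n - k) * of_nat k + fps_nth q (n - 1 - k)) * f k)) * \<rho> ^ n"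
          using \<open>0 < \<rho>\<close> by (intro mult_right_mono norm_sum) auto
        also have "\<dots> \<le> (\<Sum>k<n. real n * M * C * s ^ (n - k))"
          unfolding sum_distrib_right by (intro sum_mono term_le) auto
        also have "\<dots> = real n * M * C * (\<Sum>k<n. s ^ (n - k))" by (simp add: sum_distrib_left)
        also have "\<dots> \<le> real n * M * C * (1 / (1 - s))"
          using geo M Cpos by (intro mult_left_mono) auto
        also have "\<dots> = real n * K * C" by (simp add: K_def)
        finally show ?thesis using n Kp by simp
      qed (rule C0)
    qed
    then show ?thesis by blast
  qed
  show ?thesis
    unfolding fps_conv_radius_def
  proof (rule conv_radius_geI_ex')
    fix r assume r: "0 < r" "ereal r < 1"
    define \<rho> where "\<rho> = (r + 1) / 2"
    have \<rho>: "0 < \<rho>" "\<rho> < 1" "r < \<rho>" using r by (auto simp: \<rho>_def)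
    obtain C where C: "\<And>n. norm (f n) * \<rho> ^ n \<le> C" using main \<rho> by blast
    have "summable (\<lambda>n. C * (r / \<rho>) ^ n)"
      using r \<rho> by (intro summable_mult summable_geometric) auto
    moreover have "norm (f n * of_real r ^ n) \<le> C * (r / \<rho>) ^ n" for n
    proof -
      have "norm (f n * of_real r ^ n) = (norm (f n) * \<rho> ^ n) * (r / \<rho>) ^ n"
        using r \<rho> by (simp add: norm_mult norm_power power_divide)
      also have "\<dots> \<le> C * (r / \<rho>) ^ n" using C[of n] r \<rho> by (intro mult_right_mono) auto
      finally show ?thesis .
    qed
    ultimately show "summable (\<lambda>n. fps_nth \<phi> n * of_real r ^ n)"
      unfolding f_def by (rule summable_comparison_test'[where N = 0])
  qed
qed

section \<open>The regularized hypergeometric function\<close>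

definition hyp_fps :: "complex \<Rightarrow> complex \<Rightarrow> complex \<Rightarrow> complex fps" where
  "hyp_fps a b c = Abs_fps (\<lambda>n. pochhammer a n * pochhammer b n * rGamma (c + of_nat n) / fact n)"

text \<open>The expression by which \<open>hyp2F1_over_Gamma\<close> is defined at the poles of
  Gamma, here for every c, which removes the case distinction from everything that follows.\<close>

definition reg_hyp2F1 :: "complex \<Rightarrow> complex \<Rightarrow> complex \<Rightarrow> complex \<Rightarrow> complex" where
  "reg_hyp2F1 a b c = analytic_extension (ball 0 1) slit_plane
     (\<lambda>w. \<Sum>n. pochhammer a n * pochhammer b n * rGamma (c + of_nat n) * w ^ n / fact n)"

text \<open>Cleared of denominators, the recurrence survives at \<open>c = - n\<close>, because
  \<open>rGamma (c + n) = (c + n) * rGamma (c + n + 1)\<close> holds without exception.\<close>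

lemma hyp_fps_rec:
  "of_nat (Suc n) * (of_nat n + c) * fps_nth (hyp_fps a b c) (Suc n)
     = (of_nat n + a) * (of_nat n + b) * fps_nth (hyp_fps a b c) n"
proof -
  have "rGamma (c + of_nat n) = (c + of_nat n) * rGamma (c + of_nat (Suc n))"
    using rGamma_plus1[of "c + of_nat n"] by (simp add: add_ac)
  moreover have "(fact (Suc n) :: complex) = of_nat (Suc n) * fact n" by simp
  ultimately show ?thesis
    by (simp only: hyp_fps_def fps_nth_Abs_fps pochhammer_Suc) (simp add: divide_simps add_ac mult_ac del: fact_Suc of_nat_Suc)
qed

text \<open>Both directions matter: the series satisfies the equation because of its recurrence, and
  in Euler's transformation the recurrence is read off from the equation of a product.\<close>

lemma hyp_ode_fps_iff:
  fixes \<phi> :: "complex fps"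
  shows "fps_X * (1 - fps_X) * fps_deriv (fps_deriv \<phi>)
       + (fps_const c - fps_const (a + b + 1) * fps_X) * fps_deriv \<phi> - fps_const (a * b) * \<phi> = 0
   \<longleftrightarrow> (\<forall>n. of_nat (Suc n) * (of_nat n + c) * fps_nth \<phi> (Suc n) = (of_nat n + a) * (of_nat n + b) * fps_nth \<phi> n)"
proof -
  have "fps_nth (fps_X * (1 - fps_X) * fps_deriv (fps_deriv \<phi>)
       + (fps_const c - fps_const (a + b + 1) * fps_X) * fps_deriv \<phi> - fps_const (a * b) * \<phi>) n
    = of_nat (Suc n) * (of_nat n + c) * fps_nth \<phi> (Suc n) - (of_nat n + a) * (of_nat n + b) * fps_nth \<phi> n" for n
  proof -
    have "fps_X * (1 - fps_X) * fps_deriv (fps_deriv \<phi>)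
       + (fps_const c - fps_const (a + b + 1) * fps_X) * fps_deriv \<phi> - fps_const (a * b) * \<phi>
      = fps_X * fps_deriv (fps_deriv \<phi>) - fps_X * (fps_X * fps_deriv (fps_deriv \<phi>))
       + fps_const c * fps_deriv \<phi> - fps_const (a + b + 1) * (fps_X * fps_deriv \<phi>) - fps_const (a * b) * \<phi>"
      by (simp add: algebra_simps)
    also have "fps_nth \<dots> n = of_nat (Suc n) * (of_nat n + c) * fps_nth \<phi> (Suc n)
        - (of_nat n + a) * (of_nat n + b) * fps_nth \<phi> n"
      by (cases n; cases "n - 1") (auto simp: algebra_simps)
    finally show ?thesis .
  qed
  then show ?thesis by (simp add: fps_eq_iff)
qed

lemma hyp_fps_conv_radius: "fps_conv_radius (hyp_fps a b c) \<ge> 1"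
  unfolding fps_conv_radius_def
proof (rule conv_radius_geI_ex')
  fix r assume r: "0 < r" "ereal r < 1"
  define s where "s = (r + 1) / 2"
  have s: "r < s" "s < 1" using r by (auto simp: s_def)
  let ?f = "fps_nth (hyp_fps a b c)"
  define R where "R = (\<lambda>n. (of_nat n + a) * (of_nat n + b) / (of_nat (Suc n) * (of_nat n + c)))"
  have lim: "(\<lambda>n. (of_nat n + d) / of_nat n :: complex) \<longlonglongrightarrow> 1" for d
  proof (rule Lim_transform_eventually)
    show "(\<lambda>n. 1 + d / of_nat n) \<longlonglongrightarrow> 1" by (rule tendsto_eq_intros lim_const_over_n | simp)+
    show "\<forall>\<^sub>F n in sequentially. 1 + d / of_nat n = (of_nat n + d) / of_nat n"
      using eventually_gt_at_top[of 0] by eventually_elim (simp add: field_simps)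
  qed
  have "(\<lambda>n. ((of_nat n + a) / of_nat n) * ((of_nat n + b) / of_nat n)
     / (((of_nat n + 1) / of_nat n) * ((of_nat n + c) / of_nat n))) \<longlonglongrightarrow> (1 * 1) / (1 * 1)"
    by (intro tendsto_intros lim) auto
  moreover have "\<forall>\<^sub>F n in sequentially. ((of_nat n + a) / of_nat n) * ((of_nat n + b) / of_nat n)
     / (((of_nat n + 1) / of_nat n) * ((of_nat n + c) / of_nat n)) = R n"
    using eventually_gt_at_top[of 0] by eventually_elim (simp add: R_def add_ac)
  ultimately have "R \<longlonglongrightarrow> 1" using Lim_transform_eventually by fastforce
  then have "(\<lambda>n. norm (R n) * r) \<longlonglongrightarrow> norm (1 :: complex) * r" by (intro tendsto_intros)
  then have "\<forall>\<^sub>F n in sequentially. norm (R n) * r < s" using s by (intro order_tendstoD) auto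
  \<comment> \<open>This keeps \<open>n + c\<close> away from 0, so that the recurrence can be
    solved for the next coefficient even if c is a nonpositive integer.\<close>
  moreover have "\<forall>\<^sub>F n in sequentially. real n > norm c"
    using filterlim_at_top_dense filterlim_real_sequentially by blast
  ultimately have "\<forall>\<^sub>F n in sequentially. norm (?f (Suc n) * of_real r ^ Suc n) \<le> s * norm (?f n * of_real r ^ n)"
  proof eventually_elim
    case (elim n)
    have "of_nat n + c \<noteq> 0"
      using elim by (metis add_eq_0_iff less_irrefl norm_minus_cancel norm_of_nat)
    then have "?f (Suc n) = R n * ?f n"
      using hyp_fps_rec[of n c a b] by (simp add: R_def divide_simps mult_ac del: of_nat_Suc)
    then have "norm (?f (Suc n) * of_real r ^ Suc n) = (norm (R n) * r) * norm (?f n * of_real r ^ n)"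
      using r by (simp add: norm_mult norm_power)
    also have "\<dots> \<le> s * norm (?f n * of_real r ^ n)" using elim by (intro mult_right_mono) auto
    finally show ?case .
  qed
  then obtain N where "\<And>n. n \<ge> N \<Longrightarrow> norm (?f (Suc n) * of_real r ^ Suc n) \<le> s * norm (?f n * of_real r ^ n)"
    by (auto simp: eventually_at_top_linorder)
  with s show "summable (\<lambda>n. ?f n * of_real r ^ n)" by (intro summable_ratio_test[of s N]) auto
qed

text \<open>Turns identities of formal power series at 0 into identities on a whole connected
  domain.\<close>

lemma holomorphic_zero_expansion:
  assumes "f has_fps_expansion 0" "f holomorphic_on S" "open S" "connected S" "(0::complex) \<in> S" "z \<in> S"
  shows "f z = 0"
proof -
  have "\<forall>\<^sub>F w in nhds 0. f w = 0" using assms(1) by (simp add: has_fps_expansion_def)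
  then obtain A where A: "open A" "0 \<in> A" "\<And>w. w \<in> A \<Longrightarrow> f w = 0" by (auto simp: eventually_nhds)
  show ?thesis
  proof (rule analytic_continuation[OF assms(2-4) _ assms(5) _ _ assms(6)])
    show "A \<inter> S \<subseteq> S" "\<And>z. z \<in> A \<inter> S \<Longrightarrow> f z = 0" using A by auto
    show "0 islimpt (A \<inter> S)" using A assms by (intro interior_limit_point) (auto simp: interior_open)
  qed
qed

text \<open>The domain is a parameter since the equation is needed on the unit ball before the
  continuation exists, and on the slit plane afterwards.\<close>

lemma hyp_ode:
  fixes F :: "complex \<Rightarrow> complex"
  assumes F: "F has_fps_expansion \<phi>" "F holomorphic_on S" "open S" "connected S" "0 \<in> S" "w \<in> S"
    and rec: "\<And>n. of_nat (Suc n) * (of_nat n + c) * fps_nth \<phi> (Suc n) = (of_nat n + a) * (of_nat n + b) * fps_nth \<phi> n"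
  shows "w * (1 - w) * deriv (deriv F) w + (c - (a + b + 1) * w) * deriv F w - a * b * F w = 0"
proof (rule holomorphic_zero_expansion[OF _ _ F(3-6)])
  have 0: "fps_X * (1 - fps_X) * fps_deriv (fps_deriv \<phi>)
       + (fps_const c - fps_const (a + b + 1) * fps_X) * fps_deriv \<phi> - fps_const (a * b) * \<phi> = 0"
    unfolding hyp_ode_fps_iff using rec by blast
  show "(\<lambda>w. w * (1 - w) * deriv (deriv F) w + (c - (a + b + 1) * w) * deriv F w - a * b * F w) has_fps_expansion 0"
    unfolding 0[symmetric] by (intro fps_expansion_intros F(1))
  show "(\<lambda>w. w * (1 - w) * deriv (deriv F) w + (c - (a + b + 1) * w) * deriv F w - a * b * F w) holomorphic_on S"
    using F by (intro holomorphic_intros holomorphic_deriv) auto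
qed


lemma hyp_fps_has_expansion: "eval_fps (hyp_fps a b c) has_fps_expansion hyp_fps a b c"
  by (rule eval_fps_has_fps_expansion)
     (use hyp_fps_conv_radius[of a b c] in \<open>auto intro: less_le_trans[of 0 1]\<close>)

lemma hyp_fps_holomorphic: "eval_fps (hyp_fps a b c) holomorphic_on ball 0 1"
  by (rule holomorphic_on_subset[OF holomorphic_on_eval_fps[OF order_refl]])
     (rule ball_eball_mono, use hyp_fps_conv_radius[of a b c] in \<open>simp add: one_ereal_def\<close>)

section \<open>Analytic continuation by the quadratic substitution\<close>

text \<open>\<open>F0\<close>, \<open>F1\<close>, \<open>F2\<close> stand for a solution and its
  derivatives at w; \<open>w1\<close>, \<open>w2\<close> are the derivatives of w with respect to t.
  Since \<open>1 - w = ((1 - t) / (1 + t))\<^sup>2\<close>, the singular points 1 and \<infinity> of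
  the original equation correspond to \<open>t = 1\<close> and \<open>t = - 1\<close>, and the
  equation takes the form required by \<open>fps_conv_radius_Fuchs\<close> with coefficients
  holomorphic in the unit disc.\<close>

lemma quadratic_pullback_ode:
  fixes F0 F1 F2 a b c t :: complex
  defines "w \<equiv> 4 * t / (1 + t)\<^sup>2" and "w1 \<equiv> 4 * (1 - t) / (1 + t) ^ 3" and "w2 \<equiv> 8 * (t - 2) / (1 + t) ^ 4"
  assumes "w * (1 - w) * F2 + (c - (a + b + 1) * w) * F1 - a * b * F0 = 0" "1 + t \<noteq> 0" "1 - t \<noteq> 0"
  shows "t * (F2 * w1\<^sup>2 + F1 * w2) + F1 * w1
    = ((1 - c) * (1 + t) / (1 - t) + (4 * (a + b) - 2) * t / ((1 + t) * (1 - t))) * (F1 * w1)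
      + 4 * a * b / (1 + t)\<^sup>2 * F0"
proof -
  define i j where "i = inverse (1 + t)" and "j = inverse (1 - t)"
  have ij: "i * (1 + t) = 1" "j * (1 - t) = 1" using assms by (auto simp: i_def j_def)
  have w: "w = 4 * t * i ^ 2" "w1 = 4 * (1 - t) * i ^ 3" "w2 = 8 * (t - 2) * i ^ 4"
    by (auto simp: assms i_def field_simps)
  have "t * (F2 * w1\<^sup>2 + F1 * w2) + F1 * w1
    = ((1 - c) * (1 + t) * j + (4 * (a + b) - 2) * t * i * j) * (F1 * w1) + 4 * a * b * i ^ 2 * F0
    + 4 * i ^ 2 * (w * (1 - w) * F2 + (c - (a + b + 1) * w) * F1 - a * b * F0)"
    unfolding w using ij by algebra
  then show ?thesis using assms by (simp add: i_def j_def divide_inverse mult_ac power_inverse)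
qed

text \<open>Only the germ at \<open>t = 0\<close> is pulled back. The majorant argument makes its
  Taylor series converge in the whole unit disc, and composition with the inverse
  \<open>\<tau>\<close> of the substitution gives a function on the slit plane that agrees with the
  hypergeometric series near 0.\<close>

lemma hyp_continuation:
  "\<exists>G. G holomorphic_on slit_plane \<and> (\<forall>w\<in>ball 0 1. G w = eval_fps (hyp_fps a b c) w)"
proof -
  define F where "F = eval_fps (hyp_fps a b c)"
  have F: "F has_fps_expansion hyp_fps a b c" "F holomorphic_on ball 0 1"
    unfolding F_def by (rule hyp_fps_has_expansion hyp_fps_holomorphic)+
  define w where "w = (\<lambda>t::complex. 4 * t / (1 + t)\<^sup>2)"
  \<comment> \<open>For \<open>norm t < 1 / 8\<close> the norm of
    \<open>4 * t / (1 + t)\<^sup>2\<close> is below \<open>(1 / 2) / (7 / 8)\<^sup>2 < 1\<close>, so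
    the substitution stays where the series converges.\<close>
  define B where "B = ball (0::complex) (1 / 8)"
  have tB: "1 + t \<noteq> 0" "1 - t \<noteq> 0" if "t \<in> ball 0 1" for t :: complex
    using that by (auto simp: add_eq_0_iff)
  have tB': "t \<in> ball 0 1" if "t \<in> B" for t using that by (auto simp: B_def)
  have wB: "w t \<in> ball 0 1" if "t \<in> B" for t
  proof -
    have t: "norm t < 1 / 8" using that by (simp add: B_def)
    have "7 / 8 \<le> norm (1 + t)"
      using norm_triangle_ineq2[of 1 "-t"] t by simp
    then have "(7 / 8)\<^sup>2 \<le> norm (1 + t) ^ 2" by (intro power_mono) auto
    then show ?thesis using t by (simp add: w_def norm_divide norm_mult norm_power divide_simps power2_eq_square)
  qed
  define f where "f = (\<lambda>t. F (w t))"
  define f1 where "f1 = (\<lambda>t. deriv F (w t) * (4 * (1 - t) / (1 + t) ^ 3))"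
  define f2 where "f2 = (\<lambda>t. deriv (deriv F) (w t) * (4 * (1 - t) / (1 + t) ^ 3)\<^sup>2
     + deriv F (w t) * (8 * (t - 2) / (1 + t) ^ 4))"
  have wder: "(w has_field_derivative 4 * (1 - t) / (1 + t) ^ 3) (at t)" if "t \<in> B" for t
    unfolding w_def using tB(1)[OF tB'[OF that]]
    by (auto intro!: derivative_eq_intros simp: divide_simps power2_eq_square power3_eq_cube) algebra
  have hol: "deriv F holomorphic_on ball 0 1" using F(2) by (intro holomorphic_deriv) auto
  have d1: "(f has_field_derivative f1 t) (at t)" if "t \<in> B" for t
    unfolding f_def f1_def
    by (rule DERIV_chain2[OF holomorphic_derivI[OF F(2)] wder]) (use wB that in auto)
  have d2: "(f1 has_field_derivative f2 t) (at t)" if "t \<in> B" for t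
  proof -
    have "((\<lambda>t. deriv F (w t)) has_field_derivative deriv (deriv F) (w t) * (4 * (1 - t) / (1 + t) ^ 3)) (at t)"
      by (rule DERIV_chain2[OF holomorphic_derivI[OF hol] wder]) (use wB that in auto)
    moreover have "((\<lambda>t. 4 * (1 - t) / (1 + t) ^ 3) has_field_derivative 8 * (t - 2) / (1 + t) ^ 4) (at t)"
      using tB(1)[OF tB'[OF that]]
      by (auto intro!: derivative_eq_intros simp: divide_simps) algebra
    from DERIV_mult[OF calculation this] show ?thesis unfolding f1_def f2_def
      by (simp add: power2_eq_square mult_ac add_ac)
  qed
  have B: "open B" "0 \<in> B" by (auto simp: B_def)
  have fhol: "f holomorphic_on B" "f1 holomorphic_on B"
    using d1 d2 B by (auto simp: holomorphic_on_open)
  define \<phi> where "\<phi> = fps_expansion f 0"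
  have \<phi>: "f has_fps_expansion \<phi>"
    unfolding \<phi>_def using fhol B by blast
  have "deriv f has_fps_expansion fps_deriv \<phi>" by (intro fps_expansion_intros \<phi>)
  moreover have "\<forall>\<^sub>F t in nhds 0. deriv f t = f1 t"
    using B d1 by (auto simp: eventually_nhds intro!: exI[of _ B] DERIV_imp_deriv)
  ultimately have \<phi>1: "f1 has_fps_expansion fps_deriv \<phi>"
    using has_fps_expansion_cong by blast
  have "deriv f1 has_fps_expansion fps_deriv (fps_deriv \<phi>)" by (intro fps_expansion_intros \<phi>1)
  moreover have "\<forall>\<^sub>F t in nhds 0. deriv f1 t = f2 t"
    using B d2 by (auto simp: eventually_nhds intro!: exI[of _ B] DERIV_imp_deriv)
  ultimately have \<phi>2: "f2 has_fps_expansion fps_deriv (fps_deriv \<phi>)"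
    using has_fps_expansion_cong by blast
  define p where "p = (\<lambda>t. (1 - c) * (1 + t) / (1 - t) + (4 * (a + b) - 2) * t / ((1 + t) * (1 - t)))"
  define q where "q = (\<lambda>t. 4 * a * b / (1 + t)\<^sup>2)"
  have pq: "p holomorphic_on ball 0 1" "q holomorphic_on ball 0 1"
    unfolding p_def q_def using tB by (auto intro!: holomorphic_intros)
  have pq': "p has_fps_expansion fps_expansion p 0" "q has_fps_expansion fps_expansion q 0"
    using pq by (intro has_fps_expansion_fps_expansion[of "ball 0 1"]; simp)+
  have pqr: "fps_conv_radius (fps_expansion p 0) \<ge> 1" "fps_conv_radius (fps_expansion q 0) \<ge> 1"
    using pq by (auto intro!: conv_radius_fps_expansion simp flip: ereal_eq_1)
  have ode: "t * f2 t + f1 t = p t * f1 t + q t * f t" if "t \<in> B" for t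
    unfolding f_def f1_def f2_def p_def q_def w_def
  proof (rule quadratic_pullback_ode)
    show "4 * t / (1 + t)\<^sup>2 * (1 - 4 * t / (1 + t)\<^sup>2) * deriv (deriv F) (4 * t / (1 + t)\<^sup>2)
       + (c - (a + b + 1) * (4 * t / (1 + t)\<^sup>2)) * deriv F (4 * t / (1 + t)\<^sup>2) - a * b * F (4 * t / (1 + t)\<^sup>2) = 0"
      using hyp_ode[OF F open_ball connected_ball _ wB[OF that] hyp_fps_rec] by (simp add: w_def)
  qed (use tB[OF tB'[OF that]] in auto)
  have "fps_X * fps_deriv (fps_deriv \<phi>) + fps_deriv \<phi>
      = fps_expansion p 0 * fps_deriv \<phi> + fps_expansion q 0 * \<phi>"
  proof (rule fps_expansion_unique_complex)
    show "(\<lambda>t. t * f2 t + f1 t) has_fps_expansion fps_X * fps_deriv (fps_deriv \<phi>) + fps_deriv \<phi>"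
      by (intro fps_expansion_intros \<phi>1 \<phi>2)
    have "(\<lambda>t. p t * f1 t + q t * f t) has_fps_expansion fps_expansion p 0 * fps_deriv \<phi> + fps_expansion q 0 * \<phi>"
      by (intro fps_expansion_intros \<phi>1 \<phi> pq')
    moreover have "\<forall>\<^sub>F t in nhds 0. p t * f1 t + q t * f t = t * f2 t + f1 t"
      using B ode by (auto simp: eventually_nhds intro!: exI[of _ B])
    from iffD1[OF has_fps_expansion_cong[OF this refl] calculation]
    show "(\<lambda>t. t * f2 t + f1 t) has_fps_expansion fps_expansion p 0 * fps_deriv \<phi> + fps_expansion q 0 * \<phi>" .
  qed
  from fps_conv_radius_Fuchs[OF this pqr] have rad: "fps_conv_radius \<phi> \<ge> 1" .
  \<comment> \<open>The solution of \<open>4 * t = w * (1 + t)\<^sup>2\<close> inside the unit disc: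
    on the slit plane the principal root r of \<open>1 - w\<close> has positive real part, hence
    \<open>norm (1 - r) < norm (1 + r)\<close>.\<close>
  define \<tau> where "\<tau> = (\<lambda>w. (1 - csqrt (1 - w)) / (1 + csqrt (1 - w)))"
  have s: "Re (csqrt (1 - w)) > 0" "1 - w \<notin> \<real>\<^sub>\<le>\<^sub>0" if "w \<in> slit_plane" for w
  proof -
    show "1 - w \<notin> \<real>\<^sub>\<le>\<^sub>0" using that unfolding slit_plane_iff by (auto simp: complex_nonpos_Reals_iff)
    moreover have "1 - w \<in> \<real>\<^sub>\<le>\<^sub>0" if "Re (csqrt (1 - w)) = 0"
      using that power2_csqrt[of "1 - w"] by (simp add: complex_nonpos_Reals_iff complex_eq_iff power2_eq_square)
        (smt (verit) zero_le_square)
    ultimately show "Re (csqrt (1 - w)) > 0" using Re_csqrt[of "1 - w"] by (metis less_eq_real_def)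
  qed
  have s1: "1 + csqrt (1 - w) \<noteq> 0" if "w \<in> slit_plane" for w
    using s(1)[OF that] by (metis add_eq_0_iff uminus_complex.sel(1) one_complex.sel(1) less_minus_iff neg_0_less_iff_less not_one_less_zero minus_equation_iff)
  have \<tau>hol: "\<tau> holomorphic_on slit_plane"
    unfolding \<tau>_def using s s1 by (intro holomorphic_intros) auto
  have \<tau>1: "\<tau> w \<in> ball 0 1" if "w \<in> slit_plane" for w
  proof -
    have "norm (1 - csqrt (1 - w)) < norm (1 + csqrt (1 - w))"
      using s(1)[OF that] by (simp add: cmod_def power2_eq_square algebra_simps)
    then show ?thesis using s1[OF that] by (simp add: \<tau>_def norm_divide)
  qed
  have w\<tau>: "w (\<tau> v) = v" if "v \<in> slit_plane" for v
  proof -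
    have "1 + \<tau> v = 2 / (1 + csqrt (1 - v))" using s1[OF that] by (simp add: \<tau>_def field_simps)
    then have "w (\<tau> v) = (1 - csqrt (1 - v)) * (1 + csqrt (1 - v))"
      using s1[OF that] by (simp add: w_def \<tau>_def power2_eq_square)
    also have "\<dots> = 1 - (csqrt (1 - v))\<^sup>2" by (simp add: algebra_simps power2_eq_square)
    finally show ?thesis by simp
  qed
  define G where "G = (\<lambda>v. eval_fps \<phi> (\<tau> v))"
  have \<phi>hol: "eval_fps \<phi> holomorphic_on ball 0 1"
    by (rule holomorphic_on_subset[OF holomorphic_on_eval_fps[OF order_refl]])
       (rule ball_eball_mono, use rad in \<open>simp add: one_ereal_def\<close>)
  have Ghol: "G holomorphic_on slit_plane"
    unfolding G_def by (rule holomorphic_on_compose_gen[OF \<tau>hol \<phi>hol, unfolded o_def]) (use \<tau>1 in auto)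
  have "\<forall>\<^sub>F t in nhds 0. eval_fps \<phi> t = f t" using \<phi> by (simp add: has_fps_expansion_def)
  then obtain A where A: "open A" "0 \<in> A" "\<And>t. t \<in> A \<Longrightarrow> eval_fps \<phi> t = f t" by (auto simp: eventually_nhds)
  have op: "open (slit_plane \<inter> \<tau> -` A)"
    using continuous_open_preimage[OF holomorphic_on_imp_continuous_on[OF \<tau>hol] open_slit_plane A(1)] .
  define A' where "A' = (slit_plane \<inter> \<tau> -` A) \<inter> ball 0 1"
  have A': "open A'" "0 \<in> A'" "A' \<subseteq> ball 0 1"
    using op A by (auto simp: A'_def \<tau>_def intro: subsetD[OF ball_subset_slit_plane])
  have near: "G v - F v = 0" if "v \<in> A'" for v
    using that A(3)[of "\<tau> v"] w\<tau>[of v] by (auto simp: A'_def G_def f_def simp del: Compl_iff)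
  have "G v - F v = 0" if "v \<in> ball 0 1" for v
  proof (rule analytic_continuation[OF _ open_ball connected_ball A'(3) _ _ near that])
    show "(\<lambda>v. G v - F v) holomorphic_on ball 0 1"
      using Ghol F ball_subset_slit_plane by (intro holomorphic_intros) (auto intro: holomorphic_on_subset)
    show "0 islimpt A'" using A' by (intro interior_limit_point) (auto simp: interior_open)
  qed auto
  then show ?thesis using Ghol by (auto simp: F_def)
qed

lemma
  shows reg_hyp2F1_holomorphic: "reg_hyp2F1 a b c holomorphic_on slit_plane"
    and reg_hyp2F1_eq_series: "w \<in> ball 0 1 \<Longrightarrow> reg_hyp2F1 a b c w = eval_fps (hyp_fps a b c) w"
proof -
  obtain G where G: "G holomorphic_on slit_plane" "\<And>w. w \<in> ball 0 1 \<Longrightarrow> G w = eval_fps (hyp_fps a b c) w"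
    using hyp_continuation by blast
  have eq: "reg_hyp2F1 a b c w = G w" if "w \<in> slit_plane" for w
    unfolding reg_hyp2F1_def
  proof (rule analytic_extension_eq[OF open_slit_plane connected_slit_plane ball_subset_slit_plane _ _ G(1) _ that])
    show "G z = (\<Sum>n. pochhammer a n * pochhammer b n * rGamma (c + of_nat n) * z ^ n / fact n)"
      if "z \<in> ball 0 1" for z
      using G(2)[OF that] by (simp add: eval_fps_def hyp_fps_def)
    show "0 \<in> slit_plane" by (simp add: slit_plane_iff del: Compl_iff)
    show "(0::complex) islimpt ball 0 1" by (simp add: interior_limit_point)
  qed
  show "reg_hyp2F1 a b c holomorphic_on slit_plane"
    using G(1) by (rule holomorphic_transform) (use eq in auto)
  show "reg_hyp2F1 a b c w = eval_fps (hyp_fps a b c) w" if "w \<in> ball 0 1"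
    using eq G(2) that ball_subset_slit_plane by (metis subsetD)
qed

lemma zero_in_slit_plane: "0 \<in> slit_plane"
  by (simp add: slit_plane_iff del: Compl_iff)

lemma reg_hyp2F1_has_fps_expansion: "reg_hyp2F1 a b c has_fps_expansion hyp_fps a b c"
proof -
  have "\<forall>\<^sub>F w in nhds 0. eval_fps (hyp_fps a b c) w = reg_hyp2F1 a b c w"
    using reg_hyp2F1_eq_series by (auto simp: eventually_nhds intro!: exI[of _ "ball 0 1"])
  from iffD1[OF has_fps_expansion_cong[OF this refl] hyp_fps_has_expansion] show ?thesis .
qed

lemma reg_hyp2F1_ode:
  assumes "w \<in> slit_plane"
  shows "w * (1 - w) * deriv (deriv (reg_hyp2F1 a b c)) w + (c - (a + b + 1) * w) * deriv (reg_hyp2F1 a b c) w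
     - a * b * reg_hyp2F1 a b c w = 0"
  by (rule hyp_ode[OF reg_hyp2F1_has_fps_expansion reg_hyp2F1_holomorphic open_slit_plane
        connected_slit_plane zero_in_slit_plane assms hyp_fps_rec])

lemma reg_hyp2F1_0: "reg_hyp2F1 a b c 0 = rGamma c"
  by (simp add: reg_hyp2F1_eq_series eval_fps_at_0 hyp_fps_def)

lemma hyp2F1_eq:
  assumes "c \<notin> \<int>\<^sub>\<le>\<^sub>0" "w \<in> slit_plane"
  shows "hyp2F1 a b c w = Gamma c * reg_hyp2F1 a b c w"
  unfolding hyp2F1_def
proof (rule analytic_extension_eq[OF open_slit_plane connected_slit_plane ball_subset_slit_plane zero_in_slit_plane _ _ _ assms(2)])
  show "(\<lambda>w. Gamma c * reg_hyp2F1 a b c w) holomorphic_on slit_plane"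
    by (intro holomorphic_intros reg_hyp2F1_holomorphic)
  show "(0::complex) islimpt ball 0 1" by (simp add: interior_limit_point)
  fix z :: complex assume z: "z \<in> ball 0 1"
  have "Gamma c * rGamma (c + of_nat n) = 1 / pochhammer c n" for n
  proof -
    have "pochhammer c n \<noteq> 0" using assms(1) by (auto simp: pochhammer_eq_0_iff)
    moreover have "rGamma c = rGamma (c + of_nat n) * pochhammer c n"
      by (metis pochhammer_rGamma mult.commute)
    moreover have "Gamma c * rGamma c = 1"
      using assms(1) by (simp add: Gamma_def rGamma_eq_zero_iff)
    ultimately show ?thesis by (simp add: field_simps)
  qed
  note inv_poch = this
  have "Gamma c * (fps_nth (hyp_fps a b c) n * z ^ n)
      = pochhammer a n * pochhammer b n / pochhammer c n * z ^ n / fact n" for n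
  proof -
    have "Gamma c * (fps_nth (hyp_fps a b c) n * z ^ n)
      = pochhammer a n * pochhammer b n * (Gamma c * rGamma (c + of_nat n)) * z ^ n / fact n"
      by (simp add: hyp_fps_def)
    then show ?thesis unfolding inv_poch by simp
  qed
  moreover have "summable (\<lambda>n. fps_nth (hyp_fps a b c) n * z ^ n)"
  proof (rule summable_fps)
    have "ereal (norm z) < 1" using z by simp
    then show "ereal (norm z) < fps_conv_radius (hyp_fps a b c)"
      using hyp_fps_conv_radius by (rule less_le_trans)
  qed
  ultimately show "Gamma c * reg_hyp2F1 a b c z = (\<Sum>n. pochhammer a n * pochhammer b n / pochhammer c n * z ^ n / fact n)"
    using z by (simp add: reg_hyp2F1_eq_series eval_fps_def flip: suminf_mult)
qed

lemma hyp2F1_over_Gamma_eq: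
  assumes "w \<in> slit_plane"
  shows "hyp2F1_over_Gamma a b c w = reg_hyp2F1 a b c w"
  using assms hyp2F1_eq[of c w a b]
  by (auto simp: hyp2F1_over_Gamma_def reg_hyp2F1_def Gamma_eq_zero_iff simp del: Compl_iff)

section \<open>Euler's transformation\<close>

text \<open>For \<open>c = 1 - N\<close> with \<open>N \<ge> 1\<close> the recurrence says nothing
  about the coefficient of index N, since its factor vanishes at \<open>n = N - 1\<close>. Agreement
  is therefore demanded up to and including N; beyond that the recurrence determines
  everything.\<close>

lemma hyp_rec_unique:
  fixes f g :: "nat \<Rightarrow> complex"
  assumes "\<And>n. of_nat (Suc n) * (of_nat n + c) * f (Suc n) = (of_nat n + a) * (of_nat n + b) * f n"
    and "\<And>n. of_nat (Suc n) * (of_nat n + c) * g (Suc n) = (of_nat n + a) * (of_nat n + b) * g n"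
    and "\<And>n. n \<le> N \<Longrightarrow> f n = g n" "\<And>n. n \<ge> N \<Longrightarrow> c + of_nat n \<noteq> 0"
  shows "f n = g n"
proof (induction n)
  case (Suc n)
  show ?case
  proof (cases "Suc n \<le> N")
    case False
    then have "of_nat n + c \<noteq> 0" using assms(4)[of n] by (simp add: add_ac)
    then show ?thesis using assms(1)[of n] assms(2)[of n] Suc.IH
      by (metis mult_cancel_left mult_eq_0_iff of_nat_eq_0_iff nat.simps(3))
  qed (use assms in auto)
qed (use assms in auto)

text \<open>\<open>g\<close> stands for \<open>(1 - w) powr m\<close>, with derivatives
  \<open>- m * g / (1 - w)\<close> and \<open>m * (m - 1) * g / (1 - w)\<^sup>2\<close>; the
  left-hand side is the hypergeometric expression with parameters \<open>c - a\<close>,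
  \<open>c - b\<close>, \<open>c\<close> for the product of \<open>g\<close> with a
  solution.\<close>

lemma euler_transformed_ode:
  fixes F0 F1 F2 a b c w g :: complex
  defines "m \<equiv> a + b - c"
  assumes "w * (1 - w) * F2 + (c - (a + b + 1) * w) * F1 - a * b * F0 = 0" "w \<noteq> 1"
  shows "w * (1 - w) * (m * (m - 1) * g / (1 - w)\<^sup>2 * F0 + 2 * (- m * g / (1 - w)) * F1 + g * F2)
     + (c - ((c - a) + (c - b) + 1) * w) * (- m * g / (1 - w) * F0 + g * F1) - (c - a) * (c - b) * (g * F0) = 0"
proof -
  define j where "j = inverse (1 - w)"
  have j: "j * (1 - w) = 1" using assms by (auto simp: j_def)
  have "w * (1 - w) * (m * (m - 1) * g * j ^ 2 * F0 + 2 * (- m * g * j) * F1 + g * F2)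
     + (c - ((c - a) + (c - b) + 1) * w) * (- m * g * j * F0 + g * F1) - (c - a) * (c - b) * (g * F0)
     = g * (w * (1 - w) * F2 + (c - (a + b + 1) * w) * F1 - a * b * F0)"
    unfolding m_def using j by algebra
  then show ?thesis using assms by (simp add: j_def divide_inverse power_inverse mult_ac)
qed

text \<open>Both sides solve the same hypergeometric equation, so their Taylor coefficients obey the
  same recurrence. Usually the value at 0 then decides; if c is a nonpositive integer, both
  regularized series start only at index \<open>1 - c\<close>, and the coefficients there are
  compared by hand.\<close>

lemma euler_transformation:
  assumes "w \<in> slit_plane"
  shows "(1 - w) powr (a + b - c) * reg_hyp2F1 a b c w = reg_hyp2F1 (c - a) (c - b) c w"
proof -
  define m where "m = a + b - c"
  define F where "F = reg_hyp2F1 a b c"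
  define g where "g = (\<lambda>w::complex. (1 - w) powr m)"
  define r where "r = (\<lambda>w. g w * F w)"
  define r1 where "r1 = (\<lambda>w. - m * g w / (1 - w) * F w + g w * deriv F w)"
  define r2 where "r2 = (\<lambda>w. m * (m - 1) * g w / (1 - w)\<^sup>2 * F w + 2 * (- m * g w / (1 - w)) * deriv F w + g w * deriv (deriv F) w)"
  have F: "F holomorphic_on slit_plane" "F has_fps_expansion hyp_fps a b c"
    unfolding F_def by (rule reg_hyp2F1_holomorphic reg_hyp2F1_has_fps_expansion)+
  have F': "deriv F holomorphic_on slit_plane"
    by (intro holomorphic_deriv F open_slit_plane)
  have s: "1 - w \<notin> \<real>\<^sub>\<le>\<^sub>0" "w \<noteq> 1" if "w \<in> slit_plane" for w
    using that unfolding slit_plane_iff by (auto simp: complex_nonpos_Reals_iff)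
  have g: "(g has_field_derivative - m * g w / (1 - w)) (at w)" if "w \<in> slit_plane" for w
    using s[OF that] unfolding g_def
    by (auto intro!: derivative_eq_intros simp: powr_diff)
  note dF = holomorphic_derivI[OF F(1) open_slit_plane] holomorphic_derivI[OF F' open_slit_plane]
  have d1: "(r has_field_derivative r1 w) (at w)" if "w \<in> slit_plane" for w
    using DERIV_mult[OF g[OF that] dF(1)[OF that]] unfolding r_def r1_def
    by (simp add: mult_ac add_ac)
  have d2: "(r1 has_field_derivative r2 w) (at w)" if "w \<in> slit_plane" for w
  proof -
    have "1 - w \<noteq> 0" using s[OF that] by simp
    have "((\<lambda>w. - m * g w / (1 - w)) has_field_derivative
        ((- m * (- m * g w / (1 - w))) * (1 - w) - (- m * g w) * (- 1)) / ((1 - w) * (1 - w))) (at w)"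
      by (rule DERIV_divide[OF DERIV_cmult[OF g[OF that]]])
         (use \<open>1 - w \<noteq> 0\<close> in \<open>auto intro!: derivative_eq_intros\<close>)
    also have "((- m * (- m * g w / (1 - w))) * (1 - w) - (- m * g w) * (- 1)) / ((1 - w) * (1 - w))
        = m * (m - 1) * g w / (1 - w)\<^sup>2"
    proof -
      have "(- m * (- m * g w / (1 - w))) * (1 - w) = m * m * g w"
        using \<open>1 - w \<noteq> 0\<close> by simp
      then show ?thesis by (simp only: power2_eq_square) (simp add: left_diff_distrib right_diff_distrib)
    qed
    finally have "((\<lambda>w. - m * g w / (1 - w)) has_field_derivative m * (m - 1) * g w / (1 - w)\<^sup>2) (at w)" .
    from DERIV_add[OF DERIV_mult[OF this dF(1)[OF that]] DERIV_mult[OF g[OF that] dF(2)[OF that]]]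
    show ?thesis unfolding r1_def r2_def by (simp add: algebra_simps)
  qed
  have deq: "\<forall>\<^sub>F w in nhds 0. deriv r w = r1 w" "\<forall>\<^sub>F w in nhds 0. deriv r1 w = r2 w"
    using d1 d2 open_slit_plane zero_in_slit_plane
    by (auto simp: eventually_nhds simp del: Compl_iff intro!: exI[of _ slit_plane] DERIV_imp_deriv)
  have ghol: "g holomorphic_on slit_plane" using g open_slit_plane by (auto simp: holomorphic_on_open simp del: Compl_iff)
  define \<gamma> where "\<gamma> = fps_expansion g 0"
  have \<gamma>: "g has_fps_expansion \<gamma>" unfolding \<gamma>_def
    using ghol open_slit_plane zero_in_slit_plane by blast
  have \<gamma>0: "fps_nth \<gamma> 0 = 1" using has_fps_expansion_imp_0_eq_fps_nth_0[OF \<gamma>] by (simp add: g_def)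
  define \<psi> where "\<psi> = \<gamma> * hyp_fps a b c"
  have \<psi>: "r has_fps_expansion \<psi>" unfolding r_def \<psi>_def by (intro fps_expansion_intros \<gamma> F)
  have \<psi>1: "r1 has_fps_expansion fps_deriv \<psi>"
    using iffD1[OF has_fps_expansion_cong[OF deq(1) refl] has_fps_expansion_deriv[OF \<psi>]] .
  have \<psi>2: "r2 has_fps_expansion fps_deriv (fps_deriv \<psi>)"
    using iffD1[OF has_fps_expansion_cong[OF deq(2) refl] has_fps_expansion_deriv[OF \<psi>1]] .
  have ode: "w * (1 - w) * r2 w + (c - ((c - a) + (c - b) + 1) * w) * r1 w - (c - a) * (c - b) * r w = 0"
    if "w \<in> slit_plane" for w
    unfolding r_def r1_def r2_def m_def
    by (rule euler_transformed_ode[OF reg_hyp2F1_ode[OF that, of a b c, folded F_def] s(2)[OF that]])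
  have "fps_X * (1 - fps_X) * fps_deriv (fps_deriv \<psi>)
       + (fps_const c - fps_const ((c - a) + (c - b) + 1) * fps_X) * fps_deriv \<psi> - fps_const ((c - a) * (c - b)) * \<psi> = 0"
  proof (rule fps_expansion_unique_complex)
    show "(\<lambda>w. w * (1 - w) * r2 w + (c - ((c - a) + (c - b) + 1) * w) * r1 w - (c - a) * (c - b) * r w)
      has_fps_expansion fps_X * (1 - fps_X) * fps_deriv (fps_deriv \<psi>)
       + (fps_const c - fps_const ((c - a) + (c - b) + 1) * fps_X) * fps_deriv \<psi> - fps_const ((c - a) * (c - b)) * \<psi>"
      by (intro fps_expansion_intros \<psi> \<psi>1 \<psi>2)
    have "\<forall>\<^sub>F w in nhds 0. w * (1 - w) * r2 w + (c - ((c - a) + (c - b) + 1) * w) * r1 w - (c - a) * (c - b) * r w = 0"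
      using ode open_slit_plane zero_in_slit_plane by (auto simp: eventually_nhds simp del: Compl_iff)
    then show "(\<lambda>w. w * (1 - w) * r2 w + (c - ((c - a) + (c - b) + 1) * w) * r1 w - (c - a) * (c - b) * r w)
      has_fps_expansion 0"
      by (subst has_fps_expansion_cong[OF _ refl, where g = "\<lambda>_. 0"]) auto
  qed
  then have rec: "of_nat (Suc n) * (of_nat n + c) * fps_nth \<psi> (Suc n)
      = (of_nat n + (c - a)) * (of_nat n + (c - b)) * fps_nth \<psi> n" for n
    by (subst (asm) hyp_ode_fps_iff) blast
  \<comment> \<open>The index at which the series starts: 0 in general, and \<open>1 - c\<close> if
    c is a nonpositive integer.\<close>
  obtain N :: nat where N: "N = 0 \<or> c = 1 - of_nat N" "\<And>n. n \<ge> N \<Longrightarrow> c + of_nat n \<noteq> 0"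
  proof (cases "c \<in> \<int>\<^sub>\<le>\<^sub>0")
    case True
    then obtain k where k: "c = - of_nat k" by (auto elim!: nonpos_Ints_cases')
    show ?thesis
    proof (rule that[of "Suc k"])
      show "c + of_nat n \<noteq> 0" if "n \<ge> Suc k" for n using that by (simp add: k)
    qed (simp add: k)
  next
    case False
    show ?thesis
    proof (rule that[of 0])
      show "c + of_nat n \<noteq> 0" for n
        using False plus_of_nat_eq_0_imp by blast
    qed simp
  qed
  have "fps_nth \<psi> n = fps_nth (hyp_fps (c - a) (c - b) c) n" for n
  proof (rule hyp_rec_unique[OF rec hyp_fps_rec _ N(2)])
    fix n assume n: "n \<le> N"
    have zero: "fps_nth (hyp_fps a' b' c) k = 0" if "k < N" for a' b' k
    proof -
      have "c + of_nat k = - of_nat (N - 1 - k)" using N(1) that by (auto simp: of_nat_diff)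
      then have "rGamma (c + of_nat k) = 0" by (simp only: rGamma_eq_zero_iff) auto
      then show ?thesis by (simp add: hyp_fps_def)
    qed
    have "fps_nth \<psi> n = (\<Sum>k\<le>n. fps_nth (hyp_fps a b c) k * fps_nth \<gamma> (n - k))"
      by (simp only: \<psi>_def mult.commute[of \<gamma>] fps_mult_nth atLeast0AtMost)
    also have "\<dots> = fps_nth (hyp_fps a b c) n"
      using zero n by (simp add: lessThan_Suc_atMost[symmetric] \<gamma>0)
    also have "\<dots> = fps_nth (hyp_fps (c - a) (c - b) c) n"
    proof (cases "n = N")
      case True
      \<comment> \<open>Because \<open>c - d = - (d - 1 + N)\<close>, this reverses the order of the
        factors up to sign; it is applied to a and to b, and the two signs cancel.\<close>
      have "pochhammer (c - d) N = (-1) ^ N * pochhammer d N" for d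
      proof (cases "N = 0")
        case False
        then have "c - d = - (d - 1 + of_nat N)" using N(1) by simp
        then show ?thesis by (simp only: pochhammer_minus) simp
      qed auto
      then show ?thesis unfolding True by (simp add: hyp_fps_def)
    qed (use zero n in auto)
    finally show "fps_nth \<psi> n = fps_nth (hyp_fps (c - a) (c - b) c) n" .
  qed auto
  then have \<psi>eq: "\<psi> = hyp_fps (c - a) (c - b) c" by (simp add: fps_eq_iff)
  have "r w - reg_hyp2F1 (c - a) (c - b) c w = 0"
  proof (rule holomorphic_zero_expansion[OF _ _ open_slit_plane connected_slit_plane zero_in_slit_plane assms])
    have "(\<lambda>w. r w - reg_hyp2F1 (c - a) (c - b) c w) has_fps_expansion \<psi> - hyp_fps (c - a) (c - b) c"
      by (intro fps_expansion_intros \<psi> reg_hyp2F1_has_fps_expansion)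
    then show "(\<lambda>w. r w - reg_hyp2F1 (c - a) (c - b) c w) has_fps_expansion 0" by (simp add: \<psi>eq)
    show "(\<lambda>w. r w - reg_hyp2F1 (c - a) (c - b) c w) holomorphic_on slit_plane"
      unfolding r_def by (intro holomorphic_intros ghol F reg_hyp2F1_holomorphic)
  qed
  then show ?thesis by (simp add: r_def g_def F_def m_def)
qed

section \<open>Behaviour at 1\<close>

lemma Re_pos_not_nonpos_Int: "Re z > 0 \<Longrightarrow> z \<notin> \<int>\<^sub>\<le>\<^sub>0"
  by (auto elim!: nonpos_Ints_cases)

text \<open>Off the poles this is Euler's limit formula for the Gamma function, divided by its
  limit. At the poles that quotient degenerates to 0; there the limit is carried down from
  \<open>c + k\<close> with positive real part, one unit at a time.\<close>

lemma fact_powr_rGamma_shift: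
  "(\<lambda>n. fact n * exp (c * of_real (ln (of_nat n))) * rGamma (c + 1 + of_nat n)) \<longlonglongrightarrow> (1 :: complex)"
proof -
  let ?E = "\<lambda>c n. fact n * exp (c * of_real (ln (of_nat n))) * rGamma (c + 1 + of_nat n) :: complex"
  have base: "?E c \<longlonglongrightarrow> 1" if c: "c \<notin> \<int>\<^sub>\<le>\<^sub>0" for c
  proof (rule Lim_transform_eventually)
    have "rGamma c \<noteq> 0" using c by (simp add: rGamma_eq_zero_iff)
    then show "(\<lambda>n. rGamma c / rGamma_series c n) \<longlonglongrightarrow> 1"
      by (auto intro!: tendsto_eq_intros)
    have "rGamma c / rGamma_series c n = ?E c n" for n
    proof -
      have "pochhammer c (Suc n) \<noteq> 0" using c by (auto simp: pochhammer_eq_0_iff)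
      moreover have "rGamma c = pochhammer c (Suc n) * rGamma (c + of_nat (Suc n))"
        by (rule pochhammer_rGamma)
      ultimately show ?thesis by (simp add: rGamma_series_def add_ac)
    qed
    then show "\<forall>\<^sub>F n in sequentially. rGamma c / rGamma_series c n = ?E c n" by simp
  qed
  have step: "?E c \<longlonglongrightarrow> 1" if "?E (c + 1) \<longlonglongrightarrow> 1" for c
  proof (rule Lim_transform_eventually)
    show "(\<lambda>n. (1 + (c + 1) / of_nat n) * ?E (c + 1) n) \<longlonglongrightarrow> 1"
      by (rule tendsto_eq_intros that lim_const_over_n refl | simp)+
    show "\<forall>\<^sub>F n in sequentially. (1 + (c + 1) / of_nat n) * ?E (c + 1) n = ?E c n"
      using eventually_gt_at_top[of 0]
    proof eventually_elim
      case (elim n)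
      have "exp ((c + 1) * of_real (ln (real n))) = of_nat n * exp (c * of_real (ln (real n)))"
        using elim by (simp add: distrib_right exp_add mult.commute exp_of_real)
      moreover have "rGamma (c + 1 + of_nat n) = (c + 1 + of_nat n) * rGamma (c + 1 + 1 + of_nat n)"
        using rGamma_plus1[of "c + 1 + of_nat n"] by (simp add: add_ac)
      ultimately show ?case using elim by (simp add: divide_simps add_ac)
    qed
  qed
  obtain k :: nat where k: "- Re c < real k" using reals_Archimedean2 by blast
  have "?E (c + of_nat (k - j)) \<longlonglongrightarrow> 1" if "j \<le> k" for j
    using that
  proof (induction j)
    case 0
    have "Re (c + of_nat k) > 0" using k by simp
    then have "c + of_nat k \<notin> \<int>\<^sub>\<le>\<^sub>0" by (rule Re_pos_not_nonpos_Int)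
    from base[OF this] show ?case by simp
  next
    case (Suc j)
    have "c + of_nat (k - j) = c + of_nat (k - Suc j) + 1"
      using Suc.prems by (simp add: of_nat_diff)
    with Suc show ?case using step[of "c + of_nat (k - Suc j)"] by (simp only: Suc_leD)
  qed
  from this[of k] show ?thesis by simp
qed

lemma neg_powr_sums:
  assumes "norm u < 1"
  shows "(\<lambda>n. pochhammer s n / fact n * u ^ n) sums (1 - u) powr (- s :: complex)"
proof -
  have "(\<lambda>n. (- s gchoose n) * (- u) ^ n) sums (1 + (- u)) powr (- s)"
    using assms by (intro gen_binomial_complex) simp
  moreover have "(- s gchoose n) * (- u) ^ n = pochhammer s n / fact n * u ^ n" for n
  proof -
    have "(-1 :: complex) ^ n * (- u) ^ n = u ^ n" by (simp flip: power_mult_distrib)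
    then show ?thesis by (simp add: gbinomial_pochhammer field_simps)
  qed
  ultimately show ?thesis by simp
qed

text \<open>An Abelian comparison, passing from coefficients to the behaviour at 1. Finitely many
  terms stay bounded and are killed by the factor \<open>(1 - u) powr s\<close>; the remaining ones
  are dominated by \<open>e / 2\<close> times the majorant series, whose sum that factor turns into
  1.\<close>

lemma one_minus_powr_times_powser_tendsto_0:
  fixes d :: "nat \<Rightarrow> complex" and h :: "nat \<Rightarrow> real"
  assumes s: "s > 0" and h: "\<And>u. 0 < u \<Longrightarrow> u < 1 \<Longrightarrow> (\<lambda>n. h n * u ^ n) sums (1 - u) powr (- s)"
    and hpos: "\<And>n. h n > 0" and lim: "(\<lambda>n. d n / of_real (h n)) \<longlonglongrightarrow> 0"
  shows "((\<lambda>u. (1 - u) powr s * norm (\<Sum>n. d n * of_real u ^ n)) \<longlongrightarrow> 0) (at_left 1)"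
proof (rule tendstoI)
  fix e :: real assume "e > 0"
  then have "\<forall>\<^sub>F n in sequentially. norm (d n / of_real (h n)) < e / 2"
    using tendstoD[OF lim, of "e / 2"] by simp
  then obtain N where N: "\<And>n. n \<ge> N \<Longrightarrow> norm (d n / of_real (h n)) < e / 2"
    by (auto simp: eventually_at_top_linorder)
  have dN: "norm (d n) \<le> e / 2 * h n" if "n \<ge> N" for n
    using N[OF that] hpos[of n] by (simp add: norm_divide field_simps)
  define C where "C = (\<Sum>n<N. norm (d n))"
  have bound: "(1 - u) powr s * norm (\<Sum>n. d n * of_real u ^ n) \<le> C * (1 - u) powr s + e / 2"
    if u: "0 < u" "u < 1" for u
  proof -
    have H: "summable (\<lambda>n. h n * u ^ n)" "(\<Sum>n. h n * u ^ n) = (1 - u) powr (- s)"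
      using h[OF u] by (auto simp: sums_iff)
    have le: "norm (d n * of_real u ^ n) \<le> e / 2 * (h n * u ^ n)" if "n \<ge> N" for n
    proof -
      have "norm (d n * of_real u ^ n) = norm (d n) * u ^ n" using u by (simp add: norm_mult norm_power)
      also have "\<dots> \<le> (e / 2 * h n) * u ^ n" using dN[OF that] u by (intro mult_right_mono) auto
      finally show ?thesis by simp
    qed
    have sd: "summable (\<lambda>n. norm (d n * of_real u ^ n))"
      by (rule summable_comparison_test'[OF summable_mult[OF H(1), of "e / 2"], of N]) (use le in simp)
    have "norm (\<Sum>n. d n * of_real u ^ n) \<le> (\<Sum>n. norm (d n * of_real u ^ n))"
      by (rule summable_norm[OF sd])
    also have "\<dots> = (\<Sum>n. norm (d (n + N) * of_real u ^ (n + N))) + (\<Sum>n<N. norm (d n * of_real u ^ n))"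
      by (rule suminf_split_initial_segment[OF sd])
    also have "(\<Sum>n<N. norm (d n * of_real u ^ n)) \<le> C"
      unfolding C_def using u
      by (intro sum_mono) (auto simp: norm_mult norm_power intro!: mult_left_le power_le_one)
    also have "(\<Sum>n. norm (d (n + N) * of_real u ^ (n + N))) \<le> (\<Sum>n. e / 2 * (h (n + N) * u ^ (n + N)))"
      using summable_ignore_initial_segment[OF sd, of N]
        summable_mult[OF summable_ignore_initial_segment[OF H(1), of N], of "e / 2"]
      by (intro suminf_le le) auto
    also have "\<dots> = e / 2 * (\<Sum>n. h (n + N) * u ^ (n + N))"
      using summable_ignore_initial_segment[OF H(1), of N] by (rule suminf_mult)
    also have "(\<Sum>n. h (n + N) * u ^ (n + N)) \<le> (\<Sum>n. h n * u ^ n)"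
      using H(1) u hpos unfolding suminf_split_initial_segment[OF H(1), of N]
      by (auto intro!: sum_nonneg mult_nonneg_nonneg simp: less_imp_le)
    finally have "norm (\<Sum>n. d n * of_real u ^ n) \<le> e / 2 * (1 - u) powr (- s) + C"
      using \<open>e > 0\<close> H(2) by simp
    then have "(1 - u) powr s * norm (\<Sum>n. d n * of_real u ^ n) \<le> (1 - u) powr s * (e / 2 * (1 - u) powr (- s) + C)"
      by (intro mult_left_mono) auto
    also have "\<dots> = C * (1 - u) powr s + e / 2 * ((1 - u) powr s * (1 - u) powr (- s))"
      by (simp add: algebra_simps)
    also have "(1 - u) powr s * (1 - u) powr (- s) = 1"
      using u by (simp flip: powr_add)
    finally show ?thesis by simp
  qed
  have "((\<lambda>u. (1 - u) powr s) \<longlongrightarrow> (1 - 1) powr s) (at_left (1::real))"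
    using s by (intro tendsto_powr' tendsto_intros) (auto simp: eventually_at_filter)
  then have "((\<lambda>u. (1 - u) powr s) \<longlongrightarrow> 0) (at_left (1::real))" by simp
  then have "((\<lambda>u. C * (1 - u) powr s + e / 2) \<longlongrightarrow> C * 0 + e / 2) (at_left (1::real))"
    by (intro tendsto_intros)
  then have "\<forall>\<^sub>F u in at_left (1::real). C * (1 - u) powr s + e / 2 < e"
    using \<open>e > 0\<close> by (elim order_tendstoD) auto
  moreover have "\<forall>\<^sub>F u in at_left (1::real). u \<in> {0<..<1}"
    by (rule eventually_at_left_real) simp
  ultimately show "\<forall>\<^sub>F u in at_left 1. dist ((1 - u) powr s * norm (\<Sum>n. d n * of_real u ^ n)) 0 < e"
    by eventually_elim (use bound in \<open>fastforce simp: abs_mult\<close>)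
qed

text \<open>The coefficients f are asymptotic to L times the coefficients g of
  \<open>(1 - u) powr (- \<mu>)\<close>. Since the g are complex, the error is measured against h,
  the positive coefficients of the binomial series with exponent \<open>- Re \<mu>\<close>, which
  are of the same order of magnitude.\<close>

lemma reg_hyp2F1_limit_at_1:
  assumes "Re (a + b - c) > 0"
  shows "((\<lambda>u. of_real (1 - u) powr (a + b - c) * reg_hyp2F1 a b c (of_real u))
     \<longlongrightarrow> Gamma (a + b - c) * rGamma a * rGamma b) (at_left 1)"
proof -
  define \<mu> where "\<mu> = a + b - c"
  define s where "s = Re \<mu>"
  have s: "s > 0" using assms by (simp add: s_def \<mu>_def)
  have \<mu>np: "\<mu> \<notin> \<int>\<^sub>\<le>\<^sub>0" using s by (intro Re_pos_not_nonpos_Int) (simp add: s_def)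
  define L where "L = Gamma \<mu> * rGamma a * rGamma b"
  define f where "f = fps_nth (hyp_fps a b c)"
  define g where "g = (\<lambda>n. pochhammer \<mu> n / fact n)"
  define h where "h = (\<lambda>n. pochhammer s n / fact n)"
  have poch: "pochhammer \<mu> n \<noteq> 0" for n using \<mu>np by (auto simp: pochhammer_eq_0_iff)
  have hpos: "h n > 0" for n using s by (simp add: h_def pochhammer_pos)
  have R\<mu>: "rGamma \<mu> \<noteq> 0" using \<mu>np by (simp add: rGamma_eq_zero_iff)
  \<comment> \<open>f, g and the terms of \<open>rGamma_series\<close> are matched at
    \<open>Suc n\<close>, as \<open>rGamma_series\<close> contains the Pochhammer symbol of that
    index. All powers of n cancel because of \<open>\<mu> + c = a + b\<close>.\<close>
  have fg: "(\<lambda>n. f n / g n) \<longlonglongrightarrow> L"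
  proof (rule LIMSEQ_imp_Suc, rule Lim_transform_eventually)
    let ?E = "\<lambda>n. fact n * exp (c * of_real (ln (of_nat n))) * rGamma (c + 1 + of_nat n) :: complex"
    have "(\<lambda>n. rGamma_series a n * rGamma_series b n / rGamma_series \<mu> n * ?E n)
       \<longlonglongrightarrow> rGamma a * rGamma b / rGamma \<mu> * 1"
      by (intro tendsto_intros fact_powr_rGamma_shift R\<mu>)
    then show "(\<lambda>n. rGamma_series a n * rGamma_series b n / rGamma_series \<mu> n * ?E n) \<longlonglongrightarrow> L"
      by (simp add: L_def rGamma_inverse_Gamma field_simps)
    have "rGamma_series a n * rGamma_series b n / rGamma_series \<mu> n * ?E n = f (Suc n) / g (Suc n)" for n
    proof -
      define l where "l = complex_of_real (ln (real n))"
      have "exp (\<mu> * l) * exp (c * l) = exp (a * l) * exp (b * l)"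
        by (simp add: \<mu>_def algebra_simps flip: exp_add)
      then have E: "exp (\<mu> * l) * exp (c * l) / (exp (a * l) * exp (b * l)) = 1" by simp
      have "rGamma_series a n * rGamma_series b n / rGamma_series \<mu> n * ?E n
        = pochhammer a (Suc n) * pochhammer b (Suc n) / pochhammer \<mu> (Suc n) * rGamma (c + 1 + of_nat n)
          * (exp (\<mu> * l) * exp (c * l) / (exp (a * l) * exp (b * l)))"
        by (simp add: rGamma_series_def l_def mult_ac del: pochhammer_Suc)
      also have "\<dots> = f (Suc n) / g (Suc n)"
        unfolding E by (simp add: f_def g_def hyp_fps_def add_ac del: fact_Suc)
      finally show ?thesis .
    qed
    then show "\<forall>\<^sub>F n in sequentially. rGamma_series a n * rGamma_series b n / rGamma_series \<mu> n * ?E n = f (Suc n) / g (Suc n)"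
      by simp
  qed
  \<comment> \<open>The powers of n with exponents \<open>\<mu>\<close> and \<open>s\<close> have
    the same modulus, so they drop out of the quotient of the two Gamma products.\<close>
  have gh: "(\<lambda>n. norm (g n / of_real (h n))) \<longlonglongrightarrow> norm (rGamma \<mu>) / rGamma s"
  proof (rule LIMSEQ_imp_Suc, rule Lim_transform_eventually)
    have "rGamma s \<noteq> 0" using s by (auto simp: rGamma_eq_zero_iff elim!: nonpos_Ints_cases)
    then show "(\<lambda>n. norm (rGamma_series \<mu> n) / rGamma_series s n) \<longlonglongrightarrow> norm (rGamma \<mu>) / rGamma s"
      by (intro tendsto_intros)
    have "norm (rGamma_series \<mu> n) / rGamma_series s n = norm (g (Suc n) / of_real (h (Suc n)))" for n
      using pochhammer_pos[OF s, of "Suc n"]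
      by (simp add: rGamma_series_def g_def h_def norm_divide norm_mult s_def del: pochhammer_Suc fact_Suc)
    then show "\<forall>\<^sub>F n in sequentially. norm (rGamma_series \<mu> n) / rGamma_series s n = norm (g (Suc n) / of_real (h (Suc n)))"
      by simp
  qed
  define d where "d = (\<lambda>n. f n - L * g n)"
  have dh: "(\<lambda>n. d n / of_real (h n)) \<longlonglongrightarrow> 0"
  proof (rule tendsto_norm_zero_cancel, rule Lim_transform_eventually)
    have "(\<lambda>n. norm (f n / g n - L) * norm (g n / of_real (h n))) \<longlonglongrightarrow> norm (L - L) * (norm (rGamma \<mu>) / rGamma s)"
      by (intro tendsto_intros fg gh)
    then show "(\<lambda>n. norm (f n / g n - L) * norm (g n / of_real (h n))) \<longlonglongrightarrow> 0" by simp
    have "g n \<noteq> 0" for n using poch by (simp add: g_def)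
    then have "norm (f n / g n - L) * norm (g n / of_real (h n)) = norm (d n / of_real (h n))" for n
      by (simp add: d_def divide_simps flip: norm_mult)
    then show "\<forall>\<^sub>F n in sequentially. norm (f n / g n - L) * norm (g n / of_real (h n)) = norm (d n / of_real (h n))" by simp
  qed
  have "((\<lambda>u. (1 - u) powr s * norm (\<Sum>n. d n * of_real u ^ n)) \<longlongrightarrow> 0) (at_left 1)"
  proof (rule one_minus_powr_times_powser_tendsto_0[OF s _ hpos dh])
    fix u :: real assume u: "0 < u" "u < 1"
    have "(\<lambda>n. pochhammer (of_real s) n / fact n * of_real u ^ n) sums (1 - of_real u) powr (- of_real s :: complex)"
      using u by (intro neg_powr_sums) auto
    moreover have "(1 - of_real u) powr (- of_real s :: complex) = of_real ((1 - u) powr (- s))"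
    proof -
      have "(1 - of_real u) powr (- of_real s :: complex) = of_real (1 - u) powr of_real (- s)" by simp
      also have "\<dots> = of_real ((1 - u) powr (- s))" using u by (intro powr_of_real) simp
      finally show ?thesis .
    qed
    ultimately have "(\<lambda>n. complex_of_real (h n * u ^ n)) sums of_real ((1 - u) powr (- s))"
      by (simp add: h_def pochhammer_of_real)
    then show "(\<lambda>n. h n * u ^ n) sums (1 - u) powr (- s)" by (simp only: sums_of_real_iff)
  qed
  moreover have "\<forall>\<^sub>F u in at_left (1::real). u \<in> {0<..<1}"
    by (rule eventually_at_left_real) simp
  then have "\<forall>\<^sub>F u in at_left 1. (1 - u) powr s * norm (\<Sum>n. d n * of_real u ^ n)
      = norm (of_real (1 - u) powr \<mu> * reg_hyp2F1 a b c (of_real u) - L)"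
  proof eventually_elim
    case (elim u)
    then have u: "0 < u" "u < 1" by auto
    have "ereal (norm (complex_of_real u)) < 1" using u by simp
    also have "1 \<le> fps_conv_radius (hyp_fps a b c)" by (rule hyp_fps_conv_radius)
    finally have "(\<lambda>n. f n * of_real u ^ n) sums reg_hyp2F1 a b c (of_real u)"
      using sums_eval_fps[of "of_real u" "hyp_fps a b c"] u by (simp add: f_def reg_hyp2F1_eq_series)
    moreover have "(\<lambda>n. g n * of_real u ^ n) sums (1 - of_real u) powr (- \<mu>)"
      using neg_powr_sums[of "of_real u" \<mu>] u by (simp add: g_def)
    ultimately have "(\<lambda>n. f n * of_real u ^ n - L * (g n * of_real u ^ n)) sums
        (reg_hyp2F1 a b c (of_real u) - L * (1 - of_real u) powr (- \<mu>))"
      by (intro sums_diff sums_mult)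
    then have S: "(\<Sum>n. d n * of_real u ^ n) = reg_hyp2F1 a b c (of_real u) - L * (1 - of_real u) powr (- \<mu>)"
      by (simp add: d_def algebra_simps sums_iff)
    have "(1 - u) powr s = norm (of_real (1 - u) powr \<mu>)"
      using u by (simp add: norm_powr_real_powr s_def)
    then have "(1 - u) powr s * norm (\<Sum>n. d n * of_real u ^ n)
       = norm (of_real (1 - u) powr \<mu> * (reg_hyp2F1 a b c (of_real u) - L * (1 - of_real u) powr (- \<mu>)))"
      by (simp add: S norm_mult)
    also have "of_real (1 - u) powr \<mu> * (reg_hyp2F1 a b c (of_real u) - L * (1 - of_real u) powr (- \<mu>))
       = of_real (1 - u) powr \<mu> * reg_hyp2F1 a b c (of_real u) - L"
    proof -
      have "of_real (1 - u) powr \<mu> * (1 - of_real u) powr (- \<mu>) = (1 :: complex)"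
        using u by (simp add: powr_minus)
      then show ?thesis by (simp add: right_diff_distrib mult.left_commute)
    qed
    finally show ?case .
  qed
  ultimately have "((\<lambda>u. norm (of_real (1 - u) powr \<mu> * reg_hyp2F1 a b c (of_real u) - L)) \<longlongrightarrow> 0) (at_left 1)"
    by (rule Lim_transform_eventually)
  then show ?thesis
    by (simp only: tendsto_norm_zero_iff Lim_null[symmetric] \<mu>_def L_def)
qed

section \<open>Solutions of the Gegenbauer equation\<close>

text \<open>What the Legendre equation becomes when the factor \<open>(z\<^sup>2 - 1)\<close> to the
  power \<open>\<mu> / 2\<close> is split off. In this form the derivative of a solution solves the
  equation for \<open>\<mu> + 1\<close>, and \<open>- \<mu>\<close> is reached by multiplication
  with a power of \<open>z\<^sup>2 - 1\<close>.\<close>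

definition gegenbauer_solution :: "complex \<Rightarrow> complex \<Rightarrow> complex set \<Rightarrow> (complex \<Rightarrow> complex) \<Rightarrow> bool" where
  "gegenbauer_solution \<nu> \<mu> S y \<longleftrightarrow> y holomorphic_on S \<and>
     (\<forall>z\<in>S. (1 - z\<^sup>2) * deriv (deriv y) z - 2 * (\<mu> + 1) * z * deriv y z + (\<nu> - \<mu>) * (\<nu> + \<mu> + 1) * y z = 0)"

lemma deriv_deriv_eq:
  assumes "open S" "z \<in> S" "\<And>w. w \<in> S \<Longrightarrow> (y has_field_derivative y1 w) (at w)"
    and "\<And>w. w \<in> S \<Longrightarrow> (y1 has_field_derivative y2 w) (at w)"
  shows "deriv y z = y1 z" "deriv (deriv y) z = y2 z"
proof -
  have d: "deriv y w = y1 w" if "w \<in> S" for w using assms(3)[OF that] by (rule DERIV_imp_deriv)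
  then show "deriv y z = y1 z" using assms by blast
  have "((deriv y) has_field_derivative y2 z) (at z)"
    by (rule has_field_derivative_transform_within_open[OF assms(4)[OF assms(2)] assms(1,2)]) (use d in auto)
  then show "deriv (deriv y) z = y2 z" by (rule DERIV_imp_deriv)
qed

lemma gegenbauer_solutionI:
  assumes "open S" "\<And>w. w \<in> S \<Longrightarrow> (y has_field_derivative y1 w) (at w)"
    and "\<And>w. w \<in> S \<Longrightarrow> (y1 has_field_derivative y2 w) (at w)"
    and "\<And>z. z \<in> S \<Longrightarrow> (1 - z\<^sup>2) * y2 z - 2 * (\<mu> + 1) * z * y1 z + (\<nu> - \<mu>) * (\<nu> + \<mu> + 1) * y z = 0"
  shows "gegenbauer_solution \<nu> \<mu> S y"
  unfolding gegenbauer_solution_def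
  using assms(1,2,4) deriv_deriv_eq[OF assms(1) _ assms(2,3)] by (auto simp: holomorphic_on_open)

lemma gegenbauer_solution_subset:
  "gegenbauer_solution \<nu> \<mu> S y \<Longrightarrow> T \<subseteq> S \<Longrightarrow> gegenbauer_solution \<nu> \<mu> T y"
  unfolding gegenbauer_solution_def using holomorphic_on_subset by blast

lemma gegenbauer_solution_derivs:
  assumes "gegenbauer_solution \<nu> \<mu> S y" "open S" "z \<in> S"
  shows "(y has_field_derivative deriv y z) (at z)" "(deriv y has_field_derivative deriv (deriv y) z) (at z)"
    and "(1 - z\<^sup>2) * deriv (deriv y) z - 2 * (\<mu> + 1) * z * deriv y z + (\<nu> - \<mu>) * (\<nu> + \<mu> + 1) * y z = 0"
proof -
  have "y holomorphic_on S" using assms(1) by (simp add: gegenbauer_solution_def)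
  moreover from this have "deriv y holomorphic_on S" using assms(2) by (rule holomorphic_deriv)
  ultimately show "(y has_field_derivative deriv y z) (at z)" "(deriv y has_field_derivative deriv (deriv y) z) (at z)"
    using assms(2,3) holomorphic_derivI by blast+
qed (use assms in \<open>simp add: gegenbauer_solution_def\<close>)

section \<open>Wronskians and the space of solutions\<close>

lemma zero_deriv_imp_constant:
  fixes f :: "complex \<Rightarrow> complex"
  assumes "open S" "connected S" "\<And>z. z \<in> S \<Longrightarrow> (f has_field_derivative 0) (at z)" "z \<in> S" "w \<in> S"
  shows "f z = f w"
proof -
  have "\<exists>c. \<forall>x\<in>S. f x = c"
    by (rule DERIV_zero_connected_constant[OF assms(2,1) finite.emptyI])
       (use assms(1,3) in \<open>auto intro!: continuous_at_imp_continuous_on DERIV_isCont\<close>)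
  then show ?thesis using assms by metis
qed

text \<open>\<open>P\<close> is the integrating factor that puts the equation into Sturm--Liouville form.\<close>
lemma wronskian_constant:
  assumes y: "gegenbauer_solution \<nu> \<mu> S y" and u: "gegenbauer_solution \<nu> \<mu> S u"
    and S: "open S" "connected S" "z \<in> S" "w \<in> S"
    and P: "\<And>z. z \<in> S \<Longrightarrow> (P has_field_derivative P' z) (at z)"
      "\<And>z. z \<in> S \<Longrightarrow> (1 - z\<^sup>2) * P' z = - 2 * (\<mu> + 1) * z * P z" "\<And>z. z \<in> S \<Longrightarrow> z\<^sup>2 \<noteq> 1"
  shows "P z * (y z * deriv u z - deriv y z * u z) = P w * (y w * deriv u w - deriv y w * u w)"
proof (rule zero_deriv_imp_constant[OF S(1,2) _ S(3,4)])
  fix z assume z: "z \<in> S"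
  note dy = gegenbauer_solution_derivs[OF y S(1) z] and du = gegenbauer_solution_derivs[OF u S(1) z]
  have "((\<lambda>z. P z * (y z * deriv u z - deriv y z * u z)) has_field_derivative
     P' z * (y z * deriv u z - deriv y z * u z) + P z * (y z * deriv (deriv u) z - deriv (deriv y) z * u z)) (at z)"
    by (rule derivative_eq_intros P(1)[OF z] dy(1,2) du(1,2) refl)+ (simp add: algebra_simps)
  moreover have "P' z * (y z * deriv u z - deriv y z * u z) + P z * (y z * deriv (deriv u) z - deriv (deriv y) z * u z) = 0"
  proof -
    have "(1 - z\<^sup>2) * (P' z * (y z * deriv u z - deriv y z * u z) + P z * (y z * deriv (deriv u) z - deriv (deriv y) z * u z)) = 0"
      using P(2)[OF z] dy(3) du(3) by algebra
    then show ?thesis using P(3)[OF z] by simp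
  qed
  ultimately show "((\<lambda>z. P z * (y z * deriv u z - deriv y z * u z)) has_field_derivative 0) (at z)" by simp
qed

text \<open>Cramer's rule: the coefficients are quotients of Wronskians, and after weighting with
  \<open>P\<close> each Wronskian is constant.\<close>

lemma gegenbauer_solution_span:
  assumes y: "gegenbauer_solution \<nu> \<mu> S y"
    and u: "gegenbauer_solution \<nu> \<mu> S u1" "gegenbauer_solution \<nu> \<mu> S u2"
    and S: "open S" "connected S"
    and P: "\<And>z. z \<in> S \<Longrightarrow> (P has_field_derivative P' z) (at z)"
      "\<And>z. z \<in> S \<Longrightarrow> (1 - z\<^sup>2) * P' z = - 2 * (\<mu> + 1) * z * P z" "\<And>z. z \<in> S \<Longrightarrow> z\<^sup>2 \<noteq> 1"
      "\<And>z. z \<in> S \<Longrightarrow> P z \<noteq> 0"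
    and W: "\<And>z. z \<in> S \<Longrightarrow> u1 z * deriv u2 z - deriv u1 z * u2 z \<noteq> 0"
  shows "\<exists>A B. \<forall>z\<in>S. y z = A * u1 z + B * u2 z"
proof (cases "S = {}")
  case False
  then obtain w where w: "w \<in> S" by auto
  let ?E = "\<lambda>f g z. P z * (f z * deriv g z - deriv f z * g z)"
  have c: "?E f g z = ?E f g w" if "gegenbauer_solution \<nu> \<mu> S f" "gegenbauer_solution \<nu> \<mu> S g" "z \<in> S" for f g z
    using wronskian_constant[OF that(1,2) S that(3) w P(1-3)] .
  have "y z = ?E y u2 w / ?E u1 u2 w * u1 z + (- ?E y u1 w / ?E u1 u2 w) * u2 z" if z: "z \<in> S" for z
  proof -
    have nz: "?E u1 u2 w \<noteq> 0" using P(4)[OF w] W[OF w] by simp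
    have "y z * ?E u1 u2 z = u1 z * ?E y u2 z - u2 z * ?E y u1 z" by algebra
    then have "y z * ?E u1 u2 w = u1 z * ?E y u2 w - u2 z * ?E y u1 w"
      using c[OF u z] c[OF y u(1) z] c[OF y u(2) z] by argo
    then have "y z = (u1 z * ?E y u2 w - u2 z * ?E y u1 w) / ?E u1 u2 w"
      using nz by (metis nonzero_mult_div_cancel_right)
    then show ?thesis by (simp only: diff_divide_distrib) (simp add: mult_ac)
  qed
  then show ?thesis by blast
qed auto

section \<open>Hypergeometric solutions\<close>

lemma reg_hyp2F1_derivs:
  assumes "w \<in> slit_plane"
  shows "(reg_hyp2F1 a b c has_field_derivative deriv (reg_hyp2F1 a b c) w) (at w)"
    and "(deriv (reg_hyp2F1 a b c) has_field_derivative deriv (deriv (reg_hyp2F1 a b c)) w) (at w)"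
  using assms holomorphic_derivI[OF reg_hyp2F1_holomorphic open_slit_plane]
    holomorphic_derivI[OF holomorphic_deriv[OF reg_hyp2F1_holomorphic open_slit_plane] open_slit_plane] by blast+

text \<open>Under the substitution \<open>w = 1 - z\<^sup>2\<close> the Gegenbauer expression is 4
  times the hypergeometric one.\<close>

lemma gegenbauer_solution_at_1:
  assumes S: "open S" "\<And>z. z \<in> S \<Longrightarrow> 1 - z\<^sup>2 \<in> slit_plane"
  shows "gegenbauer_solution \<nu> \<mu> S (\<lambda>z. reg_hyp2F1 ((\<nu> + \<mu> + 1) / 2) ((\<mu> - \<nu>) / 2) (1 + \<mu>) (1 - z\<^sup>2))"
proof -
  define F where "F = reg_hyp2F1 ((\<nu> + \<mu> + 1) / 2) ((\<mu> - \<nu>) / 2) (1 + \<mu>)"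
  have "gegenbauer_solution \<nu> \<mu> S (\<lambda>z. F (1 - z\<^sup>2))"
  proof (rule gegenbauer_solutionI[OF S(1)])
    fix z assume z: "z \<in> S"
    note dF = reg_hyp2F1_derivs[OF S(2)[OF z], of "(\<nu> + \<mu> + 1) / 2" "(\<mu> - \<nu>) / 2" "1 + \<mu>", folded F_def]
    have i: "((\<lambda>z. 1 - z\<^sup>2) has_field_derivative - 2 * z) (at z)"
      by (auto intro!: derivative_eq_intros)
    show "((\<lambda>z. F (1 - z\<^sup>2)) has_field_derivative deriv F (1 - z\<^sup>2) * (- 2 * z)) (at z)"
      by (rule DERIV_chain2[OF dF(1) i])
    have "((\<lambda>z. deriv F (1 - z\<^sup>2)) has_field_derivative deriv (deriv F) (1 - z\<^sup>2) * (- 2 * z)) (at z)"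
      by (rule DERIV_chain2[OF dF(2) i])
    then show "((\<lambda>z. deriv F (1 - z\<^sup>2) * (- 2 * z)) has_field_derivative
        4 * z\<^sup>2 * deriv (deriv F) (1 - z\<^sup>2) - 2 * deriv F (1 - z\<^sup>2)) (at z)"
      by (auto intro!: derivative_eq_intros simp: power2_eq_square algebra_simps)
    define F0 F1 F2 where "F0 = F (1 - z\<^sup>2)" and "F1 = deriv F (1 - z\<^sup>2)" and "F2 = deriv (deriv F) (1 - z\<^sup>2)"
    have "(1 - z\<^sup>2) * (4 * z\<^sup>2 * F2 - 2 * F1) - 2 * (\<mu> + 1) * z * (F1 * (- 2 * z)) + (\<nu> - \<mu>) * (\<nu> + \<mu> + 1) * F0
      = 4 * ((1 - z\<^sup>2) * (1 - (1 - z\<^sup>2)) * F2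
      + (1 + \<mu> - ((\<nu> + \<mu> + 1) / 2 + (\<mu> - \<nu>) / 2 + 1) * (1 - z\<^sup>2)) * F1 - (\<nu> + \<mu> + 1) / 2 * ((\<mu> - \<nu>) / 2) * F0)"
      by (simp add: field_simps power2_eq_square power3_eq_cube)
    also have "\<dots> = 0"
      unfolding F0_def F1_def F2_def
      by (subst reg_hyp2F1_ode[OF S(2)[OF z], of "(\<nu> + \<mu> + 1) / 2" "(\<mu> - \<nu>) / 2" "1 + \<mu>", folded F_def]) simp
    finally have "(1 - z\<^sup>2) * (4 * z\<^sup>2 * F2 - 2 * F1) - 2 * (\<mu> + 1) * z * (F1 * (- 2 * z)) + (\<nu> - \<mu>) * (\<nu> + \<mu> + 1) * F0 = 0" .
    then show "(1 - z\<^sup>2) * (4 * z\<^sup>2 * deriv (deriv F) (1 - z\<^sup>2) - 2 * deriv F (1 - z\<^sup>2))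
      - 2 * (\<mu> + 1) * z * (deriv F (1 - z\<^sup>2) * (- 2 * z)) + (\<nu> - \<mu>) * (\<nu> + \<mu> + 1) * F (1 - z\<^sup>2) = 0"
      by (simp add: F0_def F1_def F2_def)
  qed
  then show ?thesis by (simp add: F_def)
qed

text \<open>The substitution is now \<open>w = z\<^sup>2\<close>, which maps all of
  \<open>D1\<close> into the slit plane. This solution and the odd one below will serve as a basis
  on both sides of the interval \<open>(-1, 1)\<close> at once.\<close>

lemma gegenbauer_solution_even:
  assumes S: "open S" "\<And>z. z \<in> S \<Longrightarrow> z\<^sup>2 \<in> slit_plane"
  shows "gegenbauer_solution \<nu> \<mu> S (\<lambda>z. reg_hyp2F1 ((\<nu> + \<mu> + 1) / 2) ((\<mu> - \<nu>) / 2) (1 / 2) (z\<^sup>2))"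
proof -
  define F where "F = reg_hyp2F1 ((\<nu> + \<mu> + 1) / 2) ((\<mu> - \<nu>) / 2) (1 / 2)"
  have "gegenbauer_solution \<nu> \<mu> S (\<lambda>z. F (z\<^sup>2))"
  proof (rule gegenbauer_solutionI[OF S(1)])
    fix z assume z: "z \<in> S"
    note dF = reg_hyp2F1_derivs[OF S(2)[OF z], of "(\<nu> + \<mu> + 1) / 2" "(\<mu> - \<nu>) / 2" "1 / 2", folded F_def]
    have i: "((\<lambda>z. z\<^sup>2) has_field_derivative 2 * z) (at z)"
      by (auto intro!: derivative_eq_intros)
    show "((\<lambda>z. F (z\<^sup>2)) has_field_derivative deriv F (z\<^sup>2) * (2 * z)) (at z)"
      by (rule DERIV_chain2[OF dF(1) i])
    have "((\<lambda>z. deriv F (z\<^sup>2)) has_field_derivative deriv (deriv F) (z\<^sup>2) * (2 * z)) (at z)"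
      by (rule DERIV_chain2[OF dF(2) i])
    then show "((\<lambda>z. deriv F (z\<^sup>2) * (2 * z)) has_field_derivative
        4 * z\<^sup>2 * deriv (deriv F) (z\<^sup>2) + 2 * deriv F (z\<^sup>2)) (at z)"
      by (auto intro!: derivative_eq_intros simp: power2_eq_square algebra_simps)
    define F0 F1 F2 where "F0 = F (z\<^sup>2)" and "F1 = deriv F (z\<^sup>2)" and "F2 = deriv (deriv F) (z\<^sup>2)"
    have "(1 - z\<^sup>2) * (4 * z\<^sup>2 * F2 + 2 * F1) - 2 * (\<mu> + 1) * z * (F1 * (2 * z)) + (\<nu> - \<mu>) * (\<nu> + \<mu> + 1) * F0
      = 4 * (z\<^sup>2 * (1 - z\<^sup>2) * F2
      + (1 / 2 - ((\<nu> + \<mu> + 1) / 2 + (\<mu> - \<nu>) / 2 + 1) * z\<^sup>2) * F1 - (\<nu> + \<mu> + 1) / 2 * ((\<mu> - \<nu>) / 2) * F0)"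
      by (simp add: field_simps power2_eq_square power3_eq_cube)
    also have "\<dots> = 0"
      unfolding F0_def F1_def F2_def
      by (subst reg_hyp2F1_ode[OF S(2)[OF z], of "(\<nu> + \<mu> + 1) / 2" "(\<mu> - \<nu>) / 2" "1 / 2", folded F_def]) simp
    finally have "(1 - z\<^sup>2) * (4 * z\<^sup>2 * F2 + 2 * F1) - 2 * (\<mu> + 1) * z * (F1 * (2 * z)) + (\<nu> - \<mu>) * (\<nu> + \<mu> + 1) * F0 = 0" .
    then show "(1 - z\<^sup>2) * (4 * z\<^sup>2 * deriv (deriv F) (z\<^sup>2) + 2 * deriv F (z\<^sup>2))
      - 2 * (\<mu> + 1) * z * (deriv F (z\<^sup>2) * (2 * z)) + (\<nu> - \<mu>) * (\<nu> + \<mu> + 1) * F (z\<^sup>2) = 0"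
      by (simp add: F0_def F1_def F2_def)
  qed
  then show ?thesis by (simp add: F_def)
qed

lemma gegenbauer_solution_odd:
  assumes S: "open S" "\<And>z. z \<in> S \<Longrightarrow> z\<^sup>2 \<in> slit_plane"
  shows "gegenbauer_solution \<nu> \<mu> S (\<lambda>z. z * reg_hyp2F1 ((\<nu> + \<mu> + 2) / 2) ((\<mu> - \<nu> + 1) / 2) (3 / 2) (z\<^sup>2))"
proof -
  define F where "F = reg_hyp2F1 ((\<nu> + \<mu> + 2) / 2) ((\<mu> - \<nu> + 1) / 2) (3 / 2)"
  have "gegenbauer_solution \<nu> \<mu> S (\<lambda>z. z * F (z\<^sup>2))"
  proof (rule gegenbauer_solutionI[OF S(1)])
    fix z assume z: "z \<in> S"
    note dF = reg_hyp2F1_derivs[OF S(2)[OF z], of "(\<nu> + \<mu> + 2) / 2" "(\<mu> - \<nu> + 1) / 2" "3 / 2", folded F_def]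
    have i: "((\<lambda>z. z\<^sup>2) has_field_derivative 2 * z) (at z)"
      by (auto intro!: derivative_eq_intros)
    have d1: "((\<lambda>z. F (z\<^sup>2)) has_field_derivative deriv F (z\<^sup>2) * (2 * z)) (at z)"
      by (rule DERIV_chain2[OF dF(1) i])
    then show "((\<lambda>z. z * F (z\<^sup>2)) has_field_derivative F (z\<^sup>2) + 2 * z\<^sup>2 * deriv F (z\<^sup>2)) (at z)"
      by (auto intro!: derivative_eq_intros simp: power2_eq_square algebra_simps)
    have "((\<lambda>z. deriv F (z\<^sup>2)) has_field_derivative deriv (deriv F) (z\<^sup>2) * (2 * z)) (at z)"
      by (rule DERIV_chain2[OF dF(2) i])
    then show "((\<lambda>z. F (z\<^sup>2) + 2 * z\<^sup>2 * deriv F (z\<^sup>2)) has_field_derivative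
        6 * z * deriv F (z\<^sup>2) + 4 * z ^ 3 * deriv (deriv F) (z\<^sup>2)) (at z)"
      using d1 by (auto intro!: derivative_eq_intros simp: power2_eq_square power3_eq_cube algebra_simps)
    define F0 F1 F2 where "F0 = F (z\<^sup>2)" and "F1 = deriv F (z\<^sup>2)" and "F2 = deriv (deriv F) (z\<^sup>2)"
    have "(1 - z\<^sup>2) * (6 * z * F1 + 4 * z ^ 3 * F2) - 2 * (\<mu> + 1) * z * (F0 + 2 * z\<^sup>2 * F1) + (\<nu> - \<mu>) * (\<nu> + \<mu> + 1) * (z * F0)
      = 4 * z * (z\<^sup>2 * (1 - z\<^sup>2) * F2
      + (3 / 2 - ((\<nu> + \<mu> + 2) / 2 + (\<mu> - \<nu> + 1) / 2 + 1) * z\<^sup>2) * F1 - (\<nu> + \<mu> + 2) / 2 * ((\<mu> - \<nu> + 1) / 2) * F0)"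
      by (simp add: field_simps power2_eq_square power3_eq_cube)
    also have "\<dots> = 0"
      unfolding F0_def F1_def F2_def
      by (subst reg_hyp2F1_ode[OF S(2)[OF z], of "(\<nu> + \<mu> + 2) / 2" "(\<mu> - \<nu> + 1) / 2" "3 / 2", folded F_def]) simp
    finally have "(1 - z\<^sup>2) * (6 * z * F1 + 4 * z ^ 3 * F2) - 2 * (\<mu> + 1) * z * (F0 + 2 * z\<^sup>2 * F1) + (\<nu> - \<mu>) * (\<nu> + \<mu> + 1) * (z * F0) = 0" .
    then show "(1 - z\<^sup>2) * (6 * z * deriv F (z\<^sup>2) + 4 * z ^ 3 * deriv (deriv F) (z\<^sup>2))
      - 2 * (\<mu> + 1) * z * (F (z\<^sup>2) + 2 * z\<^sup>2 * deriv F (z\<^sup>2)) + (\<nu> - \<mu>) * (\<nu> + \<mu> + 1) * (z * F (z\<^sup>2)) = 0"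
      by (simp add: F0_def F1_def F2_def)
  qed
  then show ?thesis by (simp add: F_def)
qed

section \<open>The associated Legendre function off the cut\<close>

abbreviation cut_plane :: "complex set" where
  "cut_plane \<equiv> - complex_of_real ` {..1}"

lemma cut_plane_iff: "z \<in> cut_plane \<longleftrightarrow> Im z \<noteq> 0 \<or> Re z > 1"
  by (auto simp: image_iff complex_eq_iff not_le)

lemma open_cut_plane: "open cut_plane"
proof -
  have "cut_plane = {z. Im z < 0} \<union> {z. Im z > 0} \<union> {z. Re z > 1}"
    using cut_plane_iff by auto
  then show ?thesis
    by (metis open_Un open_halfspace_Im_gt open_halfspace_Im_lt open_halfspace_Re_gt)
qed

lemma starlike_segment_Re_gt:
  assumes "0 \<le> u" "u \<le> (1::real)" "r > 1"
  shows "1 < (1 - u) * 2 + u * r"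
proof -
  have "u * (r - 1) \<ge> 0" using assms by (intro mult_nonneg_nonneg) auto
  moreover have "u * (r - 1) > 0" if "u = 1" using that assms by simp
  ultimately show ?thesis using assms by (cases "u = 1") (auto simp: algebra_simps)
qed

lemma closed_segment_subset_cut_plane:
  assumes x: "x \<in> cut_plane"
  shows "closed_segment 2 x \<subseteq> cut_plane"
proof
  fix z assume "z \<in> closed_segment 2 x"
  then obtain u where u: "0 \<le> u" "u \<le> 1" "z = (1 - u) *\<^sub>R 2 + u *\<^sub>R x" by (auto simp: in_segment)
  have "u = 0 \<or> Im z \<noteq> 0 \<or> 1 < Re z"
    using x starlike_segment_Re_gt[OF u(1,2), of "Re x"] unfolding cut_plane_iff u(3) by auto
  moreover have "1 < Re z" if "u = 0" using that u by simp
  ultimately show "z \<in> cut_plane" unfolding cut_plane_iff by blast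
qed

lemma connected_cut_plane_Int:
  assumes "convex C" "2 \<in> C"
  shows "connected (cut_plane \<inter> C)"
proof (rule starlike_imp_connected)
  have "2 \<in> cut_plane" by (simp add: cut_plane_iff del: Compl_iff)
  then show "starlike (cut_plane \<inter> C)"
    unfolding starlike_def using assms closed_segment_subset_cut_plane closed_segment_subset
    by (intro bexI[of _ 2] ballI) blast+
qed

lemma connected_cut_plane: "connected cut_plane"
  using connected_cut_plane_Int[of UNIV] by simp

lemma cut_plane_facts:
  assumes "z \<in> cut_plane"
  shows "z - 1 \<notin> \<real>\<^sub>\<le>\<^sub>0" "z + 1 \<notin> \<real>\<^sub>\<le>\<^sub>0" "z \<notin> \<real>\<^sub>\<le>\<^sub>0" "z \<noteq> 0" "z \<noteq> 1" "z + 1 \<noteq> 0" "z\<^sup>2 \<noteq> 1" "1 / z\<^sup>2 \<in> slit_plane"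
proof -
  have z: "Im z \<noteq> 0 \<or> Re z > 1" using assms unfolding cut_plane_iff .
  show 1: "z - 1 \<notin> \<real>\<^sub>\<le>\<^sub>0" "z + 1 \<notin> \<real>\<^sub>\<le>\<^sub>0" "z \<notin> \<real>\<^sub>\<le>\<^sub>0" using z by (auto simp: complex_nonpos_Reals_iff)
  then show "z \<noteq> 0" "z \<noteq> 1" "z + 1 \<noteq> 0" by auto
  then show "z\<^sup>2 \<noteq> 1" by (simp add: power2_eq_1_iff add_eq_0_iff2)
  have False if t: "1 / z\<^sup>2 = of_real t" "t \<ge> 1" for t :: real
  proof -
    have "z\<^sup>2 = of_real (1 / t)" using t \<open>z \<noteq> 0\<close> by (simp add: field_simps)
    then have "(Re z)\<^sup>2 - (Im z)\<^sup>2 = 1 / t" "2 * Re z * Im z = 0"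
      by (auto simp: complex_eq_iff power2_eq_square)
    moreover have "0 < 1 / t" "1 / t \<le> 1" using t by auto
    moreover have "(Im z)\<^sup>2 \<ge> 0" by simp
    ultimately show False using z
    proof (cases "Im z = 0")
      case True
      with z have "(Re z)\<^sup>2 > 1" by simp
      with True \<open>(Re z)\<^sup>2 - (Im z)\<^sup>2 = 1 / t\<close> \<open>1 / t \<le> 1\<close> show False by simp
    next
      case False
      with \<open>2 * Re z * Im z = 0\<close> have "Re z = 0" by simp
      with \<open>(Re z)\<^sup>2 - (Im z)\<^sup>2 = 1 / t\<close> \<open>0 < 1 / t\<close> \<open>(Im z)\<^sup>2 \<ge> 0\<close> show False
        by (simp only: power_zero_numeral)
    qed
  qed
  then show "1 / z\<^sup>2 \<in> slit_plane" by auto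
qed

section \<open>Powers of \<open>z\<^sup>2 - 1\<close> off the cut\<close>

text \<open>The split product is holomorphic across the imaginary axis, where the principal power of
  \<open>z\<^sup>2 - 1\<close> in general jumps.\<close>

definition sq_powr :: "complex \<Rightarrow> complex \<Rightarrow> complex" where
  "sq_powr m z = (z - 1) powr m * (z + 1) powr m"

lemma sq_powr_deriv:
  assumes "z \<in> cut_plane"
  shows "(sq_powr m has_field_derivative 2 * m * z * sq_powr (m - 1) z) (at z)"
  unfolding sq_powr_def[abs_def] using cut_plane_facts[OF assms]
  by (auto intro!: derivative_eq_intros simp: powr_diff field_simps)

lemma sq_powr_nonzero: "z \<in> cut_plane \<Longrightarrow> sq_powr m z \<noteq> 0"
  using cut_plane_facts[of z] by (auto simp: sq_powr_def)

lemma sq_powr_add: "sq_powr (m + n) z = sq_powr m z * sq_powr n z"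
  by (simp add: sq_powr_def powr_add)

lemma sq_powr_1: "z \<in> cut_plane \<Longrightarrow> sq_powr 1 z = z\<^sup>2 - 1"
  using cut_plane_facts[of z] by (simp add: sq_powr_def power2_eq_square algebra_simps)

lemma sq_powr_plus_1: "z \<in> cut_plane \<Longrightarrow> sq_powr (m + 1) z = (z\<^sup>2 - 1) * sq_powr m z"
  by (simp add: sq_powr_add sq_powr_1)

lemma sq_powr_minus_1: "z \<in> cut_plane \<Longrightarrow> sq_powr m z = (z\<^sup>2 - 1) * sq_powr (m - 1) z"
  using sq_powr_plus_1[of z "m - 1"] by simp

lemma sq_powr_0: "z \<in> cut_plane \<Longrightarrow> sq_powr 0 z = 1"
  using cut_plane_facts[of z] by (simp add: sq_powr_def)

lemma sq_powr_mult_minus: "z \<in> cut_plane \<Longrightarrow> sq_powr m z * sq_powr (- m) z = 1"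
  using sq_powr_add[of m "-m" z] sq_powr_0 by simp

lemma sq_powr_holomorphic: "sq_powr m holomorphic_on cut_plane"
  using sq_powr_deriv open_cut_plane by (auto simp: holomorphic_on_open simp del: Compl_iff)

text \<open>The symmetry between \<open>\<mu>\<close> and \<open>- \<mu>\<close>. The derivative is
  given with the lower power factored out, so that the powers can be removed from a Wronskian with a
  regular solution.\<close>

lemma sq_powr_times_solution:
  assumes S: "open S" "S \<subseteq> cut_plane" and v: "gegenbauer_solution \<nu> (- \<mu>) S v"
  shows "gegenbauer_solution \<nu> \<mu> S (\<lambda>z. sq_powr (- \<mu>) z * v z)"
    and "z \<in> S \<Longrightarrow> deriv (\<lambda>z. sq_powr (- \<mu>) z * v z) z
           = sq_powr (- \<mu> - 1) z * (- 2 * \<mu> * z * v z + (z\<^sup>2 - 1) * deriv v z)"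
proof -
  define k where "k = (\<lambda>z. - 2 * \<mu> * z * v z + (z\<^sup>2 - 1) * deriv v z)"
  define k1 where "k1 = (\<lambda>z. - 2 * \<mu> * v z + (2 - 2 * \<mu>) * z * deriv v z + (z\<^sup>2 - 1) * deriv (deriv v) z)"
  note dv = gegenbauer_solution_derivs[OF v S(1)]
  have cut: "z \<in> cut_plane" if "z \<in> S" for z using that S by blast
  have d1: "((\<lambda>z. sq_powr (- \<mu>) z * v z) has_field_derivative sq_powr (- \<mu> - 1) z * k z) (at z)" if "z \<in> S" for z
  proof -
    have "sq_powr (- \<mu>) z = (z\<^sup>2 - 1) * sq_powr (- \<mu> - 1) z"
      by (rule sq_powr_minus_1[OF cut[OF that]])
    then have "2 * - \<mu> * z * sq_powr (- \<mu> - 1) z * v z + deriv v z * sq_powr (- \<mu>) z = sq_powr (- \<mu> - 1) z * k z"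
      unfolding k_def by algebra
    with DERIV_mult[OF sq_powr_deriv[OF cut[OF that], of "- \<mu>"] dv(1)[OF that]] show ?thesis by (simp only:)
  qed
  have dk: "(k has_field_derivative k1 z) (at z)" if "z \<in> S" for z
    unfolding k_def k1_def
    by (rule derivative_eq_intros dv(1,2) that refl)+ (simp add: algebra_simps)
  define y2 where "y2 = (\<lambda>z. sq_powr (- \<mu> - 1 - 1) z * (- 2 * (\<mu> + 1) * z * k z + (z\<^sup>2 - 1) * k1 z))"
  have d2: "((\<lambda>z. sq_powr (- \<mu> - 1) z * k z) has_field_derivative y2 z) (at z)" if "z \<in> S" for z
  proof -
    have "sq_powr (- \<mu> - 1) z = (z\<^sup>2 - 1) * sq_powr (- \<mu> - 1 - 1) z"
      by (rule sq_powr_minus_1[OF cut[OF that]])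
    then show ?thesis
      using DERIV_mult[OF sq_powr_deriv[OF cut[OF that], of "- \<mu> - 1"] dk[OF that]]
      unfolding y2_def by (elim DERIV_cong) algebra
  qed
  show "gegenbauer_solution \<nu> \<mu> S (\<lambda>z. sq_powr (- \<mu>) z * v z)"
  proof (rule gegenbauer_solutionI[OF S(1) d1 d2])
    fix z assume z: "z \<in> S"
    have g1: "sq_powr (- \<mu> - 1) z = (z\<^sup>2 - 1) * sq_powr (- \<mu> - 1 - 1) z"
      by (rule sq_powr_minus_1[OF cut[OF z]])
    have g0: "sq_powr (- \<mu>) z = (z\<^sup>2 - 1) * ((z\<^sup>2 - 1) * sq_powr (- \<mu> - 1 - 1) z)"
      using sq_powr_minus_1[OF cut[OF z], of "- \<mu>"] g1 by simp
    show "(1 - z\<^sup>2) * y2 z - 2 * (\<mu> + 1) * z * (sq_powr (- \<mu> - 1) z * k z)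
        + (\<nu> - \<mu>) * (\<nu> + \<mu> + 1) * (sq_powr (- \<mu>) z * v z) = 0"
      using dv(3)[OF z] unfolding y2_def g0 g1 k_def k1_def by algebra
  qed
  show "z \<in> S \<Longrightarrow> deriv (\<lambda>z. sq_powr (- \<mu>) z * v z) z
           = sq_powr (- \<mu> - 1) z * (- 2 * \<mu> * z * v z + (z\<^sup>2 - 1) * deriv v z)"
    using DERIV_imp_deriv[OF d1] by (simp add: k_def)
qed

text \<open>\<open>E\<close> is the weighted Wronskian of \<open>u\<close> and
  \<open>sq_powr (- \<mu>) z * v z\<close> with all branches cancelled. It makes sense across
  \<open>z = 1\<close>, and there only \<open>- 2 * \<mu> * u 1 * v 1\<close> is left.\<close>

lemma contiguous_wronskian_constant:
  assumes S: "open S" "connected S" "z \<in> S" "w \<in> S"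
    and u: "gegenbauer_solution \<nu> \<mu> S u" and v: "gegenbauer_solution \<nu> (- \<mu>) S v"
  defines "E \<equiv> \<lambda>z. u z * (- 2 * \<mu> * z * v z + (z\<^sup>2 - 1) * deriv v z) - (z\<^sup>2 - 1) * deriv u z * v z"
  shows "E z = E w"
proof (rule zero_deriv_imp_constant[OF S(1,2) _ S(3,4)])
  fix z assume z: "z \<in> S"
  note du = gegenbauer_solution_derivs[OF u S(1) z] and dv = gegenbauer_solution_derivs[OF v S(1) z]
  have "(E has_field_derivative deriv u z * (- 2 * \<mu> * z * v z + (z\<^sup>2 - 1) * deriv v z)
     + u z * (- 2 * \<mu> * v z - 2 * \<mu> * z * deriv v z + 2 * z * deriv v z + (z\<^sup>2 - 1) * deriv (deriv v) z)
     - 2 * z * deriv u z * v z - (z\<^sup>2 - 1) * deriv (deriv u) z * v z - (z\<^sup>2 - 1) * deriv u z * deriv v z) (at z)"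
    unfolding E_def by (rule derivative_eq_intros du(1,2) dv(1,2) refl)+ (simp add: algebra_simps)
  moreover have "deriv u z * (- 2 * \<mu> * z * v z + (z\<^sup>2 - 1) * deriv v z)
     + u z * (- 2 * \<mu> * v z - 2 * \<mu> * z * deriv v z + 2 * z * deriv v z + (z\<^sup>2 - 1) * deriv (deriv v) z)
     - 2 * z * deriv u z * v z - (z\<^sup>2 - 1) * deriv (deriv u) z * v z - (z\<^sup>2 - 1) * deriv u z * deriv v z = 0"
    using du(3) dv(3) by algebra
  ultimately show "(E has_field_derivative 0) (at z)" by simp
qed

section \<open>The kernel of the Legendre function\<close>

text \<open>What remains of \<open>legendre_Q\<close> without the constants and without the power of
  \<open>z\<^sup>2 - 1\<close>; this is the factor that solves the Gegenbauer equation.\<close>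

definition legendre_Q_kernel :: "complex \<Rightarrow> complex \<Rightarrow> complex \<Rightarrow> complex" where
  "legendre_Q_kernel \<nu> \<mu> z = z powr (- (\<nu> + \<mu> + 1))
     * reg_hyp2F1 ((\<nu> + \<mu> + 2) / 2) ((\<nu> + \<mu> + 1) / 2) (\<nu> + 3 / 2) (1 / z\<^sup>2)"

text \<open>For the derivative: with \<open>b = (\<nu> + \<mu> + 1) / 2\<close> and
  \<open>w = 1 / z\<^sup>2\<close>, differentiation applies the operator \<open>w * d/dw + b\<close>
  to the hypergeometric factor, and this raises b to \<open>b + 1\<close> because
  \<open>(n + b) * pochhammer b n = b * pochhammer (b + 1) n\<close>. As the other parameter is
  \<open>a = b + 1 / 2\<close>, the pair \<open>b + 1\<close>, \<open>a\<close> is exactly the one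
  that belongs to \<open>\<mu> + 1\<close>.\<close>

lemma legendre_Q_kernel_solution:
  "gegenbauer_solution \<nu> \<mu> cut_plane (legendre_Q_kernel \<nu> \<mu>)"
  and legendre_Q_kernel_deriv: "z \<in> cut_plane \<Longrightarrow>
    deriv (legendre_Q_kernel \<nu> \<mu>) z = - (\<nu> + \<mu> + 1) * legendre_Q_kernel \<nu> (\<mu> + 1) z"
proof -
  define s where "s = \<nu> + \<mu> + 1"
  define a where "a = (\<nu> + \<mu> + 2) / 2"
  define b where "b = (\<nu> + \<mu> + 1) / 2"
  define c where "c = \<nu> + 3 / 2"
  define F where "F = reg_hyp2F1 a b c"
  define i where "i = (\<lambda>z::complex. 1 / z)"
  define y1 where "y1 = (\<lambda>z. z powr (- s) * (- s * i z * F (1 / z\<^sup>2) - 2 * i z ^ 3 * deriv F (1 / z\<^sup>2)))"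
  define y2 where "y2 = (\<lambda>z. z powr (- s) * (s * (s + 1) * i z ^ 2 * F (1 / z\<^sup>2)
     + (4 * s + 6) * i z ^ 4 * deriv F (1 / z\<^sup>2) + 4 * i z ^ 6 * deriv (deriv F) (1 / z\<^sup>2)))"
  have K: "legendre_Q_kernel \<nu> \<mu> = (\<lambda>z. z powr (- s) * F (1 / z\<^sup>2))"
    by (auto simp: legendre_Q_kernel_def fun_eq_iff s_def F_def a_def b_def c_def)
  have di: "(i has_field_derivative - (i z ^ 2)) (at z)" if "z \<in> cut_plane" for z
    unfolding i_def using cut_plane_facts[OF that]
    by (auto intro!: derivative_eq_intros simp: power2_eq_square)
  have dw: "((\<lambda>z. 1 / z\<^sup>2) has_field_derivative - 2 * i z ^ 3) (at z)" if "z \<in> cut_plane" for z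
    unfolding i_def using cut_plane_facts[OF that]
    by (auto intro!: derivative_eq_intros simp: power2_eq_square power3_eq_cube field_simps)
  have dp: "((\<lambda>z. z powr (- s)) has_field_derivative - s * i z * z powr (- s)) (at z)" if "z \<in> cut_plane" for z
    unfolding i_def using cut_plane_facts[OF that]
    by (auto intro!: derivative_eq_intros simp: powr_diff)
  have dF: "((\<lambda>z. F (1 / z\<^sup>2)) has_field_derivative deriv F (1 / z\<^sup>2) * (- 2 * i z ^ 3)) (at z)"
    "((\<lambda>z. deriv F (1 / z\<^sup>2)) has_field_derivative deriv (deriv F) (1 / z\<^sup>2) * (- 2 * i z ^ 3)) (at z)"
    if "z \<in> cut_plane" for z
    unfolding F_def by (rule DERIV_chain2[OF reg_hyp2F1_derivs(1)[OF cut_plane_facts(8)[OF that]] dw[OF that]],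
      rule DERIV_chain2[OF reg_hyp2F1_derivs(2)[OF cut_plane_facts(8)[OF that]] dw[OF that]])
  have d1: "(legendre_Q_kernel \<nu> \<mu> has_field_derivative y1 z) (at z)" if "z \<in> cut_plane" for z
    unfolding K y1_def using DERIV_mult[OF dp[OF that] dF(1)[OF that]]
    by (simp add: algebra_simps)
  have d2: "(y1 has_field_derivative y2 z) (at z)" if z: "z \<in> cut_plane" for z
    unfolding y1_def y2_def
    by (rule derivative_eq_intros dp[OF z] dF[OF z] di[OF z] refl)+
       (simp add: algebra_simps power_numeral_reduce)
  show "gegenbauer_solution \<nu> \<mu> cut_plane (legendre_Q_kernel \<nu> \<mu>)"
  proof (rule gegenbauer_solutionI[OF open_cut_plane d1 d2])
    fix z assume z: "z \<in> cut_plane"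
    have iz: "i z * z = 1" and w: "1 / z\<^sup>2 = i z ^ 2" using cut_plane_facts[OF z] by (auto simp: i_def power_divide)
    define F0 F1 F2 where "F0 = F (1 / z\<^sup>2)" and "F1 = deriv F (1 / z\<^sup>2)" and "F2 = deriv (deriv F) (1 / z\<^sup>2)"
    have ode: "i z ^ 2 * (1 - i z ^ 2) * F2 + (c - (a + b + 1) * i z ^ 2) * F1 - a * b * F0 = 0"
      using reg_hyp2F1_ode[OF cut_plane_facts(8)[OF z], of a b c] unfolding F0_def F1_def F2_def F_def w .
    have ab: "2 * a = s + 1" "2 * b = s" "2 * c = 2 * \<nu> + 3" "\<mu> = s - \<nu> - 1"
      by (auto simp: a_def b_def c_def s_def field_simps)
    have "(1 - z\<^sup>2) * (s * (s + 1) * i z ^ 2 * F0 + (4 * s + 6) * i z ^ 4 * F1 + 4 * i z ^ 6 * F2)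
      - 2 * (\<mu> + 1) * z * (- s * i z * F0 - 2 * i z ^ 3 * F1) + (\<nu> - \<mu>) * (\<nu> + \<mu> + 1) * F0 = 0"
      using ode iz ab by algebra
    then have "z powr (- s) * ((1 - z\<^sup>2) * (s * (s + 1) * i z ^ 2 * F0 + (4 * s + 6) * i z ^ 4 * F1 + 4 * i z ^ 6 * F2)
      - 2 * (\<mu> + 1) * z * (- s * i z * F0 - 2 * i z ^ 3 * F1) + (\<nu> - \<mu>) * (\<nu> + \<mu> + 1) * F0) = 0" by simp
    then show "(1 - z\<^sup>2) * y2 z - 2 * (\<mu> + 1) * z * y1 z + (\<nu> - \<mu>) * (\<nu> + \<mu> + 1) * legendre_Q_kernel \<nu> \<mu> z = 0"
      unfolding K y1_def y2_def F0_def F1_def F2_def by algebra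
  qed
  have cont: "w * deriv F w + b * F w - b * reg_hyp2F1 (b + 1) a c w = 0" if "w \<in> slit_plane" for w
  proof (rule holomorphic_zero_expansion[OF _ _ open_slit_plane connected_slit_plane zero_in_slit_plane that])
    have "fps_X * fps_deriv (hyp_fps a b c) + fps_const b * hyp_fps a b c - fps_const b * hyp_fps (b + 1) a c = 0"
    proof (rule fps_ext)
      fix n
      have "(of_nat n + b) * pochhammer b n = b * pochhammer (b + 1) n"
        by (metis pochhammer_rec pochhammer_rec' add.commute)
      then have "(of_nat n + b) * fps_nth (hyp_fps a b c) n = b * fps_nth (hyp_fps (b + 1) a c) n"
        by (simp add: hyp_fps_def divide_simps mult_ac)
      then show "fps_nth (fps_X * fps_deriv (hyp_fps a b c) + fps_const b * hyp_fps a b c - fps_const b * hyp_fps (b + 1) a c) n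
         = fps_nth 0 n"
        by (cases n) (auto simp: algebra_simps)
    qed
    moreover have "(\<lambda>w. w * deriv F w + b * F w - b * reg_hyp2F1 (b + 1) a c w) has_fps_expansion
       fps_X * fps_deriv (hyp_fps a b c) + fps_const b * hyp_fps a b c - fps_const b * hyp_fps (b + 1) a c"
      unfolding F_def by (intro fps_expansion_intros reg_hyp2F1_has_fps_expansion)
    ultimately show "(\<lambda>w. w * deriv F w + b * F w - b * reg_hyp2F1 (b + 1) a c w) has_fps_expansion 0" by simp
    show "(\<lambda>w. w * deriv F w + b * F w - b * reg_hyp2F1 (b + 1) a c w) holomorphic_on slit_plane"
      unfolding F_def by (intro holomorphic_intros reg_hyp2F1_holomorphic holomorphic_deriv open_slit_plane)
  qed
  show "deriv (legendre_Q_kernel \<nu> \<mu>) z = - (\<nu> + \<mu> + 1) * legendre_Q_kernel \<nu> (\<mu> + 1) z" if z: "z \<in> cut_plane"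
  proof -
    have "legendre_Q_kernel \<nu> (\<mu> + 1) z = z powr (- s - 1) * reg_hyp2F1 (b + 1) a c (1 / z\<^sup>2)"
    proof -
      have "(\<nu> + (\<mu> + 1) + 2) / 2 = b + 1" "(\<nu> + (\<mu> + 1) + 1) / 2 = a" "- (\<nu> + (\<mu> + 1) + 1) = - s - 1"
        by (simp_all add: a_def b_def s_def field_simps)
      then show ?thesis by (simp only: legendre_Q_kernel_def c_def)
    qed
    moreover have "z powr (- s - 1) = z powr (- s) * i z"
      using cut_plane_facts[OF z] by (simp add: powr_diff i_def)
    moreover have b2: "\<nu> + \<mu> + 1 = 2 * b" by (simp add: b_def)
    ultimately have "- (\<nu> + \<mu> + 1) * legendre_Q_kernel \<nu> (\<mu> + 1) z
      = - 2 * z powr (- s) * i z * (b * reg_hyp2F1 (b + 1) a c (1 / z\<^sup>2))"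
      using b2 by (simp add: mult_ac del: minus_add_distrib)
    also have "b * reg_hyp2F1 (b + 1) a c (1 / z\<^sup>2) = i z ^ 2 * deriv F (1 / z\<^sup>2) + b * F (1 / z\<^sup>2)"
      using cont[OF cut_plane_facts(8)[OF z]] by (simp add: i_def power_divide)
    also have "- 2 * z powr (- s) * i z * (i z ^ 2 * deriv F (1 / z\<^sup>2) + b * F (1 / z\<^sup>2)) = y1 z"
    proof -
      have "s = 2 * b" by (simp add: s_def b_def)
      then show ?thesis unfolding y1_def by algebra
    qed
    finally show ?thesis using DERIV_imp_deriv[OF d1[OF z]] by simp
  qed
qed

lemma legendre_Q_kernel_holomorphic: "legendre_Q_kernel \<nu> \<mu> holomorphic_on cut_plane"
  using legendre_Q_kernel_solution by (simp add: gegenbauer_solution_def)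

section \<open>Connection coefficients at 1\<close>

lemma sq_powr_eq_powr_square:
  assumes "z > 1"
  shows "sq_powr m (of_real z) = of_real z powr (2 * m) * (1 - 1 / (of_real z)\<^sup>2) powr m"
proof -
  have ln: "Ln (complex_of_real (z - 1)) = of_real (ln (z - 1))" "Ln (complex_of_real (z + 1)) = of_real (ln (z + 1))"
    "Ln (complex_of_real z) = of_real (ln z)" "Ln (complex_of_real (1 - 1 / z\<^sup>2)) = of_real (ln (1 - 1 / z\<^sup>2))"
    by (rule Ln_of_real; use assms in \<open>simp add: divide_simps\<close>)+
  have "1 - 1 / z\<^sup>2 = (z - 1) * (z + 1) / z\<^sup>2"
    using assms by (simp add: field_simps power2_eq_square)
  then have "ln (1 - 1 / z\<^sup>2) = ln (z - 1) + ln (z + 1) - 2 * ln z"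
    using assms by (simp add: ln_div ln_mult ln_realpow)
  then have "m * complex_of_real (ln (z - 1) + ln (z + 1)) = m * of_real (2 * ln z + ln (1 - 1 / z\<^sup>2))"
    by simp
  then have eq: "m * of_real (ln (z - 1)) + m * of_real (ln (z + 1))
     = 2 * m * complex_of_real (ln z) + m * of_real (ln (1 - 1 / z\<^sup>2))"
    by (simp add: algebra_simps)
  have c: "of_real z - 1 = complex_of_real (z - 1)" "of_real z + 1 = complex_of_real (z + 1)"
    "1 - 1 / (of_real z)\<^sup>2 = complex_of_real (1 - 1 / z\<^sup>2)" by simp_all
  have nz: "complex_of_real (z - 1) \<noteq> 0" "complex_of_real (z + 1) \<noteq> 0" "complex_of_real z \<noteq> 0" "complex_of_real (1 - 1 / z\<^sup>2) \<noteq> 0"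
    using assms by (simp_all only: of_real_eq_0_iff) (auto simp: field_simps power2_eq_1_iff)
  show ?thesis
    unfolding sq_powr_def c powr_def using nz eq by (simp only: ln if_False flip: exp_add)
qed

text \<open>Identities between powers need to be checked only for real \<open>x > 1\<close>, where
  the logarithms involved are real and additive.\<close>

lemma cut_plane_eqI:
  assumes "f holomorphic_on cut_plane" "g holomorphic_on cut_plane"
    and eq: "\<And>x. x > (1::real) \<Longrightarrow> f (of_real x) = g (of_real x)" and z: "z \<in> cut_plane"
  shows "f z = g z"
proof -
  have "f z - g z = 0"
  proof (rule analytic_continuation[of "\<lambda>z. f z - g z" cut_plane "of_real ` {1<..}" 2])
    show "(\<lambda>z. f z - g z) holomorphic_on cut_plane" using assms by (intro holomorphic_intros)
    show "2 islimpt complex_of_real ` {1<..}"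
      unfolding islimpt_approachable
    proof (intro allI impI)
      fix e :: real assume "e > 0"
      then show "\<exists>x'\<in>complex_of_real ` {1<..}. x' \<noteq> 2 \<and> dist x' 2 < e"
        by (intro bexI[of _ "of_real (2 + e / 2)"] imageI conjI) (auto simp: dist_norm)
    qed
  qed (use open_cut_plane connected_cut_plane z eq in \<open>auto simp: cut_plane_iff simp del: Compl_iff\<close>)
  then show ?thesis by simp
qed

text \<open>Here \<open>a + b - c = \<mu>\<close>, while \<open>c - b\<close> and
  \<open>c - a\<close> are the parameters a and b for \<open>- \<mu>\<close>; the power
  \<open>(1 - 1 / z\<^sup>2) powr \<mu>\<close> of Euler's transformation supplies
  \<open>sq_powr \<mu> z\<close> up to a power of z.\<close>

lemma legendre_Q_kernel_reflect:
  assumes "z \<in> cut_plane"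
  shows "sq_powr \<mu> z * legendre_Q_kernel \<nu> \<mu> z = legendre_Q_kernel \<nu> (- \<mu>) z"
proof (rule cut_plane_eqI[OF _ _ _ assms])
  show "(\<lambda>z. sq_powr \<mu> z * legendre_Q_kernel \<nu> \<mu> z) holomorphic_on cut_plane"
    by (intro holomorphic_intros sq_powr_holomorphic legendre_Q_kernel_holomorphic)
  show "legendre_Q_kernel \<nu> (- \<mu>) holomorphic_on cut_plane" by (rule legendre_Q_kernel_holomorphic)
  fix x :: real assume x: "x > 1"
  define a where "a = (\<nu> + \<mu> + 2) / 2"
  define b where "b = (\<nu> + \<mu> + 1) / 2"
  define c where "c = \<nu> + 3 / 2"
  define z where "z = complex_of_real x"
  have "z \<in> cut_plane" using x by (simp add: z_def cut_plane_iff del: Compl_iff)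
  then have "1 / z\<^sup>2 \<in> slit_plane" by (rule cut_plane_facts)
  from euler_transformation[OF this, of a b c]
  have "(1 - 1 / z\<^sup>2) powr \<mu> * reg_hyp2F1 a b c (1 / z\<^sup>2) = reg_hyp2F1 (c - a) (c - b) c (1 / z\<^sup>2)"
    by (simp add: a_def b_def c_def field_simps)
  moreover have "reg_hyp2F1 (c - a) (c - b) c = reg_hyp2F1 (c - b) (c - a) c"
    by (simp add: reg_hyp2F1_def mult_ac)
  moreover have "c - b = (\<nu> + - \<mu> + 2) / 2" "c - a = (\<nu> + - \<mu> + 1) / 2"
    by (simp_all add: a_def b_def c_def field_simps)
  moreover have "z powr (- (\<nu> + - \<mu> + 1)) = z powr (- (\<nu> + \<mu> + 1)) * z powr (2 * \<mu>)"
    by (simp flip: powr_add add: algebra_simps)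
  ultimately show "sq_powr \<mu> (of_real x) * legendre_Q_kernel \<nu> \<mu> (of_real x) = legendre_Q_kernel \<nu> (- \<mu>) (of_real x)"
    unfolding sq_powr_eq_powr_square[OF x] legendre_Q_kernel_def z_def a_def[symmetric] b_def[symmetric] c_def[symmetric]
    by (simp add: mult_ac)
qed

lemma legendre_Q_kernel_limit_at_1:
  assumes "Re \<mu> > 0"
  shows "((\<lambda>x. sq_powr \<mu> (of_real x) * legendre_Q_kernel \<nu> \<mu> (of_real x))
     \<longlongrightarrow> Gamma \<mu> * rGamma ((\<nu> + \<mu> + 2) / 2) * rGamma ((\<nu> + \<mu> + 1) / 2)) (at_right 1)"
proof -
  define a where "a = (\<nu> + \<mu> + 2) / 2"
  define b where "b = (\<nu> + \<mu> + 1) / 2"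
  define c where "c = \<nu> + 3 / 2"
  have abc: "a + b - c = \<mu>" by (simp add: a_def b_def c_def field_simps)
  have "filterlim (\<lambda>x::real. 1 / x\<^sup>2) (at_left 1) (at_right 1)"
  proof (subst filterlim_at, intro conjI)
    have "((\<lambda>x::real. 1 / x\<^sup>2) \<longlongrightarrow> 1 / 1\<^sup>2) (at_right 1)" by (intro tendsto_intros) auto
    then show "((\<lambda>x::real. 1 / x\<^sup>2) \<longlongrightarrow> 1) (at_right 1)" by simp
    show "\<forall>\<^sub>F x::real in at_right 1. 1 / x\<^sup>2 \<in> {..<1} \<and> 1 / x\<^sup>2 \<noteq> 1"
      unfolding eventually_at_right_field by (rule exI[of _ 2]) (auto simp: power2_eq_1_iff)
  qed
  from filterlim_compose[OF reg_hyp2F1_limit_at_1[of a b c, unfolded abc, OF assms] this]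
  have "((\<lambda>x. of_real (1 - 1 / x\<^sup>2) powr \<mu> * reg_hyp2F1 a b c (of_real (1 / x\<^sup>2))) \<longlongrightarrow> Gamma \<mu> * rGamma a * rGamma b) (at_right 1)"
    .
  moreover have "((\<lambda>x. of_real x powr (2 * \<mu> - (\<nu> + \<mu> + 1))) \<longlongrightarrow> of_real 1 powr (2 * \<mu> - (\<nu> + \<mu> + 1))) (at_right 1)"
    by (intro tendsto_intros) auto
  ultimately have "((\<lambda>x. of_real x powr (2 * \<mu> - (\<nu> + \<mu> + 1)) * (of_real (1 - 1 / x\<^sup>2) powr \<mu> * reg_hyp2F1 a b c (of_real (1 / x\<^sup>2))))
     \<longlongrightarrow> of_real 1 powr (2 * \<mu> - (\<nu> + \<mu> + 1)) * (Gamma \<mu> * rGamma a * rGamma b)) (at_right 1)"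
    by (rule tendsto_mult[rotated])
  moreover have "\<forall>\<^sub>F x in at_right 1. of_real x powr (2 * \<mu> - (\<nu> + \<mu> + 1)) * (of_real (1 - 1 / x\<^sup>2) powr \<mu> * reg_hyp2F1 a b c (of_real (1 / x\<^sup>2)))
     = sq_powr \<mu> (of_real x) * legendre_Q_kernel \<nu> \<mu> (of_real x)"
    unfolding eventually_at_right_field
  proof (intro exI[of _ 2] conjI allI impI)
    fix x :: real assume x: "1 < x" "x < 2"
    have "complex_of_real x powr (2 * \<mu> - (\<nu> + \<mu> + 1)) = of_real x powr (2 * \<mu>) * of_real x powr (- (\<nu> + \<mu> + 1))"
      by (simp flip: powr_add)
    then show "of_real x powr (2 * \<mu> - (\<nu> + \<mu> + 1)) * (of_real (1 - 1 / x\<^sup>2) powr \<mu> * reg_hyp2F1 a b c (of_real (1 / x\<^sup>2)))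
     = sq_powr \<mu> (of_real x) * legendre_Q_kernel \<nu> \<mu> (of_real x)"
      unfolding sq_powr_eq_powr_square[OF x(1)] legendre_Q_kernel_def a_def[symmetric] b_def[symmetric] c_def[symmetric]
      by simp
  qed simp
  ultimately have "((\<lambda>x. sq_powr \<mu> (of_real x) * legendre_Q_kernel \<nu> \<mu> (of_real x))
     \<longlongrightarrow> of_real 1 powr (2 * \<mu> - (\<nu> + \<mu> + 1)) * (Gamma \<mu> * rGamma a * rGamma b)) (at_right 1)"
    by (rule Lim_transform_eventually)
  then show ?thesis by (simp add: a_def b_def)
qed

text \<open>
  Differentiating the hypothesis replaces \<open>\<mu>\<close> by \<open>\<mu> + 1\<close>, which makes the singular part dominant after
  finitely many steps. The factor \<open>\<kappa>\<close> absorbs \<open>- (\<nu> + \<mu> + 1)\<close>, which may vanish.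
\<close>
lemma singular_coefficient:
  assumes "Re \<mu> + real N > 0" "\<mu> \<notin> \<int>" "\<delta> > 0" "g holomorphic_on ball 1 \<delta>" "k holomorphic_on ball 1 \<delta>"
    and "\<And>z. z \<in> ball 1 \<delta> \<inter> cut_plane \<Longrightarrow> \<kappa> * legendre_Q_kernel \<nu> \<mu> z = g z + sq_powr (- \<mu>) z * k z"
  shows "k 1 = \<kappa> * (Gamma \<mu> * rGamma ((\<nu> + \<mu> + 2) / 2) * rGamma ((\<nu> + \<mu> + 1) / 2))"
  using assms
proof (induction N arbitrary: \<mu> g k \<kappa>)
  case 0
  have \<mu>: "Re \<mu> > 0" using 0(1) by simp
  have gk: "isCont g 1" "isCont k 1"
    using continuous_on_interior[OF holomorphic_on_imp_continuous_on[OF 0(4)], of 1]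
      continuous_on_interior[OF holomorphic_on_imp_continuous_on[OF 0(5)], of 1] 0(3)
    by (simp_all add: interior_open)
  have r: "filterlim complex_of_real (nhds 1) (at_right 1)"
    using tendsto_of_real[OF tendsto_ident_at, of 1 "{1<..}", where 'a = complex] by simp
  have lim: "((\<lambda>x. g (of_real x)) \<longlongrightarrow> g 1) (at_right 1)" "((\<lambda>x. k (of_real x)) \<longlongrightarrow> k 1) (at_right 1)"
    using gk r by (auto intro: isCont_tendsto_compose)
  have "((\<lambda>x. norm (sq_powr \<mu> (complex_of_real x))) \<longlongrightarrow> 0) (at_right 1)"
  proof (rule Lim_transform_eventually)
    have "((\<lambda>x. (x - 1) powr Re \<mu> * (x + 1) powr Re \<mu>) \<longlongrightarrow> (1 - 1) powr Re \<mu> * (1 + 1) powr Re \<mu>) (at_right (1::real))"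
      using \<mu> by (intro tendsto_mult tendsto_powr' tendsto_intros) (auto simp: eventually_at_filter)
    then show "((\<lambda>x. (x - 1) powr Re \<mu> * (x + 1) powr Re \<mu>) \<longlongrightarrow> 0) (at_right (1::real))" by simp
    show "\<forall>\<^sub>F x in at_right 1. (x - 1) powr Re \<mu> * (x + 1) powr Re \<mu> = norm (sq_powr \<mu> (complex_of_real x))"
      unfolding eventually_at_right_field
    proof (intro exI[of _ 2] conjI allI impI)
      fix x :: real assume x: "1 < x" "x < 2"
      have "complex_of_real x - 1 = of_real (x - 1)" "complex_of_real x + 1 = of_real (x + 1)" by simp_all
      then show "(x - 1) powr Re \<mu> * (x + 1) powr Re \<mu> = norm (sq_powr \<mu> (complex_of_real x))"
        using x by (simp only: sq_powr_def norm_mult) (simp add: norm_powr_real_powr del: of_real_diff of_real_add)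
    qed simp
  qed
  then have sq0: "((\<lambda>x. sq_powr \<mu> (complex_of_real x)) \<longlongrightarrow> 0) (at_right 1)"
    by (simp only: tendsto_norm_zero_iff)
  \<comment> \<open>Multiplied by \<open>sq_powr \<mu>\<close>, the regular part tends to 0, and
    \<open>k\<close> is what remains of the singular part.\<close>
  have "((\<lambda>x. \<kappa> * (sq_powr \<mu> (of_real x) * legendre_Q_kernel \<nu> \<mu> (of_real x)) - sq_powr \<mu> (of_real x) * g (of_real x))
     \<longlongrightarrow> \<kappa> * (Gamma \<mu> * rGamma ((\<nu> + \<mu> + 2) / 2) * rGamma ((\<nu> + \<mu> + 1) / 2)) - 0 * g 1) (at_right 1)"
    by (intro tendsto_intros legendre_Q_kernel_limit_at_1 \<mu> lim sq0)
  moreover have "\<forall>\<^sub>F x in at_right 1. \<kappa> * (sq_powr \<mu> (of_real x) * legendre_Q_kernel \<nu> \<mu> (of_real x)) - sq_powr \<mu> (of_real x) * g (of_real x)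
     = k (of_real x)"
    unfolding eventually_at_right_field
  proof (intro exI[of _ "1 + \<delta>"] conjI allI impI)
    fix x :: real assume x: "1 < x" "x < 1 + \<delta>"
    have c: "complex_of_real x \<in> cut_plane" using x by (simp add: cut_plane_iff del: Compl_iff)
    have "complex_of_real x \<in> ball 1 \<delta>"
      using dist_of_real[of 1 x, where 'a = complex] x by (simp add: dist_real_def)
    with c have "\<kappa> * legendre_Q_kernel \<nu> \<mu> (of_real x) = g (of_real x) + sq_powr (- \<mu>) (of_real x) * k (of_real x)"
      by (intro 0(6)) blast
    moreover have "sq_powr \<mu> (of_real x) * sq_powr (- \<mu>) (of_real x) = 1" by (rule sq_powr_mult_minus[OF c])
    ultimately show "\<kappa> * (sq_powr \<mu> (of_real x) * legendre_Q_kernel \<nu> \<mu> (of_real x)) - sq_powr \<mu> (of_real x) * g (of_real x)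
       = k (of_real x)" by algebra
  qed (use 0(3) in simp)
  ultimately have "((\<lambda>x. k (of_real x)) \<longlongrightarrow> \<kappa> * (Gamma \<mu> * rGamma ((\<nu> + \<mu> + 2) / 2) * rGamma ((\<nu> + \<mu> + 1) / 2)) - 0 * g 1) (at_right 1)"
    by (rule Lim_transform_eventually)
  from tendsto_unique[OF _ lim(2) this] show ?case by simp
next
  case (Suc N)
  define S where "S = ball 1 \<delta> \<inter> cut_plane"
  have S: "open S" unfolding S_def by (intro open_Int open_ball open_cut_plane)
  \<comment> \<open>The derivative of \<open>sq_powr (- \<mu>) z * k z\<close> is
    \<open>sq_powr (- \<mu> - 1) z * k' z\<close>. At 1 the second summand vanishes, so
    \<open>k' 1 = - 2 * \<mu> * k 1\<close> returns the coefficient sought, as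
    \<open>\<mu> \<noteq> 0\<close>.\<close>
  define k' where "k' = (\<lambda>z. - 2 * \<mu> * z * k z + (z\<^sup>2 - 1) * deriv k z)"
  have dgk: "deriv g holomorphic_on ball 1 \<delta>" "deriv k holomorphic_on ball 1 \<delta>"
    by (rule holomorphic_deriv[OF Suc.prems(4) open_ball] holomorphic_deriv[OF Suc.prems(5) open_ball])+
  have "k' 1 = (- (\<nu> + \<mu> + 1) * \<kappa>) * (Gamma (\<mu> + 1) * rGamma ((\<nu> + (\<mu> + 1) + 2) / 2) * rGamma ((\<nu> + (\<mu> + 1) + 1) / 2))"
  proof (rule Suc.IH[where g = "deriv g" and k = k'])
    show "Re (\<mu> + 1) + real N > 0" using Suc.prems(1) by simp
    show "\<mu> + 1 \<notin> \<int>" using Suc.prems(2) Ints_diff[OF _ Ints_1, of "\<mu> + 1"] by auto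
    show "k' holomorphic_on ball 1 \<delta>"
      unfolding k'_def
      by (intro holomorphic_on_add holomorphic_on_mult holomorphic_on_diff holomorphic_on_power
          holomorphic_on_const holomorphic_on_ident dgk(2) Suc.prems(5))
    fix z assume z: "z \<in> ball 1 \<delta> \<inter> cut_plane"
    then have zc: "z \<in> cut_plane" "z \<in> S" by (auto simp: S_def)
    have "((\<lambda>z. \<kappa> * legendre_Q_kernel \<nu> \<mu> z) has_field_derivative \<kappa> * (- (\<nu> + \<mu> + 1) * legendre_Q_kernel \<nu> (\<mu> + 1) z)) (at z)"
      using DERIV_cmult[OF holomorphic_derivI[OF legendre_Q_kernel_holomorphic open_cut_plane zc(1)], of \<kappa> \<nu> \<mu>]
      by (simp only: legendre_Q_kernel_deriv[OF zc(1)])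
    moreover have "((\<lambda>z. \<kappa> * legendre_Q_kernel \<nu> \<mu> z) has_field_derivative
       deriv g z + (2 * - \<mu> * z * sq_powr (- \<mu> - 1) z * k z + deriv k z * sq_powr (- \<mu>) z)) (at z)"
    proof (rule has_field_derivative_transform_within_open[OF _ S zc(2)])
      show "((\<lambda>z. g z + sq_powr (- \<mu>) z * k z) has_field_derivative
         deriv g z + (2 * - \<mu> * z * sq_powr (- \<mu> - 1) z * k z + deriv k z * sq_powr (- \<mu>) z)) (at z)"
        using z by (intro DERIV_add DERIV_mult sq_powr_deriv zc(1)
            holomorphic_derivI[OF Suc.prems(4) open_ball] holomorphic_derivI[OF Suc.prems(5) open_ball]) auto
      show "g w + sq_powr (- \<mu>) w * k w = \<kappa> * legendre_Q_kernel \<nu> \<mu> w" if "w \<in> S" for w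
        using Suc.prems(6)[OF that[unfolded S_def]] by (rule sym)
    qed
    ultimately have "\<kappa> * (- (\<nu> + \<mu> + 1) * legendre_Q_kernel \<nu> (\<mu> + 1) z)
       = deriv g z + (2 * - \<mu> * z * sq_powr (- \<mu> - 1) z * k z + deriv k z * sq_powr (- \<mu>) z)"
      by (rule DERIV_unique)
    moreover have "sq_powr (- \<mu>) z = (z\<^sup>2 - 1) * sq_powr (- \<mu> - 1) z"
      by (rule sq_powr_minus_1[OF zc(1)])
    moreover have shift: "- (\<mu> + 1) = - \<mu> - 1" by simp
    ultimately show "- (\<nu> + \<mu> + 1) * \<kappa> * legendre_Q_kernel \<nu> (\<mu> + 1) z = deriv g z + sq_powr (- (\<mu> + 1)) z * k' z"
      unfolding shift k'_def by algebra
  qed (use Suc.prems(3) dgk in simp_all)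
  moreover have "k' 1 = - 2 * \<mu> * k 1" by (simp add: k'_def)
  moreover have "(\<nu> + (\<mu> + 1) + 1) / 2 = (\<nu> + \<mu> + 2) / 2" by simp
  ultimately have k1: "- 2 * \<mu> * k 1 = (- (\<nu> + \<mu> + 1) * \<kappa>)
      * (Gamma (\<mu> + 1) * rGamma ((\<nu> + (\<mu> + 1) + 2) / 2) * rGamma ((\<nu> + \<mu> + 2) / 2))"
    by (simp only:)
  have \<mu>: "\<mu> \<noteq> 0" "\<mu> \<notin> \<int>\<^sub>\<le>\<^sub>0" using Suc.prems(2) nonpos_Ints_Int by auto
  \<comment> \<open>The factor \<open>\<nu> + \<mu> + 1\<close> produced by differentiation is
    absorbed into a shift of \<open>rGamma\<close>, so that no division by it occurs.\<close>
  have rG: "(\<nu> + \<mu> + 1) * rGamma ((\<nu> + (\<mu> + 1) + 2) / 2) = 2 * rGamma ((\<nu> + \<mu> + 1) / 2)"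
  proof -
    have "(\<nu> + (\<mu> + 1) + 2) / 2 = (\<nu> + \<mu> + 1) / 2 + 1" by simp
    then show ?thesis using rGamma_plus1[of "(\<nu> + \<mu> + 1) / 2"] by (simp only:) simp
  qed
  have "\<mu> * k 1 = \<mu> * (\<kappa> * (Gamma \<mu> * rGamma ((\<nu> + \<mu> + 2) / 2) * rGamma ((\<nu> + \<mu> + 1) / 2)))"
    using k1 rG unfolding Gamma_plus1[OF \<mu>(2)] by algebra
  then show ?case using \<mu>(1) by simp
qed

section \<open>The expansion in the right half plane\<close>

abbreviation right_half_plane :: "complex set" where
  "right_half_plane \<equiv> {z. Re z > 0}"

lemma open_right_half_plane: "open right_half_plane"
  by (rule open_halfspace_Re_gt)

lemma one_minus_square_in_slit_plane:
  assumes "Re z > 0"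
  shows "1 - z\<^sup>2 \<in> slit_plane"
proof (rule ccontr)
  assume "1 - z\<^sup>2 \<notin> slit_plane"
  then have "Im (1 - z\<^sup>2) = 0" "Re (1 - z\<^sup>2) \<ge> 1" unfolding slit_plane_iff by auto
  then have "Re z * Im z = 0" "(Re z)\<^sup>2 \<le> (Im z)\<^sup>2" by (auto simp: power2_eq_square)
  with assms show False by auto
qed

text \<open>For reciprocals the duplication formula has no exceptions: \<open>2 * z\<close> is a
  nonpositive integer exactly when \<open>z\<close> or \<open>z + 1 / 2\<close> is one, and then
  both sides vanish. The exceptional arguments do occur, since \<open>\<nu> - \<mu>\<close> is
  unrestricted in the theorem.\<close>

lemma rGamma_legendre_duplication:
  fixes z :: complex
  shows "exp ((1 - 2 * z) * of_real (ln 2)) * of_real (sqrt pi) * rGamma z * rGamma (z + 1 / 2) = rGamma (2 * z)"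
proof (cases "z \<in> \<int>\<^sub>\<le>\<^sub>0 \<or> z + 1 / 2 \<in> \<int>\<^sub>\<le>\<^sub>0")
  case True
  have "2 * z \<in> \<int>\<^sub>\<le>\<^sub>0"
  proof -
    from True consider n where "z = - of_nat n" | n where "z + 1 / 2 = - of_nat n"
      by (auto elim!: nonpos_Ints_cases')
    then show ?thesis
    proof cases
      case 1
      then have "2 * z = - of_nat (2 * n)" by simp
      then show ?thesis by (simp only: minus_of_nat_in_nonpos_Ints)
    next
      case 2
      have "2 * z = 2 * (z + 1 / 2) - 1" by (simp add: distrib_left)
      also have "\<dots> = - of_nat (2 * n + 1)" unfolding 2 by simp
      finally have "2 * z = - of_nat (2 * n + 1)" .
      then show ?thesis by (simp only: minus_of_nat_in_nonpos_Ints)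
    qed
  qed
  then have "rGamma (2 * z) = 0" "rGamma z = 0 \<or> rGamma (z + 1 / 2) = 0"
    using True by (simp_all only: rGamma_eq_zero_iff)
  then show ?thesis by auto
next
  case False
  have "2 * z \<notin> \<int>\<^sub>\<le>\<^sub>0"
  proof
    assume "2 * z \<in> \<int>\<^sub>\<le>\<^sub>0"
    then obtain n where n: "2 * z = - of_nat n" by (auto elim!: nonpos_Ints_cases')
    show False
    proof (cases "even n")
      case True
      then obtain k where "n = 2 * k" by blast
      with n have "z = - of_nat k" by simp
      then show False using False by simp
    next
      case odd: False
      then obtain k where "n = 2 * k + 1" by (elim oddE)
      with n have "2 * z = - (2 * of_nat k + 1)" by simp
      then have "2 * (z + 1 / 2) = 2 * (- of_nat k)" unfolding distrib_left by simp
      then have "z + 1 / 2 = - of_nat k" by (subst (asm) mult_cancel_left) simp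
      then show False using False by simp
    qed
  qed
  then have "Gamma z \<noteq> 0" "Gamma (z + 1 / 2) \<noteq> 0" "Gamma (2 * z) \<noteq> 0" using False by (auto simp: Gamma_eq_zero_iff)
  then show ?thesis using Gamma_legendre_duplication[of z] False
    by (simp add: rGamma_inverse_Gamma field_simps)
qed

definition legendre_regular :: "complex \<Rightarrow> complex \<Rightarrow> complex \<Rightarrow> complex" where
  "legendre_regular \<nu> \<mu> z = reg_hyp2F1 ((\<nu> + \<mu> + 1) / 2) ((\<mu> - \<nu>) / 2) (1 + \<mu>) (1 - z\<^sup>2)"

lemma legendre_regular_solution: "gegenbauer_solution \<nu> \<mu> right_half_plane (legendre_regular \<nu> \<mu>)"
  unfolding legendre_regular_def[abs_def]
  by (rule gegenbauer_solution_at_1[OF open_right_half_plane]) (use one_minus_square_in_slit_plane in auto)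

lemma legendre_regular_holomorphic: "legendre_regular \<nu> \<mu> holomorphic_on right_half_plane"
  using legendre_regular_solution by (simp add: gegenbauer_solution_def)

lemma legendre_regular_1: "legendre_regular \<nu> \<mu> 1 = rGamma (1 + \<mu>)"
  by (simp add: legendre_regular_def reg_hyp2F1_0)

lemma legendre_Q_kernel_expansion:
  fixes \<mu> \<nu> z :: complex
  assumes \<mu>: "\<mu> \<notin> \<int>"
  defines "A \<equiv> Gamma (1 + \<mu>) * (Gamma (- \<mu>) * rGamma ((\<nu> - \<mu> + 2) / 2) * rGamma ((\<nu> - \<mu> + 1) / 2))"
    and "B \<equiv> Gamma (1 - \<mu>) * (Gamma \<mu> * rGamma ((\<nu> + \<mu> + 2) / 2) * rGamma ((\<nu> + \<mu> + 1) / 2))"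
  assumes z: "z \<in> cut_plane" "Re z > 0"
  shows "legendre_Q_kernel \<nu> \<mu> z
     = A * legendre_regular \<nu> \<mu> z + B * (sq_powr (- \<mu>) z * legendre_regular \<nu> (- \<mu>) z)"
proof -
  define R where "R = cut_plane \<inter> right_half_plane"
  have R: "open R" "connected R" "R \<subseteq> cut_plane" "R \<subseteq> right_half_plane"
    unfolding R_def using open_cut_plane open_right_half_plane connected_cut_plane_Int[OF convex_halfspace_Re_gt]
    by auto
  define u where "u = legendre_regular \<nu> \<mu>"
  define v where "v = legendre_regular \<nu> (- \<mu>)"
  have sol: "gegenbauer_solution \<nu> \<mu> right_half_plane u" "gegenbauer_solution \<nu> (- \<mu>) right_half_plane v"
    unfolding u_def v_def by (rule legendre_regular_solution)+
  have solR: "gegenbauer_solution \<nu> \<mu> R u" "gegenbauer_solution \<nu> (- \<mu>) R v"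
    "gegenbauer_solution \<nu> \<mu> R (legendre_Q_kernel \<nu> \<mu>)"
    using sol R legendre_Q_kernel_solution gegenbauer_solution_subset by blast+
  note v2 = sq_powr_times_solution[OF R(1,3) solR(2)]
  have nonint: "1 + \<mu> \<notin> \<int>" "1 - \<mu> \<notin> \<int>" "- \<mu> \<notin> \<int>"
    using \<mu> Ints_diff[of "1 + \<mu>" 1] Ints_diff[of 1 "1 - \<mu>"] by auto
  then have nz: "rGamma (1 + \<mu>) \<noteq> 0" "rGamma (1 - \<mu>) \<noteq> 0" "\<mu> \<noteq> 0"
    using \<mu> nonpos_Ints_Int by (auto simp: rGamma_eq_zero_iff)
  have "\<exists>A B. \<forall>z\<in>R. legendre_Q_kernel \<nu> \<mu> z = A * u z + B * (sq_powr (- \<mu>) z * v z)"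
  proof (rule gegenbauer_solution_span[OF solR(3) solR(1) v2(1) R(1,2)])
    fix w assume w: "w \<in> R"
    then have wc: "w \<in> cut_plane" "Re w > 0" by (auto simp: R_def)
    show "(sq_powr (\<mu> + 1) has_field_derivative 2 * (\<mu> + 1) * w * sq_powr (\<mu> + 1 - 1) w) (at w)"
      by (rule sq_powr_deriv[OF wc(1)])
    show "(1 - w\<^sup>2) * (2 * (\<mu> + 1) * w * sq_powr (\<mu> + 1 - 1) w) = - 2 * (\<mu> + 1) * w * sq_powr (\<mu> + 1) w"
      unfolding sq_powr_minus_1[OF wc(1), of "\<mu> + 1"] by algebra
    show "w\<^sup>2 \<noteq> 1" "sq_powr (\<mu> + 1) w \<noteq> 0" using wc cut_plane_facts sq_powr_nonzero by blast+
    \<comment> \<open>The constant is evaluated at 1, where it equals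
      \<open>- 2 * \<mu> * rGamma (1 + \<mu>) * rGamma (1 - \<mu>)\<close>; this is nonzero because
      \<open>\<mu>\<close> is not an integer.\<close>
    have "u w * (- 2 * \<mu> * w * v w + (w\<^sup>2 - 1) * deriv v w) - (w\<^sup>2 - 1) * deriv u w * v w
        = u 1 * (- 2 * \<mu> * 1 * v 1 + (1\<^sup>2 - 1) * deriv v 1) - (1\<^sup>2 - 1) * deriv u 1 * v 1"
      by (rule contiguous_wronskian_constant[OF open_right_half_plane _ _ _ sol])
         (use wc in \<open>auto intro!: convex_connected convex_halfspace_Re_gt\<close>)
    also have "\<dots> \<noteq> 0" using nz by (simp add: u_def v_def legendre_regular_1)
    finally have "sq_powr (- \<mu> - 1) w * (u w * (- 2 * \<mu> * w * v w + (w\<^sup>2 - 1) * deriv v w) - (w\<^sup>2 - 1) * deriv u w * v w) \<noteq> 0"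
      using sq_powr_nonzero[OF wc(1)] by simp
    also have "sq_powr (- \<mu> - 1) w * (u w * (- 2 * \<mu> * w * v w + (w\<^sup>2 - 1) * deriv v w) - (w\<^sup>2 - 1) * deriv u w * v w)
       = u w * deriv (\<lambda>z. sq_powr (- \<mu>) z * v z) w - deriv u w * (sq_powr (- \<mu>) w * v w)"
      unfolding v2(2)[OF w] sq_powr_minus_1[OF wc(1), of "- \<mu>"] by algebra
    finally show "u w * deriv (\<lambda>z. sq_powr (- \<mu>) z * v z) w - deriv u w * (sq_powr (- \<mu>) w * v w) \<noteq> 0" .
  qed
  then obtain A' B' where AB: "\<And>z. z \<in> R \<Longrightarrow> legendre_Q_kernel \<nu> \<mu> z = A' * u z + B' * (sq_powr (- \<mu>) z * v z)"
    by blast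
  have ball: "ball 1 1 \<subseteq> right_half_plane"
  proof
    fix z :: complex assume "z \<in> ball 1 1"
    then have "Re (1 - z) < 1" using complex_Re_le_cmod[of "1 - z"] by (simp add: dist_norm)
    then show "z \<in> right_half_plane" by simp
  qed
  have hol: "u holomorphic_on ball 1 1" "v holomorphic_on ball 1 1"
    unfolding u_def v_def using legendre_regular_holomorphic ball holomorphic_on_subset by blast+
  have ballR: "z \<in> R" if "z \<in> ball 1 1 \<inter> cut_plane" for z using that ball by (auto simp: R_def)
  obtain N :: nat where N: "- Re \<mu> < real N" using reals_Archimedean2 by blast
  have "(\<lambda>z. B' * v z) 1 = 1 * (Gamma \<mu> * rGamma ((\<nu> + \<mu> + 2) / 2) * rGamma ((\<nu> + \<mu> + 1) / 2))"
  proof (rule singular_coefficient[of \<mu> N 1 "\<lambda>z. A' * u z" "\<lambda>z. B' * v z"])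
    show "1 * legendre_Q_kernel \<nu> \<mu> z = A' * u z + sq_powr (- \<mu>) z * (B' * v z)" if "z \<in> ball 1 1 \<inter> cut_plane" for z
      using AB[OF ballR[OF that]] by (simp add: mult_ac)
  qed (use N \<mu> hol in \<open>auto intro!: holomorphic_intros\<close>)
  then have "B' * rGamma (1 - \<mu>) = Gamma \<mu> * rGamma ((\<nu> + \<mu> + 2) / 2) * rGamma ((\<nu> + \<mu> + 1) / 2)"
    by (simp add: v_def legendre_regular_1)
  moreover have "Gamma (1 - \<mu>) * rGamma (1 - \<mu>) = 1" using nz by (simp add: Gamma_def)
  ultimately have B: "B' = B" unfolding B_def by algebra
  obtain M :: nat where M: "Re \<mu> < real M" using reals_Archimedean2 by blast
  \<comment> \<open>Multiplication by \<open>sq_powr \<mu>\<close> interchanges the regular and the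
    singular part, so \<open>A'\<close> is the singular coefficient for the kernel of order
    \<open>- \<mu>\<close>.\<close>
  have "(\<lambda>z. A' * u z) 1 = 1 * (Gamma (- \<mu>) * rGamma ((\<nu> + - \<mu> + 2) / 2) * rGamma ((\<nu> + - \<mu> + 1) / 2))"
  proof (rule singular_coefficient[of "- \<mu>" M 1 "\<lambda>z. B' * v z" "\<lambda>z. A' * u z"])
    fix z assume z: "z \<in> ball 1 1 \<inter> cut_plane"
    then have zc: "z \<in> cut_plane" by auto
    have "legendre_Q_kernel \<nu> (- \<mu>) z = sq_powr \<mu> z * (A' * u z + B' * (sq_powr (- \<mu>) z * v z))"
      using legendre_Q_kernel_reflect[OF zc, of \<mu> \<nu>] AB[OF ballR[OF z]] by simp
    then show "1 * legendre_Q_kernel \<nu> (- \<mu>) z = B' * v z + sq_powr (- (- \<mu>)) z * (A' * u z)"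
      using sq_powr_mult_minus[OF zc, of \<mu>] unfolding minus_minus by algebra
  qed (use M nonint hol in \<open>auto intro!: holomorphic_intros\<close>)
  then have "A' * rGamma (1 + \<mu>) = Gamma (- \<mu>) * rGamma ((\<nu> - \<mu> + 2) / 2) * rGamma ((\<nu> - \<mu> + 1) / 2)"
    by (simp add: u_def legendre_regular_1)
  moreover have "Gamma (1 + \<mu>) * rGamma (1 + \<mu>) = 1" using nz by (simp add: Gamma_def)
  ultimately have A: "A' = A" unfolding A_def by algebra
  show ?thesis using AB[of z] z unfolding A B u_def v_def R_def by blast
qed

section \<open>The Ferrers function\<close>

lemma D1_iff: "z \<in> D1 \<longleftrightarrow> Im z \<noteq> 0 \<or> \<bar>Re z\<bar> < 1"
  by (auto simp: D1_def image_iff complex_eq_iff not_le)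

lemma open_D1: "open D1"
proof -
  have eq: "D1 = {z. Im z < 0} \<union> {z. Im z > 0} \<union> {z. Re z < 1} \<inter> {z. Re z > -1}"
    by (auto simp: D1_iff)
  show ?thesis
    unfolding eq by (intro open_Int open_Un open_halfspace_Im_gt open_halfspace_Im_lt open_halfspace_Re_lt open_halfspace_Re_gt)
qed

lemma closed_segment_subset_D1:
  assumes x: "x \<in> D1" and r: "\<bar>r\<bar> < (1::real)"
  shows "closed_segment (of_real r) x \<subseteq> D1"
proof
  fix z assume "z \<in> closed_segment (of_real r) x"
  then obtain u where u: "0 \<le> u" "u \<le> 1" "z = (1 - u) *\<^sub>R of_real r + u *\<^sub>R x" by (auto simp: in_segment)
  have "\<bar>Re z\<bar> < 1" if "\<bar>Re x\<bar> < 1 \<or> u = 0"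
  proof (cases "u = 0")
    case False
    with that have "convex ({-1<..<1} :: real set)" "r \<in> {-1<..<1}" "Re x \<in> {-1<..<1}" using r by auto
    from convexD[OF this, of "1 - u" u] u show ?thesis by auto
  qed (use u r in simp)
  then show "z \<in> D1" using x unfolding D1_iff u(3) by auto
qed

lemma connected_D1_Int:
  assumes "convex C" "of_real r \<in> C" "\<bar>r\<bar> < (1::real)"
  shows "connected (D1 \<inter> C)"
proof (rule starlike_imp_connected)
  have "complex_of_real r \<in> D1" using assms by (simp add: D1_iff)
  then show "starlike (D1 \<inter> C)"
    unfolding starlike_def using assms closed_segment_subset_D1[OF _ assms(3)] closed_segment_subset
    by (intro bexI[of _ "of_real r"] ballI) blast+
qed

lemma connected_D1: "connected D1"
  using connected_D1_Int[of UNIV 0] by simp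

lemma D1_square:
  assumes "z \<in> D1"
  shows "z\<^sup>2 \<in> slit_plane" "1 - z\<^sup>2 \<notin> \<real>\<^sub>\<le>\<^sub>0" "z\<^sup>2 \<noteq> 1"
proof -
  show 1: "z\<^sup>2 \<in> slit_plane"
  proof (rule ccontr)
    assume "z\<^sup>2 \<notin> slit_plane"
    then have *: "Im (z\<^sup>2) = 0" "Re (z\<^sup>2) \<ge> 1" unfolding slit_plane_iff by auto
    then have "Re z = 0 \<or> Im z = 0" "(Re z)\<^sup>2 - (Im z)\<^sup>2 \<ge> 1" by (auto simp: power2_eq_square)
    moreover have "(Re z)\<^sup>2 < 1" if "\<bar>Re z\<bar> < 1" using that by (simp add: abs_square_less_1)
    moreover have "(Im z)\<^sup>2 \<ge> 0" by simp
    ultimately show False using assms unfolding D1_iff by (cases "Im z = 0") auto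
  qed
  then show "1 - z\<^sup>2 \<notin> \<real>\<^sub>\<le>\<^sub>0" unfolding slit_plane_iff by (auto simp: complex_nonpos_Reals_iff)
  then show "z\<^sup>2 \<noteq> 1" by auto
qed

lemma one_minus_square_powr_deriv:
  assumes "z \<in> D1"
  shows "((\<lambda>z. (1 - z\<^sup>2) powr m) has_field_derivative - 2 * m * z * (1 - z\<^sup>2) powr (m - 1)) (at z)"
  using D1_square[OF assms] by (auto intro!: derivative_eq_intros)

lemma one_minus_square_powr_holomorphic: "(\<lambda>z. (1 - z\<^sup>2) powr m) holomorphic_on D1"
  using one_minus_square_powr_deriv open_D1 by (auto simp: holomorphic_on_open)

section \<open>Even and odd solutions on \<open>D1\<close>\<close>

definition legendre_even :: "complex \<Rightarrow> complex \<Rightarrow> complex \<Rightarrow> complex" where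
  "legendre_even \<nu> \<mu> z = reg_hyp2F1 ((\<nu> + \<mu> + 1) / 2) ((\<mu> - \<nu>) / 2) (1 / 2) (z\<^sup>2)"

definition legendre_odd :: "complex \<Rightarrow> complex \<Rightarrow> complex \<Rightarrow> complex" where
  "legendre_odd \<nu> \<mu> z = z * reg_hyp2F1 ((\<nu> + \<mu> + 2) / 2) ((\<mu> - \<nu> + 1) / 2) (3 / 2) (z\<^sup>2)"

lemma legendre_even_solution: "gegenbauer_solution \<nu> \<mu> D1 (legendre_even \<nu> \<mu>)"
  unfolding legendre_even_def[abs_def] by (rule gegenbauer_solution_even[OF open_D1 D1_square(1)])

lemma legendre_odd_solution: "gegenbauer_solution \<nu> \<mu> D1 (legendre_odd \<nu> \<mu>)"
  unfolding legendre_odd_def[abs_def] by (rule gegenbauer_solution_odd[OF open_D1 D1_square(1)])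

text \<open>The Wronskian weighted with \<open>(1 - z\<^sup>2) powr (\<mu> + 1)\<close> is constant
  on \<open>D1\<close>, and at 0 it equals \<open>rGamma (1 / 2) * rGamma (3 / 2)\<close>, whatever
  \<open>\<nu>\<close> and \<open>\<mu>\<close> are.\<close>

lemma legendre_even_odd_wronskian:
  assumes z: "z \<in> D1"
  shows "legendre_even \<nu> \<mu> z * deriv (legendre_odd \<nu> \<mu>) z - deriv (legendre_even \<nu> \<mu>) z * legendre_odd \<nu> \<mu> z \<noteq> 0"
proof -
  have 0: "0 \<in> D1" by (simp add: D1_iff)
  have "(1 - z\<^sup>2) powr (\<mu> + 1) * (legendre_even \<nu> \<mu> z * deriv (legendre_odd \<nu> \<mu>) z - deriv (legendre_even \<nu> \<mu>) z * legendre_odd \<nu> \<mu> z)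
    = (1 - 0\<^sup>2) powr (\<mu> + 1) * (legendre_even \<nu> \<mu> 0 * deriv (legendre_odd \<nu> \<mu>) 0 - deriv (legendre_even \<nu> \<mu>) 0 * legendre_odd \<nu> \<mu> 0)"
  proof (rule wronskian_constant[OF legendre_even_solution legendre_odd_solution open_D1 connected_D1 z 0 one_minus_square_powr_deriv])
    fix w assume w: "w \<in> D1"
    have "(1 - w\<^sup>2) powr (\<mu> + 1) = (1 - w\<^sup>2) powr (\<mu> + 1 - 1) * (1 - w\<^sup>2)"
      using D1_square[OF w] by (simp add: powr_add)
    then show "(1 - w\<^sup>2) * (- 2 * (\<mu> + 1) * w * (1 - w\<^sup>2) powr (\<mu> + 1 - 1)) = - 2 * (\<mu> + 1) * w * (1 - w\<^sup>2) powr (\<mu> + 1)"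
      by algebra
  qed (use D1_square in auto)
  also have "\<dots> \<noteq> 0"
  proof -
    have "((\<lambda>z. reg_hyp2F1 ((\<nu> + \<mu> + 2) / 2) ((\<mu> - \<nu> + 1) / 2) (3 / 2) (z\<^sup>2)) has_field_derivative
        deriv (reg_hyp2F1 ((\<nu> + \<mu> + 2) / 2) ((\<mu> - \<nu> + 1) / 2) (3 / 2)) (0\<^sup>2) * 0) (at 0)"
      by (rule DERIV_chain2[where g = "\<lambda>z. z\<^sup>2", OF reg_hyp2F1_derivs(1)[OF D1_square(1)[OF 0]]])
         (auto intro!: derivative_eq_intros)
    from DERIV_mult[OF DERIV_ident this] have "deriv (legendre_odd \<nu> \<mu>) 0 = rGamma (3 / 2)"
      unfolding legendre_odd_def[abs_def] by (intro DERIV_imp_deriv) (simp add: reg_hyp2F1_0)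
    moreover have "rGamma (3 / 2 :: complex) \<noteq> 0" "rGamma (1 / 2 :: complex) \<noteq> 0"
      unfolding rGamma_eq_zero_iff by (rule Re_pos_not_nonpos_Int, simp)+
    ultimately show ?thesis by (simp add: legendre_odd_def legendre_even_def reg_hyp2F1_0)
  qed
  finally show ?thesis by simp
qed

section \<open>Passage to the cut\<close>

text \<open>In either half plane the arguments of \<open>1 - z\<close> and \<open>1 + z\<close> have
  opposite signs, so their logarithms add up to the principal logarithm of
  \<open>1 - z\<^sup>2\<close>. Replacing \<open>1 - z\<close> by \<open>z - 1\<close> adds
  \<open>s * \<i> * pi\<close> and so produces the phase.\<close>

lemma sq_powr_half_plane:
  assumes "s = 1 \<or> s = - 1" "s * Im z > 0"
  shows "sq_powr m z = exp (of_real s * (\<i> * of_real pi * m)) * (1 - z\<^sup>2) powr m"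
proof -
  have z: "z \<noteq> 1" "z \<noteq> - 1" using assms(2) by auto
  have nz: "1 - z \<noteq> 0" "1 + z \<noteq> 0" "z - 1 \<noteq> 0" "z + 1 \<noteq> 0" "1 - z\<^sup>2 \<noteq> 0"
  proof -
    show 1: "1 - z \<noteq> 0" "z - 1 \<noteq> 0" using z(1) by simp_all
    show 2: "1 + z \<noteq> 0" using z(2) by (simp add: add_eq_0_iff)
    then show "z + 1 \<noteq> 0" by (simp only: add.commute not_False_eq_True)
    have "1 - z\<^sup>2 = (1 - z) * (1 + z)" by (simp add: power2_eq_square algebra_simps)
    with 1 2 show "1 - z\<^sup>2 \<noteq> 0" by (simp only: mult_eq_0_iff simp_thms)
  qed
  have b: "- pi < Im (Ln (1 - z))" "Im (Ln (1 - z)) \<le> pi" "- pi < Im (Ln (1 + z))" "Im (Ln (1 + z)) \<le> pi"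
    by (intro mpi_less_Im_Ln Im_Ln_le_pi nz)+
  have iff: "0 \<le> Im (Ln (1 - z)) \<longleftrightarrow> Im z \<le> 0" "0 < Im (Ln (1 - z)) \<and> Im (Ln (1 - z)) < pi \<longleftrightarrow> Im z < 0"
    "0 \<le> Im (Ln (1 + z)) \<longleftrightarrow> 0 \<le> Im z" "0 < Im (Ln (1 + z)) \<and> Im (Ln (1 + z)) < pi \<longleftrightarrow> 0 < Im z"
    using Im_Ln_pos_le[OF nz(1)] Im_Ln_pos_le[OF nz(2)] Im_Ln_pos_lt[OF nz(1)] Im_Ln_pos_lt[OF nz(2)] b(2,4) by simp_all
  have sgn: "s * Im (Ln (1 - z)) < 0 \<and> 0 < s * Im (Ln (1 + z))"
  proof (cases "s = 1")
    case True
    then have "0 < Im z" using assms(2) by simp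
    then have "\<not> 0 \<le> Im (Ln (1 - z))" "0 < Im (Ln (1 + z))" using iff by auto
    then show ?thesis using True by simp
  next
    case False
    then have "s = - 1" "Im z < 0" using assms by auto
    then have "0 < Im (Ln (1 - z))" "\<not> 0 \<le> Im (Ln (1 + z))" using iff by auto
    then show ?thesis using \<open>s = - 1\<close> by simp
  qed
  have "Ln ((1 - z) * (1 + z)) = Ln (1 - z) + Ln (1 + z)"
    using sgn assms(1) b by (intro Ln_times_simple nz) auto
  moreover have "(1 - z) * (1 + z) = 1 - z\<^sup>2" by (simp add: power2_eq_square algebra_simps)
  moreover have "Ln (z - 1) = Ln (1 - z) + of_real s * (\<i> * of_real pi)"
    using Ln_minus[of "1 - z"] nz assms by auto
  moreover have "Ln (z + 1) = Ln (1 + z)" by (simp add: add.commute)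
  ultimately have "m * Ln (z - 1) + m * Ln (z + 1) = of_real s * (\<i> * of_real pi * m) + m * Ln (1 - z\<^sup>2)"
    by (simp add: algebra_simps)
  then show ?thesis using nz by (simp add: sq_powr_def powr_def flip: exp_add)
qed

lemma legendre_Q_eq:
  assumes "z \<in> cut_plane"
  shows "legendre_Q \<nu> \<mu> z = of_real (sqrt pi) * exp (\<i> * of_real pi * \<mu>) * Gamma (\<nu> + \<mu> + 1) / 2 powr (\<nu> + 1)
     * (sq_powr (\<mu> / 2) z * legendre_Q_kernel \<nu> \<mu> z)"
proof -
  have "z powr (- (\<nu> + \<mu> + 1)) = 1 / z powr (\<nu> + \<mu> + 1)"
    by (simp only: powr_minus inverse_eq_divide)
  then show ?thesis
    unfolding legendre_Q_def legendre_Q_kernel_def hyp2F1_over_Gamma_eq[OF cut_plane_facts(8)[OF assms]] sq_powr_def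
    by (simp add: mult_ac)
qed

text \<open>The half planes \<open>Im z > 0\<close> and \<open>Im z < 0\<close> are treated together, as \<open>s * Im z > 0\<close> with \<open>s = 1\<close> and \<open>s = - 1\<close>.\<close>
lemma legendre_Q_kernel_continuation:
  fixes \<mu> \<nu> :: complex
  assumes s: "s = 1 \<or> s = - 1" and \<mu>: "\<mu> \<notin> \<int>"
  defines "A \<equiv> Gamma (1 + \<mu>) * (Gamma (- \<mu>) * rGamma ((\<nu> - \<mu> + 2) / 2) * rGamma ((\<nu> - \<mu> + 1) / 2))"
    and "B \<equiv> Gamma (1 - \<mu>) * (Gamma \<mu> * rGamma ((\<nu> + \<mu> + 2) / 2) * rGamma ((\<nu> + \<mu> + 1) / 2))"
  obtains w where "w holomorphic_on D1" "\<And>z. s * Im z > 0 \<Longrightarrow> legendre_Q_kernel \<nu> \<mu> z = w z"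
    "\<And>z. z \<in> D1_plus \<Longrightarrow> w z = A * legendre_regular \<nu> \<mu> z
       + B * exp (- of_real s * (\<i> * of_real pi * \<mu>)) * ((1 - z\<^sup>2) powr (- \<mu>) * legendre_regular \<nu> (- \<mu>) z)"
proof -
  define S where "S = {z. s * Im z > 0}"
  have S: "open S" "connected S" "S \<subseteq> D1" "S \<subseteq> cut_plane"
  proof -
    have "S = {z. Im z > 0} \<or> S = {z. Im z < 0}" using s by (auto simp: S_def)
    then show "open S" "connected S"
      by (auto simp: open_halfspace_Im_gt open_halfspace_Im_lt convex_halfspace_Im_gt convex_halfspace_Im_lt convex_connected)
    show "S \<subseteq> D1" "S \<subseteq> cut_plane"
      using s unfolding S_def by (auto simp: D1_iff cut_plane_iff simp del: Compl_iff)
  qed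
  \<comment> \<open>Both basis functions live on all of \<open>D1\<close>, so this representation in
    one half plane already is the continuation across the interval.\<close>
  have "\<exists>\<alpha> \<beta>. \<forall>z\<in>S. legendre_Q_kernel \<nu> \<mu> z = \<alpha> * legendre_even \<nu> \<mu> z + \<beta> * legendre_odd \<nu> \<mu> z"
  proof (rule gegenbauer_solution_span[OF _ _ _ S(1,2)])
    show "gegenbauer_solution \<nu> \<mu> S (legendre_Q_kernel \<nu> \<mu>)" "gegenbauer_solution \<nu> \<mu> S (legendre_even \<nu> \<mu>)"
      "gegenbauer_solution \<nu> \<mu> S (legendre_odd \<nu> \<mu>)"
      using S legendre_Q_kernel_solution legendre_even_solution legendre_odd_solution gegenbauer_solution_subset by blast+
    fix w assume "w \<in> S"
    then have w: "w \<in> D1" "w \<in> cut_plane" using S by auto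
    show "(sq_powr (\<mu> + 1) has_field_derivative 2 * (\<mu> + 1) * w * sq_powr (\<mu> + 1 - 1) w) (at w)"
      by (rule sq_powr_deriv[OF w(2)])
    show "(1 - w\<^sup>2) * (2 * (\<mu> + 1) * w * sq_powr (\<mu> + 1 - 1) w) = - 2 * (\<mu> + 1) * w * sq_powr (\<mu> + 1) w"
      unfolding sq_powr_minus_1[OF w(2), of "\<mu> + 1"] by algebra
    show "w\<^sup>2 \<noteq> 1" "sq_powr (\<mu> + 1) w \<noteq> 0" using w cut_plane_facts sq_powr_nonzero by blast+
    show "legendre_even \<nu> \<mu> w * deriv (legendre_odd \<nu> \<mu>) w - deriv (legendre_even \<nu> \<mu>) w * legendre_odd \<nu> \<mu> w \<noteq> 0"
      by (rule legendre_even_odd_wronskian[OF w(1)])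
  qed
  then obtain \<alpha> \<beta> where ab: "\<And>z. z \<in> S \<Longrightarrow> legendre_Q_kernel \<nu> \<mu> z = \<alpha> * legendre_even \<nu> \<mu> z + \<beta> * legendre_odd \<nu> \<mu> z"
    by blast
  define w where "w = (\<lambda>z. \<alpha> * legendre_even \<nu> \<mu> z + \<beta> * legendre_odd \<nu> \<mu> z)"
  have whol: "w holomorphic_on D1"
    using legendre_even_solution legendre_odd_solution unfolding w_def gegenbauer_solution_def
    by (intro holomorphic_on_add holomorphic_on_mult holomorphic_on_const) auto
  have wS: "legendre_Q_kernel \<nu> \<mu> z = w z" if "s * Im z > 0" for z using ab[of z] that by (simp add: w_def S_def)
  define h where "h = (\<lambda>z. A * legendre_regular \<nu> \<mu> z
       + B * exp (- of_real s * (\<i> * of_real pi * \<mu>)) * ((1 - z\<^sup>2) powr (- \<mu>) * legendre_regular \<nu> (- \<mu>) z))"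
  have D1p: "open D1_plus" "connected D1_plus" "D1_plus \<subseteq> D1" "D1_plus \<subseteq> right_half_plane"
    unfolding D1_plus_def using open_D1 connected_D1_Int[OF convex_halfspace_Re_gt, of "1 / 2" 0]
    by (auto intro!: open_Int open_halfspace_Re_gt)
  have hol: "(\<lambda>z. w z - h z) holomorphic_on D1_plus"
  proof -
    have "legendre_regular \<nu> m holomorphic_on D1_plus" for m
      using legendre_regular_holomorphic D1p(4) by (rule holomorphic_on_subset)
    moreover have "(\<lambda>z. (1 - z\<^sup>2) powr (- \<mu>)) holomorphic_on D1_plus"
      using one_minus_square_powr_holomorphic D1p(3) by (rule holomorphic_on_subset)
    moreover have "w holomorphic_on D1_plus" using whol D1p(3) by (rule holomorphic_on_subset)
    ultimately show ?thesis
      unfolding h_def by (intro holomorphic_on_diff holomorphic_on_add holomorphic_on_mult holomorphic_on_const) auto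
  qed
  \<comment> \<open>In this open quarter plane the expansion at 1 holds as well, with the power of
    \<open>z\<^sup>2 - 1\<close> rewritten by its phase; the identity theorem then spreads the
    equality over \<open>D1_plus\<close>.\<close>
  have eq: "w z - h z = 0" if "z \<in> S \<inter> D1_plus" for z
  proof -
    have z: "z \<in> cut_plane" "Re z > 0" "s * Im z > 0" using that S by (auto simp: D1_plus_def S_def)
    have "sq_powr (- \<mu>) z = exp (- of_real s * (\<i> * of_real pi * \<mu>)) * (1 - z\<^sup>2) powr (- \<mu>)"
      using sq_powr_half_plane[OF s z(3), of "- \<mu>"] by simp
    then have "legendre_Q_kernel \<nu> \<mu> z = h z"
      unfolding legendre_Q_kernel_expansion[OF \<mu> z(1,2)] h_def A_def B_def by (simp add: mult_ac)
    then show ?thesis using wS[OF z(3)] by simp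
  qed
  have wh: "w z = h z" if "z \<in> D1_plus" for z
  proof -
    define p where "p = Complex 1 s"
    have p: "p \<in> S \<inter> D1_plus" using s by (auto simp: p_def S_def D1_plus_def D1_iff)
    have "w z - h z = 0"
    proof (rule analytic_continuation[OF hol D1p(1,2) _ _ _ eq that])
      show "S \<inter> D1_plus \<subseteq> D1_plus" "p \<in> D1_plus" using p by auto
      show "p islimpt S \<inter> D1_plus"
        using p S(1) D1p(1) by (intro interior_limit_point) (simp add: interior_open open_Int)
    qed
    then show ?thesis by simp
  qed
  show ?thesis by (rule that[OF whol wS]) (use wh in \<open>auto simp: h_def\<close>)
qed

text \<open>In the half plane \<open>legendre_Q\<close> coincides with a function that is continuous
  on \<open>D1\<close>, so its boundary value is the value of that function. The phase with
  \<open>\<mu> / 2\<close> comes from the elementary factor of \<open>legendre_Q\<close>.\<close>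

lemma Lim_legendre_Q:
  assumes s: "s = 1 \<or> s = - 1" and w: "w holomorphic_on D1" "\<And>z. s * Im z > 0 \<Longrightarrow> legendre_Q_kernel \<nu> \<mu> z = w z"
    and x: "x \<in> D1" "Im x = 0"
  shows "Lim (at x within {z. s * Im z > 0}) (legendre_Q \<nu> \<mu>)
    = of_real (sqrt pi) * exp (\<i> * of_real pi * \<mu>) * Gamma (\<nu> + \<mu> + 1) / 2 powr (\<nu> + 1)
      * (exp (of_real s * (\<i> * of_real pi * \<mu> / 2)) * (1 - x\<^sup>2) powr (\<mu> / 2) * w x)"
proof (rule tendsto_Lim)
  define S where "S = {z. s * Im z > 0}"
  have "x islimpt S"
    unfolding islimpt_approachable
  proof (intro allI impI)
    fix e :: real assume "e > 0"
    then show "\<exists>x'\<in>S. x' \<noteq> x \<and> dist x' x < e"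
      using s x by (intro bexI[of _ "x + of_real (s * e / 2) * \<i>"]) (auto simp: dist_norm S_def norm_mult)
  qed
  then show "\<not> trivial_limit (at x within {z. s * Im z > 0})" by (simp add: trivial_limit_within S_def)
  define K where "K = of_real (sqrt pi) * exp (\<i> * of_real pi * \<mu>) * Gamma (\<nu> + \<mu> + 1) / 2 powr (\<nu> + 1)"
  define f where "f = (\<lambda>z. K * (exp (of_real s * (\<i> * of_real pi * \<mu> / 2)) * (1 - z\<^sup>2) powr (\<mu> / 2) * w z))"
  have "f holomorphic_on D1"
    unfolding f_def by (rule holomorphic_on_mult holomorphic_on_const w(1) one_minus_square_powr_holomorphic)+
  then have "continuous_on D1 f" by (rule holomorphic_on_imp_continuous_on)
  then have "isCont f x" using x(1) by (simp only: continuous_on_eq_continuous_at[OF open_D1])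
  then have "(f \<longlongrightarrow> f x) (at x)" by (simp only: isCont_def)
  then have "(f \<longlongrightarrow> f x) (at x within S)" by (rule tendsto_within_subset) simp
  moreover have "\<forall>\<^sub>F z in at x within S. f z = legendre_Q \<nu> \<mu> z"
    unfolding eventually_at_filter
  proof (intro always_eventually allI impI)
    fix z assume "z \<in> S"
    then have z: "s * Im z > 0" by (simp add: S_def)
    then have "z \<in> cut_plane" using s by (auto simp: cut_plane_iff simp del: Compl_iff)
    then have "legendre_Q \<nu> \<mu> z = K * (sq_powr (\<mu> / 2) z * w z)"
      by (simp only: legendre_Q_eq K_def w(2)[OF z])
    moreover have "sq_powr (\<mu> / 2) z = exp (of_real s * (\<i> * of_real pi * \<mu> / 2)) * (1 - z\<^sup>2) powr (\<mu> / 2)"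
      using sq_powr_half_plane[OF s z, of "\<mu> / 2"] by (simp only: times_divide_eq_right)
    ultimately show "f z = legendre_Q \<nu> \<mu> z" by (simp only: f_def)
  qed
  ultimately have "(legendre_Q \<nu> \<mu> \<longlongrightarrow> f x) (at x within S)" by (rule Lim_transform_eventually)
  then show "(legendre_Q \<nu> \<mu> \<longlongrightarrow> of_real (sqrt pi) * exp (\<i> * of_real pi * \<mu>) * Gamma (\<nu> + \<mu> + 1) / 2 powr (\<nu> + 1)
      * (exp (of_real s * (\<i> * of_real pi * \<mu> / 2)) * (1 - x\<^sup>2) powr (\<mu> / 2) * w x)) (at x within {z. s * Im z > 0})"
    by (simp only: f_def K_def S_def)
qed

theorem theorem4p1:
  fixes x \<nu> \<mu> :: complex
  assumes "x \<in> D1_plus"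
    and "\<mu> \<notin> \<int>"
    and "\<forall>n::nat. n \<ge> 1 \<longrightarrow> \<nu> + \<mu> \<noteq> - of_nat n"
  shows "ferrers_Q \<nu> \<mu> x =
      2 powr (\<mu> - 1) * Gamma \<mu> * cos (of_real pi * \<mu>) / (1 - x\<^sup>2) powr (\<mu> / 2)
        * hyp2F1 ((\<nu> - \<mu> + 1) / 2) ((- \<nu> - \<mu>) / 2) (1 - \<mu>) (1 - x\<^sup>2)
    + Gamma (- \<mu>) * Gamma (\<nu> + \<mu> + 1) * (1 - x\<^sup>2) powr (\<mu> / 2)
        / 2 powr (1 + \<mu>) * rGamma (\<nu> - \<mu> + 1)
        * hyp2F1 ((\<nu> + \<mu> + 1) / 2) ((\<mu> - \<nu>) / 2) (1 + \<mu>) (1 - x\<^sup>2)"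
proof -
  define e where "e = \<i> * of_real pi * \<mu>"
  define K where "K = of_real (sqrt pi) * Gamma (\<nu> + \<mu> + 1) / 2 powr (\<nu> + 1)"
  define A where "A = Gamma (1 + \<mu>) * (Gamma (- \<mu>) * rGamma ((\<nu> - \<mu> + 2) / 2) * rGamma ((\<nu> - \<mu> + 1) / 2))"
  define B where "B = Gamma (1 - \<mu>) * (Gamma \<mu> * rGamma ((\<nu> + \<mu> + 2) / 2) * rGamma ((\<nu> + \<mu> + 1) / 2))"
  define u where "u = legendre_regular \<nu> \<mu> x"
  define v where "v = legendre_regular \<nu> (- \<mu>) x"
  obtain w1 where w1: "w1 holomorphic_on D1" "\<And>z. 1 * Im z > 0 \<Longrightarrow> legendre_Q_kernel \<nu> \<mu> z = w1 z"
    "\<And>z. z \<in> D1_plus \<Longrightarrow> w1 z = A * legendre_regular \<nu> \<mu> z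
       + B * exp (- of_real 1 * (\<i> * of_real pi * \<mu>)) * ((1 - z\<^sup>2) powr (- \<mu>) * legendre_regular \<nu> (- \<mu>) z)"
    unfolding A_def B_def by (rule legendre_Q_kernel_continuation[OF _ assms(2), of 1 \<nu>]) auto
  obtain w2 where w2: "w2 holomorphic_on D1" "\<And>z. - 1 * Im z > 0 \<Longrightarrow> legendre_Q_kernel \<nu> \<mu> z = w2 z"
    "\<And>z. z \<in> D1_plus \<Longrightarrow> w2 z = A * legendre_regular \<nu> \<mu> z
       + B * exp (- of_real (- 1) * (\<i> * of_real pi * \<mu>)) * ((1 - z\<^sup>2) powr (- \<mu>) * legendre_regular \<nu> (- \<mu>) z)"
    unfolding A_def B_def by (rule legendre_Q_kernel_continuation[OF _ assms(2), of "- 1" \<nu>]) auto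
  have x: "x \<in> D1" "Re x > 0" using assms(1) by (auto simp: D1_plus_def)
  \<comment> \<open>The exponentials in \<open>ferrers_Q_interval\<close> cancel exactly the factor
    \<open>exp e\<close> of \<open>legendre_Q\<close> and the phases \<open>exp (e / 2)\<close>,
    \<open>exp (- (e / 2))\<close> of the two limits. What remains is an expression holomorphic on
    \<open>D1\<close>, which is the required continuation.\<close>
  have "ferrers_Q \<nu> \<mu> x = 1 / 2 * K * (1 - x\<^sup>2) powr (\<mu> / 2) * (w1 x + w2 x)"
    unfolding ferrers_Q_def
  proof (rule analytic_extension_eq[OF open_D1 connected_D1 _ _ _ _ _ x(1), of _ 0])
    show "complex_of_real ` {-1<..<1} \<subseteq> D1" "0 \<in> D1" by (auto simp: D1_iff)
    show "0 islimpt complex_of_real ` {-1<..<1}"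
      unfolding islimpt_approachable
    proof (intro allI impI)
      fix d :: real assume "d > 0"
      then show "\<exists>x'\<in>complex_of_real ` {-1<..<1}. x' \<noteq> 0 \<and> dist x' 0 < d"
        by (intro bexI[of _ "of_real (min (1 / 2) (d / 2))"] imageI conjI) (auto simp: min_def)
    qed
    show "(\<lambda>x. 1 / 2 * K * (1 - x\<^sup>2) powr (\<mu> / 2) * (w1 x + w2 x)) holomorphic_on D1"
      by (intro holomorphic_on_mult holomorphic_on_add holomorphic_on_const w1(1) w2(1) one_minus_square_powr_holomorphic)
    fix z assume "z \<in> complex_of_real ` {-1<..<1}"
    then have z: "z \<in> D1" "Im z = 0" by (auto simp: D1_iff)
    have L1: "Lim (at z within {z. Im z > 0}) (legendre_Q \<nu> \<mu>) = K * exp e * (exp (e / 2) * (1 - z\<^sup>2) powr (\<mu> / 2) * w1 z)"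
      using Lim_legendre_Q[of 1, OF _ w1(1,2) z] by (simp add: K_def e_def mult_ac)
    have L2: "Lim (at z within {z. Im z < 0}) (legendre_Q \<nu> \<mu>) = K * exp e * (exp (- (e / 2)) * (1 - z\<^sup>2) powr (\<mu> / 2) * w2 z)"
      using Lim_legendre_Q[of "- 1", OF _ w2(1,2) z] by (simp add: K_def e_def mult_ac)
    have E: "exp (- (e / 2)) * exp (e / 2) = 1" "exp (- e) * exp e = 1" by (simp_all flip: exp_add)
    show "1 / 2 * K * (1 - z\<^sup>2) powr (\<mu> / 2) * (w1 z + w2 z) = ferrers_Q_interval \<nu> \<mu> z"
      unfolding ferrers_Q_interval_def L1 L2 e_def[symmetric] using E by algebra
  qed
  also have "w1 x + w2 x = 2 * A * u + 2 * B * cos (of_real pi * \<mu>) * ((1 - x\<^sup>2) powr (- \<mu>) * v)"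
  proof -
    have "2 * cos (of_real pi * \<mu>) = exp e + exp (- e)"
      by (simp add: cos_exp_eq e_def mult_ac)
    then show ?thesis unfolding w1(3)[OF assms(1)] w2(3)[OF assms(1)] u_def[symmetric] v_def[symmetric] e_def[symmetric]
      by (simp add: algebra_simps)
  qed
  finally have F: "ferrers_Q \<nu> \<mu> x = K * A * u * (1 - x\<^sup>2) powr (\<mu> / 2)
     + K * B * cos (of_real pi * \<mu>) * v * ((1 - x\<^sup>2) powr (\<mu> / 2) * (1 - x\<^sup>2) powr (- \<mu>))"
    by (simp add: algebra_simps)
  have pw: "(1 - x\<^sup>2) powr (\<mu> / 2) * (1 - x\<^sup>2) powr (- \<mu>) = 1 / (1 - x\<^sup>2) powr (\<mu> / 2)"
  proof -
    have "\<mu> / 2 + - \<mu> = - (\<mu> / 2)" by simp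
    then have "(1 - x\<^sup>2) powr (\<mu> / 2) * (1 - x\<^sup>2) powr (- \<mu>) = (1 - x\<^sup>2) powr (- (\<mu> / 2))"
      by (simp only: powr_add[symmetric])
    then show ?thesis by (simp only: powr_minus inverse_eq_divide)
  qed
  have nonint: "1 + \<mu> \<notin> \<int>\<^sub>\<le>\<^sub>0" "1 - \<mu> \<notin> \<int>\<^sub>\<le>\<^sub>0"
    using assms(2) Ints_diff[of "1 + \<mu>" 1] Ints_diff[of 1 "1 - \<mu>"] nonpos_Ints_Int by auto
  note slit = one_minus_square_in_slit_plane[OF x(2)]
  have h1: "hyp2F1 ((\<nu> + \<mu> + 1) / 2) ((\<mu> - \<nu>) / 2) (1 + \<mu>) (1 - x\<^sup>2) = Gamma (1 + \<mu>) * u"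
    unfolding u_def legendre_regular_def by (rule hyp2F1_eq[OF nonint(1) slit])
  have h2: "hyp2F1 ((\<nu> - \<mu> + 1) / 2) ((- \<nu> - \<mu>) / 2) (1 - \<mu>) (1 - x\<^sup>2) = Gamma (1 - \<mu>) * v"
  proof -
    have "(- \<mu> - \<nu>) / 2 = (- \<nu> - \<mu>) / 2" by simp
    then have "v = reg_hyp2F1 ((\<nu> - \<mu> + 1) / 2) ((- \<nu> - \<mu>) / 2) (1 - \<mu>) (1 - x\<^sup>2)"
      unfolding v_def legendre_regular_def by (simp only: add_uminus_conv_diff)
    then show ?thesis using hyp2F1_eq[OF nonint(2) slit] by simp
  qed
  have np: "\<nu> + \<mu> + 1 \<notin> \<int>\<^sub>\<le>\<^sub>0"
  proof
    assume "\<nu> + \<mu> + 1 \<in> \<int>\<^sub>\<le>\<^sub>0"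
    then obtain n where "\<nu> + \<mu> + 1 = - of_nat n" by (auto elim!: nonpos_Ints_cases')
    then have eq: "\<nu> + \<mu> = - of_nat (Suc n)" by (simp add: algebra_simps eq_neg_iff_add_eq_0)
    have "Suc n \<ge> 1" by simp
    with assms(3) have "\<nu> + \<mu> \<noteq> - of_nat (Suc n)" by blast
    then show False using eq by contradiction
  qed
  define T where "T = (2 :: complex) powr (\<nu> + 1)"
  define sp where "sp = complex_of_real (sqrt pi)"
  \<comment> \<open>The constants are compared after multiplication by \<open>T\<close>, which
    removes the denominator of \<open>K\<close>.\<close>
  have T: "T \<noteq> 0" by (simp add: T_def)
  then have K: "K * T = sp * Gamma (\<nu> + \<mu> + 1)" by (simp add: K_def T_def sp_def)
  have dup: "rGamma ((t + 1) / 2) * rGamma (t / 2) * sp = 2 powr (t - 1) * rGamma t" for t :: complex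
  proof -
    have e: "exp ((1 - t) * of_real (ln 2)) = 2 powr (1 - t)"
      using Ln_of_real[of 2] by (simp add: powr_def)
    have h: "t / 2 + 1 / 2 = (t + 1) / 2" by (simp add: add_divide_distrib)
    have D: "2 powr (1 - t) * sp * rGamma (t / 2) * rGamma ((t + 1) / 2) = rGamma t"
      using rGamma_legendre_duplication[of "t / 2"] unfolding h by (simp add: e sp_def)
    have "2 powr (t - 1) * 2 powr (1 - t) = (1 :: complex)" by (simp flip: powr_add)
    then show ?thesis using D by algebra
  qed
  \<comment> \<open>Duplication at \<open>t = \<nu> + \<mu> + 1\<close> merges the two reciprocal
    Gamma values of \<open>B\<close> with \<open>sqrt pi\<close> into
    \<open>rGamma (\<nu> + \<mu> + 1)\<close>. This cancels
    \<open>Gamma (\<nu> + \<mu> + 1)\<close>, a step that rests on \<open>\<nu> + \<mu>\<close> not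
    being a negative integer.\<close>
  have KB: "K * B = 2 powr (\<mu> - 1) * Gamma \<mu> * Gamma (1 - \<mu>)"
  proof -
    have G: "Gamma (\<nu> + \<mu> + 1) * rGamma (\<nu> + \<mu> + 1) = 1"
      using np by (simp add: rGamma_inverse_Gamma Gamma_eq_zero_iff)
    have P: "2 powr (\<nu> + \<mu> + 1 - 1) = 2 powr (\<mu> - 1) * T"
      unfolding T_def powr_add[symmetric] by (simp add: algebra_simps)
    have t: "(\<nu> + \<mu> + 2) / 2 = (\<nu> + \<mu> + 1 + 1) / 2" by simp
    have "K * B * T = 2 powr (\<mu> - 1) * Gamma \<mu> * Gamma (1 - \<mu>) * T"
      using K G P dup[of "\<nu> + \<mu> + 1"] unfolding B_def t by algebra
    then show ?thesis using T by simp
  qed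
  \<comment> \<open>Duplication is now taken at \<open>t = \<nu> - \<mu> + 1\<close>. Nothing
    cancels, and \<open>rGamma (\<nu> - \<mu> + 1)\<close> stays in the result, possibly as
    0.\<close>
  have KA: "K * A = Gamma (- \<mu>) * Gamma (\<nu> + \<mu> + 1) / 2 powr (1 + \<mu>) * rGamma (\<nu> - \<mu> + 1) * Gamma (1 + \<mu>)"
  proof -
    define T2 where "T2 = (2 :: complex) powr (1 + \<mu>)"
    have T2: "T2 \<noteq> 0" by (simp add: T2_def)
    have P: "2 powr (\<nu> - \<mu> + 1 - 1) * T2 = T"
      unfolding T_def T2_def powr_add[symmetric] by (simp add: algebra_simps)
    have t: "(\<nu> - \<mu> + 2) / 2 = (\<nu> - \<mu> + 1 + 1) / 2" by simp
    have "(K * A * T2) * T = (Gamma (- \<mu>) * Gamma (\<nu> + \<mu> + 1) * rGamma (\<nu> - \<mu> + 1) * Gamma (1 + \<mu>)) * T"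
      using K P dup[of "\<nu> - \<mu> + 1"] unfolding A_def t by algebra
    then have "K * A * T2 = Gamma (- \<mu>) * Gamma (\<nu> + \<mu> + 1) * rGamma (\<nu> - \<mu> + 1) * Gamma (1 + \<mu>)"
      using T by simp
    then have "K * A = Gamma (- \<mu>) * Gamma (\<nu> + \<mu> + 1) * rGamma (\<nu> - \<mu> + 1) * Gamma (1 + \<mu>) / T2"
      by (metis T2 nonzero_mult_div_cancel_right)
    then show ?thesis by (simp add: T2_def)
  qed
  show ?thesis unfolding F pw h1 h2 KA KB by (simp add: mult_ac)
qed

end
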